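(* Let $(G,\mathfrak g,\|\cdot\|)$ be a Finsler Lie group with a strongly convex norm. Let $\gamma_1,\gamma_2:[0,1]\to G$ be normal curves. If there exists $t\in[0,1]$ such that $\gamma_1(t)=\gamma_2(t)$, $\dot\gamma_1(t)=\dot\gamma_2(t)$ and $\|\cdot\|$ is differentiable at $\mathrm dL_{\gamma_1(t)}^{-1}\dot\gamma_1(t)$, then $\gamma_1=\gamma_2$. In particular, in every Finsler Lie group with a strongly convex norm that is differentiable outside $0$, there is no branching of normal curves.
   Context: A Finsler Lie group $(G,\mathfrak g,\|\cdot\|)$ is a Lie group $G$ with a norm $\|\cdot\|$ on its whole Lie algebra $\mathfrak g$. For an absolutely continuous curve $\gamma:I\to G$ on an interval $I$, the control is $u(t)=\mathrm dL_{\gamma(t)}^{-1}\dot\gamma(t)\in\mathfrak g$ ($L$ = left translation). The energy is $\mathrm E:\mathfrak g\to\mathbb R$, $\mathrm E(v)=\frac12\|v\|^2$. The subdifferential of $\mathrm E$ at $w$ is $\partial_w\mathrm E=\{\eta\in \mathfrak g^*:\eta(v-w)\le \mathrm E(v)-\mathrm E(w)\ \forall v\in \mathfrak g\}$. An absolutely continuous curve $\gamma:I\to G$ with control $u\in L^2(I,\mathfrak g)$ is a normal curve if there exists $\lambda\in\mathfrak g^*$ with $\lambda\circ\mathrm{Ad}_{\gamma(t)}\in\partial_{u(t)}\mathrm E$ for a.e. $t\in I$. For strongly convex norms, normal curves are of class $C^{1,1}$, so pointwise derivatives make sense. The norm is strongly convex if its energy is strongly convex, i.e. there is a Euclidean norm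 $N$ on $\mathfrak g$ such that $\mathrm E(tv+(1-t)w)\le t\mathrm E(v)+(1-t)\mathrm E(w)-t(1-t)N(w-v)^2$ for all $v,w\in \mathfrak g$, $t\in[0,1]$. There is branching of normal curves in $G$ if there exist two different normal curves $\gamma_1,\gamma_2:I\to G$ on an interval $I\subseteq\mathbb R$ and an interval $J\subseteq I$ with non-empty interior such that $\gamma_1|_J=\gamma_2|_J$. *)

theory Defs
  imports "HOL-Analysis.Analysis" "HOL-Algebra.Group"
begin

section \<open>Smooth manifolds\<close>

text \<open>Charts take values in a finite-dimensional normed space \<open>'e\<close>. The sort
  \<open>{real_normed_vector, heine_borel, second_countable_topology}\<close> holds for every such space
  (and \<open>heine_borel\<close> forces finite dimension); unlike \<open>euclidean_space\<close> it allows dimension 0.\<close>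

text \<open>Class \<open>C^k\<close> on an open set. In finite dimension, continuity of all iterated directional
  derivatives \<open>x \<mapsto> Df(x) v\<close> is continuity of the iterated Frechet derivatives.\<close>

primrec Ck_on :: "nat \<Rightarrow> ('a::real_normed_vector \<Rightarrow> 'b::real_normed_vector) \<Rightarrow> 'a set \<Rightarrow> bool" where
  "Ck_on 0 f S \<longleftrightarrow> continuous_on S f"
| "Ck_on (Suc k) f S \<longleftrightarrow> (\<forall>x\<in>S. f differentiable (at x)) \<and>
     (\<forall>v. Ck_on k (\<lambda>x. frechet_derivative f (at x) v) S)"

definition smooth_on :: "('a::real_normed_vector \<Rightarrow> 'b::real_normed_vector) \<Rightarrow> 'a set \<Rightarrow> bool" where
  "smooth_on f S \<longleftrightarrow> (\<forall>k. Ck_on k f S)"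

type_synonym ('m, 'e) chart = "'m set \<times> ('m \<Rightarrow> 'e)"

abbreviation chart_inv :: "('m, 'e) chart \<Rightarrow> 'e \<Rightarrow> 'm" where
  "chart_inv c \<equiv> inv_into (fst c) (snd c)"

definition is_chart :: "('m::topological_space, 'e::real_normed_vector) chart \<Rightarrow> bool" where
  "is_chart c \<longleftrightarrow> open (fst c) \<and> open (snd c ` fst c) \<and>
     homeomorphism (fst c) (snd c ` fst c) (snd c) (chart_inv c)"

definition smooth_atlas :: "('m::topological_space, 'e::real_normed_vector) chart set \<Rightarrow> bool" where
  "smooth_atlas A \<longleftrightarrow> (\<forall>c\<in>A. is_chart c) \<and> (\<Union>c\<in>A. fst c) = UNIV \<and>
     (\<forall>c\<in>A. \<forall>d\<in>A. smooth_on (snd d \<circ> chart_inv c) (snd c ` (fst c \<inter> fst d)))"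

definition prod_atlas ::
  "('m, 'e) chart set \<Rightarrow> ('n, 'f) chart set \<Rightarrow> ('m \<times> 'n, 'e \<times> 'f) chart set" where
  "prod_atlas A B = {(fst c \<times> fst d, map_prod (snd c) (snd d)) | c d. c \<in> A \<and> d \<in> B}"

definition smooth_map ::
  "('m::topological_space, 'e::real_normed_vector) chart set \<Rightarrow>
   ('n::topological_space, 'f::real_normed_vector) chart set \<Rightarrow> ('m \<Rightarrow> 'n) \<Rightarrow> bool" where
  "smooth_map A B f \<longleftrightarrow> continuous_on UNIV f \<and>
     (\<forall>c\<in>A. \<forall>d\<in>B. smooth_on (snd d \<circ> f \<circ> chart_inv c) (snd c ` (fst c \<inter> f -` fst d)))"

text \<open>The tangent space at \<open>p\<close> is represented by \<open>'e\<close>, through the differential at \<open>p\<close> of one chosen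
  chart around \<open>p\<close>. Differentials and velocities below are expressed in these identifications.\<close>

definition chart_at :: "('m, 'e) chart set \<Rightarrow> 'm \<Rightarrow> ('m, 'e) chart" where
  "chart_at A p = (SOME c. c \<in> A \<and> p \<in> fst c)"

definition differential ::
  "('m, 'e::real_normed_vector) chart set \<Rightarrow> ('n, 'f::real_normed_vector) chart set \<Rightarrow>
   ('m \<Rightarrow> 'n) \<Rightarrow> 'm \<Rightarrow> 'e \<Rightarrow> 'f" where
  "differential A B f p =
     frechet_derivative (snd (chart_at B (f p)) \<circ> f \<circ> chart_inv (chart_at A p))
       (at (snd (chart_at A p) p))"

text \<open>At an endpoint of the interval \<open>I\<close> this is the one-sided derivative.\<close>

definition velocity ::
  "('m, 'e::real_normed_vector) chart set \<Rightarrow> real set \<Rightarrow> (real \<Rightarrow> 'm) \<Rightarrow> real \<Rightarrow> 'e" where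
  "velocity A I \<gamma> t = vector_derivative (snd (chart_at A (\<gamma> t)) \<circ> \<gamma>) (at t within I)"

text \<open>A pair \<open>(s, t)\<close> in \<open>D\<close> stands for the interval \<open>[s, t]\<close>.\<close>

definition abs_continuous_on :: "real \<Rightarrow> real \<Rightarrow> (real \<Rightarrow> 'e::real_normed_vector) \<Rightarrow> bool" where
  "abs_continuous_on a b f \<longleftrightarrow> (\<forall>\<epsilon>>0. \<exists>\<delta>>0. \<forall>D.
     finite D \<and> (\<forall>(s, t)\<in>D. a \<le> s \<and> s \<le> t \<and> t \<le> b) \<and>
     pairwise (\<lambda>p q. {fst p<..<snd p} \<inter> {fst q<..<snd q} = {}) D \<and>
     (\<Sum>(s, t)\<in>D. t - s) < \<delta>
     \<longrightarrow> (\<Sum>(s, t)\<in>D. norm (f t - f s)) < \<epsilon>)"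

definition abs_continuous_curve ::
  "('m::topological_space, 'e::real_normed_vector) chart set \<Rightarrow> real set \<Rightarrow> (real \<Rightarrow> 'm) \<Rightarrow> bool" where
  "abs_continuous_curve A I \<gamma> \<longleftrightarrow> continuous_on I \<gamma> \<and>
     (\<forall>c\<in>A. \<forall>a b. a \<le> b \<and> {a..b} \<subseteq> I \<and> \<gamma> ` {a..b} \<subseteq> fst c
        \<longrightarrow> abs_continuous_on a b (snd c \<circ> \<gamma>))"


section \<open>Norms and convexity on a finite-dimensional vector space\<close>

definition is_norm :: "('v::real_vector \<Rightarrow> real) \<Rightarrow> bool" where
  "is_norm n \<longleftrightarrow> (\<forall>v. 0 \<le> n v) \<and> (\<forall>v. n v = 0 \<longleftrightarrow> v = 0) \<and>
     (\<forall>a v. n (a *\<^sub>R v) = \<bar>a\<bar> * n v) \<and> (\<forall>v w. n (v + w) \<le> n v + n w)"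

definition is_euclidean_norm :: "('v::real_vector \<Rightarrow> real) \<Rightarrow> bool" where
  "is_euclidean_norm n \<longleftrightarrow> (\<exists>B. bilinear B \<and> (\<forall>v w. B v w = B w v) \<and>
     (\<forall>v. v \<noteq> 0 \<longrightarrow> 0 < B v v) \<and> (\<forall>v. n v = sqrt (B v v)))"

definition energy :: "('v \<Rightarrow> real) \<Rightarrow> 'v \<Rightarrow> real" where
  "energy n v = (n v)\<^sup>2 / 2"

definition strongly_convex_norm :: "('v::real_vector \<Rightarrow> real) \<Rightarrow> bool" where
  "strongly_convex_norm n \<longleftrightarrow> (\<exists>N. is_euclidean_norm N \<and>
     (\<forall>v w. \<forall>t\<in>{0..1}. energy n (t *\<^sub>R v + (1 - t) *\<^sub>R w)
        \<le> t * energy n v + (1 - t) * energy n w - t * (1 - t) * (N (w - v))\<^sup>2))"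

definition subdifferential :: "('v::real_vector \<Rightarrow> real) \<Rightarrow> 'v \<Rightarrow> ('v \<Rightarrow> real) set" where
  "subdifferential F w = {\<eta>. linear \<eta> \<and> (\<forall>v. \<eta> (v - w) \<le> F v - F w)}"


section \<open>Finsler Lie groups\<close>

record ('g, 'e) lie_group_structure = "'g monoid" +
  atlas :: "('g, 'e) chart set"

locale lie_group = group G
  for G :: "('g::{t2_space, second_countable_topology},
    'e::{real_normed_vector, heine_borel, second_countable_topology}) lie_group_structure"
    (structure) +
  assumes carrier_UNIV: "carrier G = UNIV"
    and finite_dim: "\<exists>B :: 'e set. finite B \<and> span B = UNIV"
    and smooth_atlas: "smooth_atlas (atlas G)"
    and smooth_mult:
      "smooth_map (prod_atlas (atlas G) (atlas G)) (atlas G) (\<lambda>(g, h). g \<otimes>\<^bsub>G\<^esub> h)"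
    and smooth_inv: "smooth_map (atlas G) (atlas G) (\<lambda>g. inv\<^bsub>G\<^esub> g)"

text \<open>The Lie algebra is the tangent space at the identity, hence represented by \<open>'e\<close>.\<close>

locale finsler_lie_group = lie_group G
  for G :: "('g::{t2_space, second_countable_topology},
    'e::{real_normed_vector, heine_borel, second_countable_topology}) lie_group_structure"
    (structure) +
  fixes nrm :: "'e \<Rightarrow> real"
  assumes is_norm: "is_norm nrm"

definition Ad :: "('g, 'e::real_normed_vector) lie_group_structure \<Rightarrow> 'g \<Rightarrow> 'e \<Rightarrow> 'e" where
  "Ad G g = differential (atlas G) (atlas G) (\<lambda>h. g \<otimes>\<^bsub>G\<^esub> h \<otimes>\<^bsub>G\<^esub> inv\<^bsub>G\<^esub> g) \<one>\<^bsub>G\<^esub>"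

text \<open>The inverse of \<open>dL_g\<close> is the differential at \<open>g\<close> of left translation by the inverse of \<open>g\<close>.\<close>

definition control ::
  "('g, 'e::real_normed_vector) lie_group_structure \<Rightarrow> real set \<Rightarrow> (real \<Rightarrow> 'g) \<Rightarrow> real \<Rightarrow> 'e" where
  "control G I \<gamma> t =
     differential (atlas G) (atlas G) (\<lambda>h. inv\<^bsub>G\<^esub> (\<gamma> t) \<otimes>\<^bsub>G\<^esub> h) (\<gamma> t)
       (velocity (atlas G) I \<gamma> t)"

definition normal_curve ::
  "('g::topological_space, 'e::real_normed_vector) lie_group_structure \<Rightarrow> ('e \<Rightarrow> real) \<Rightarrow>
   real set \<Rightarrow> (real \<Rightarrow> 'g) \<Rightarrow> bool" where
  "normal_curve G nrm I \<gamma> \<longleftrightarrow>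
     abs_continuous_curve (atlas G) I \<gamma> \<and>
     control G I \<gamma> \<in> borel_measurable (lebesgue_on I) \<and>
     integrable (lebesgue_on I) (\<lambda>t. (nrm (control G I \<gamma> t))\<^sup>2) \<and>
     (\<exists>\<xi>. linear \<xi> \<and>
        (AE t in lebesgue_on I. \<xi> \<circ> Ad G (\<gamma> t) \<in> subdifferential (energy nrm) (control G I \<gamma> t)))"

definition branching_of_normal_curves ::
  "('g::topological_space, 'e::real_normed_vector) lie_group_structure \<Rightarrow> ('e \<Rightarrow> real) \<Rightarrow> bool" where
  "branching_of_normal_curves G nrm \<longleftrightarrow>
     (\<exists>I J \<gamma>1 \<gamma>2. is_interval I \<and> is_interval J \<and> J \<subseteq> I \<and> interior J \<noteq> {} \<and>
        normal_curve G nrm I \<gamma>1 \<and> normal_curve G nrm I \<gamma>2 \<and>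
        (\<exists>t\<in>I. \<gamma>1 t \<noteq> \<gamma>2 t) \<and> (\<forall>t\<in>J. \<gamma>1 t = \<gamma>2 t))"

end

theory Submission
  imports Defs
begin

text \<open>The reason behind the theorem is that a normal curve is determined by its covector \<open>\<xi>\<close> and one of
  its points, because it solves an ordinary differential equation. Strong convexity makes the
  subdifferential of the energy strongly monotone, so the relation \<open>\<eta> \<in> \<partial>\<^sub>w E\<close> is the graph of a Lipschitz
  map \<open>\<eta> \<mapsto> w\<close>, called \<open>legendre\<close> below. The condition \<open>\<xi> \<circ> Ad \<gamma>(t) \<in> \<partial>\<^bsub>u(t)\<^esub> E\<close> therefore says that the
  control \<open>u(t)\<close> is the Legendre transform of \<open>\<xi> \<circ> Ad \<gamma>(t)\<close>, and \<open>\<gamma>\<close> is an integral curve of the locally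
  Lipschitz vector field \<open>g \<mapsto> dL\<^sub>g (legendre (\<xi> \<circ> Ad g))\<close>
  (\<open>normal_field_lip_near\<close>, \<open>normal_curve_integral_curve\<close>). Two normal curves with the same covector
  that meet are then equal (\<open>normal_curves_agree\<close>).

  It remains to compare the covectors \<open>\<xi>1\<close> and \<open>\<xi>2\<close> of two curves that have the same position \<open>g\<close> and
  the same control \<open>w\<close> at one time. Both \<open>\<xi>1 \<circ> Ad g\<close> and \<open>\<xi>2 \<circ> Ad g\<close> are subgradients of the energy at
  \<open>w\<close>. Where the norm is differentiable there is only one subgradient, and the same holds at
  the origin, where the energy is differentiable for every norm (\<open>subgradient_unique\<close>). Since \<open>Ad g\<close> is
  surjective, \<open>\<xi>1 = \<xi>2\<close>. Branching curves agree on an open interval, so they have the same position and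
  control at an interior time, which excludes branching.

  The differential equation holds a priori only almost everywhere, and only where the derivative of \<open>\<gamma>\<close>
  exists; at other times the velocity, and with it the control, has no meaning. That absolutely
  continuous curves are differentiable almost everywhere and are the integrals of their derivatives is
  thus an essential ingredient (\<open>abs_continuous_has_vector_derivative\<close>). It is obtained by
  writing an absolutely continuous function as a difference of monotone ones, applying
  the Radon--Nikodym theorem to their Stieltjes measures, and differentiating the resulting integrals.\<close>

section \<open>Absolutely continuous functions\<close>

definition nonoverlapping :: "real \<Rightarrow> real \<Rightarrow> (real \<times> real) set \<Rightarrow> bool" where
  "nonoverlapping a b D \<longleftrightarrow> finite D \<and> (\<forall>(s, t)\<in>D. a \<le> s \<and> s \<le> t \<and> t \<le> b) \<and>
     pairwise (\<lambda>p q. {fst p<..<snd p} \<inter> {fst q<..<snd q} = {}) D"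

lemma abs_continuous_on_nonoverlapping:
  "abs_continuous_on a b f \<longleftrightarrow> (\<forall>\<epsilon>>0. \<exists>\<delta>>0. \<forall>D.
     nonoverlapping a b D \<and> (\<Sum>(s, t)\<in>D. t - s) < \<delta> \<longrightarrow> (\<Sum>(s, t)\<in>D. norm (f t - f s)) < \<epsilon>)"
  unfolding abs_continuous_on_def nonoverlapping_def by (simp only: conj_assoc)

text \<open>Families of intervals arise below by cutting, clamping and merging, which may collapse several
  intervals to the same degenerate one. Since such intervals contribute nothing to the sums of interest,
  a family can be replaced by the set of its nondegenerate members.\<close>

lemma nonoverlapping_of_family:
  fixes s t :: "'k \<Rightarrow> real"
  assumes "finite K" and "\<And>i. i \<in> K \<Longrightarrow> a \<le> s i \<and> s i \<le> t i \<and> t i \<le> b"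
    and "\<And>i j. \<lbrakk>i \<in> K; j \<in> K; i \<noteq> j\<rbrakk> \<Longrightarrow> {s i<..<t i} \<inter> {s j<..<t j} = {}"
  shows "\<exists>D. nonoverlapping a b D \<and> (\<forall>h :: real \<Rightarrow> real \<Rightarrow> real. (\<forall>x. h x x = 0) \<longrightarrow>
    (\<Sum>(x, y)\<in>D. h x y) = (\<Sum>i\<in>K. h (s i) (t i)))"
proof (intro exI conjI allI impI)
  define K' where "K' = {i \<in> K. s i < t i}"
  let ?D = "(\<lambda>i. (s i, t i)) ` K'"
  have inj: "inj_on (\<lambda>i. (s i, t i)) K'"
  proof (rule inj_onI)
    fix i j assume *: "i \<in> K'" "j \<in> K'" "(s i, t i) = (s j, t j)"
    show "i = j"
    proof (rule ccontr)
      assume "i \<noteq> j"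
      with * assms(3)[of i j] have "{s i<..<t i} = {}" by (auto simp: K'_def)
      with * show False by (simp add: K'_def)
    qed
  qed
  show "nonoverlapping a b ?D"
    unfolding nonoverlapping_def pairwise_def using assms by (auto simp: K'_def)
  fix h :: "real \<Rightarrow> real \<Rightarrow> real" assume h: "\<forall>x. h x x = 0"
  have "(\<Sum>(x, y)\<in>?D. h x y) = (\<Sum>i\<in>K'. h (s i) (t i))"
    by (subst sum.reindex[OF inj]) simp
  also have "\<dots> = (\<Sum>i\<in>K. h (s i) (t i))"
  proof (rule sum.mono_neutral_left)
    show "\<forall>i\<in>K - K'. h (s i) (t i) = 0"
    proof
      fix i assume "i \<in> K - K'"
      with assms(2)[of i] have "s i = t i" by (auto simp: K'_def)
      with h show "h (s i) (t i) = 0" by simp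
    qed
  qed (use assms in \<open>auto simp: K'_def\<close>)
  finally show "(\<Sum>(x, y)\<in>?D. h x y) = (\<Sum>i\<in>K. h (s i) (t i))" .
qed

lemma nonoverlapping_length_le:
  assumes "nonoverlapping a b D" "a \<le> b"
  shows "(\<Sum>(s, t)\<in>D. t - s) \<le> b - a"
proof -
  have D: "finite D" "\<And>p. p \<in> D \<Longrightarrow> a \<le> fst p \<and> fst p \<le> snd p \<and> snd p \<le> b"
    using assms by (auto simp: nonoverlapping_def)
  have disj: "disjoint_family_on (\<lambda>p. {fst p<..<snd p}) D"
    using assms(1) unfolding nonoverlapping_def pairwise_def disjoint_family_on_def by blast
  have "(\<Sum>(s, t)\<in>D. t - s) = (\<Sum>p\<in>D. measure lborel {fst p<..<snd p})"
    using D by (intro sum.cong) auto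
  also have "\<dots> = measure lborel (\<Union>p\<in>D. {fst p<..<snd p})"
    by (rule measure_finite_Union[symmetric]) (use D disj in auto)
  also have "\<dots> \<le> measure lborel {a..b}"
  proof (rule measure_mono_fmeasurable)
    show "(\<Union>p\<in>D. {fst p<..<snd p}) \<subseteq> {a..b}" using D(2) by fastforce
    show "(\<Union>p\<in>D. {fst p<..<snd p}) \<in> sets lborel"
      unfolding sets_lborel by (intro borel_open open_UN ballI open_greaterThanLessThan)
    show "{a..b} \<in> fmeasurable lborel" using \<open>a \<le> b\<close> by (auto intro!: fmeasurableI simp: ennreal_less_top)
  qed
  also have "\<dots> = b - a" using assms by simp
  finally show ?thesis .
qed

text \<open>Replacing the endpoints of an interval by their nearest points in \<open>[c, d]\<close> intersects the interval
  with \<open>[c, d]\<close> or collapses it.\<close>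

abbreviation clamp_to :: "real \<Rightarrow> real \<Rightarrow> real \<Rightarrow> real" where
  "clamp_to c d r \<equiv> max c (min r d)"

lemma clamped_disjoint:
  assumes "nonoverlapping a b D" "p \<in> D" "q \<in> D" "p \<noteq> q"
  shows "{clamp_to c d (fst p)<..<clamp_to c d (snd p)} \<inter> {clamp_to c d (fst q)<..<clamp_to c d (snd q)} = {}"
proof -
  have "{fst p<..<snd p} \<inter> {fst q<..<snd q} = {}"
    using assms by (auto simp: nonoverlapping_def pairwise_def)
  moreover have "{clamp_to c d (fst p)<..<clamp_to c d (snd p)} \<subseteq> {fst p<..<snd p}" for p
    by (auto simp: max_def min_def split: if_splits)
  ultimately show ?thesis by blast
qed

lemma nonoverlapping_clamped:
  assumes D: "nonoverlapping a b D" and "c \<le> d"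
  shows "\<exists>D'. nonoverlapping c d D' \<and> (\<forall>h :: real \<Rightarrow> real \<Rightarrow> real. (\<forall>x. h x x = 0) \<longrightarrow>
      (\<Sum>(s, t)\<in>D'. h s t) = (\<Sum>(s, t)\<in>D. h (clamp_to c d s) (clamp_to c d t)))"
  unfolding split_beta'
proof (rule nonoverlapping_of_family[of D c "\<lambda>p. clamp_to c d (fst p)" "\<lambda>p. clamp_to c d (snd p)" d, unfolded split_beta'])
  show "finite D" using D by (simp add: nonoverlapping_def)
  show "c \<le> clamp_to c d (fst i) \<and> clamp_to c d (fst i) \<le> clamp_to c d (snd i) \<and> clamp_to c d (snd i) \<le> d"
    if "i \<in> D" for i
  proof -
    have "fst i \<le> snd i" using that D by (auto simp: nonoverlapping_def)
    then show ?thesis using \<open>c \<le> d\<close> by (auto simp: le_max_iff_disj min_le_iff_disj)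
  qed
qed (rule clamped_disjoint[OF D])

lemma nonoverlapping_mono:
  assumes "nonoverlapping c d D" "a \<le> c" "d \<le> b"
  shows "nonoverlapping a b D"
proof -
  have "a \<le> s \<and> s \<le> t \<and> t \<le> b" if "(s, t) \<in> D" for s t
    using that assms unfolding nonoverlapping_def by (auto dest!: bspec)
  then show ?thesis using assms(1) by (auto simp: nonoverlapping_def)
qed

text \<open>The total variation of \<open>f\<close> on \<open>[a, x]\<close>. All suprema range over the partial partitions of the same
  interval \<open>[a, b]\<close>, clamped to \<open>[a, x]\<close>; this makes values at different \<open>x\<close> comparable without
  having to cut intervals at \<open>x\<close>.\<close>

definition variation :: "real \<Rightarrow> real \<Rightarrow> (real \<Rightarrow> real) \<Rightarrow> real \<Rightarrow> real" where
  "variation a b f x =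
     (SUP D\<in>{D. nonoverlapping a b D}. \<Sum>(s, t)\<in>D. abs (f (clamp_to a x t) - f (clamp_to a x s)))"

lemma nonoverlapping_empty: "nonoverlapping a b {}"
  by (simp add: nonoverlapping_def)

context
  fixes a b C :: real and f :: "real \<Rightarrow> real"
  assumes C: "\<And>D. nonoverlapping a b D \<Longrightarrow> (\<Sum>(s, t)\<in>D. abs (f t - f s)) \<le> C"
begin

lemma variation_bdd:
  assumes "a \<le> x" "x \<le> b"
  shows "bdd_above ((\<lambda>D. \<Sum>(s, t)\<in>D. abs (f (clamp_to a x t) - f (clamp_to a x s))) ` {D. nonoverlapping a b D})"
proof (rule bdd_aboveI2[where M=C])
  fix D assume "D \<in> {D. nonoverlapping a b D}"
  then have "nonoverlapping a b D" by simp
  from nonoverlapping_clamped[OF this assms(1)]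
  obtain D' where D': "nonoverlapping a x D'" "\<forall>h :: real \<Rightarrow> real \<Rightarrow> real. (\<forall>x. h x x = 0) \<longrightarrow>
      (\<Sum>(s, t)\<in>D'. h s t) = (\<Sum>(s, t)\<in>D. h (clamp_to a x s) (clamp_to a x t))"
    by (elim exE conjE) (rule that)
  then have "nonoverlapping a b D'"
    using assms by (blast intro: nonoverlapping_mono)
  from C[OF this] show "(\<Sum>(s, t)\<in>D. abs (f (clamp_to a x t) - f (clamp_to a x s))) \<le> C"
    using D'(2)[THEN spec, THEN mp, of "\<lambda>s t. abs (f t - f s)"] by simp
qed

lemma variation_upper:
  assumes "nonoverlapping a b D" "a \<le> x" "x \<le> b"
  shows "(\<Sum>(s, t)\<in>D. abs (f (clamp_to a x t) - f (clamp_to a x s))) \<le> variation a b f x"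
  unfolding variation_def by (rule cSUP_upper) (use assms variation_bdd in auto)

text \<open>A partial partition of \<open>[a, x]\<close> can be extended by the interval \<open>[x, y]\<close>. In particular both the
  variation and its difference with \<open>f\<close> are nondecreasing.\<close>

lemma variation_step:
  assumes "a \<le> x" "x \<le> y" "y \<le> b"
  shows "variation a b f x + abs (f y - f x) \<le> variation a b f y"
proof -
  have "(\<Sum>(s, t)\<in>D. abs (f (clamp_to a x t) - f (clamp_to a x s))) \<le> variation a b f y - abs (f y - f x)"
    if D: "nonoverlapping a b D" for D
  proof -
    define s :: "(real \<times> real) option \<Rightarrow> real" where "s = case_option x (\<lambda>p. clamp_to a x (fst p))"
    define t :: "(real \<times> real) option \<Rightarrow> real" where "t = case_option y (\<lambda>p. clamp_to a x (snd p))"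
    let ?K = "insert None (Some ` D)"
    have fin: "finite D" using D by (simp add: nonoverlapping_def)
    have "\<exists>D'. nonoverlapping a b D' \<and> (\<forall>h :: real \<Rightarrow> real \<Rightarrow> real. (\<forall>x. h x x = 0) \<longrightarrow>
      (\<Sum>(x, y)\<in>D'. h x y) = (\<Sum>i\<in>?K. h (s i) (t i)))"
    proof (rule nonoverlapping_of_family[of ?K a s t b])
      show "a \<le> s i \<and> s i \<le> t i \<and> t i \<le> b" if "i \<in> ?K" for i
      proof (cases i)
        case None
        then show ?thesis using assms by (simp add: s_def t_def)
      next
        case (Some p)
        then have "fst p \<le> snd p" using that D by (auto simp: nonoverlapping_def)
        then show ?thesis using Some assms by (auto simp: s_def t_def le_max_iff_disj min_le_iff_disj)
      qed
      show "{s i<..<t i} \<inter> {s j<..<t j} = {}" if ij: "i \<in> ?K" "j \<in> ?K" "i \<noteq> j" for i j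
      proof (cases "i = None \<or> j = None")
        case True
        have s_none: "s None = x" by (simp add: s_def)
        have le: "t (Some p) \<le> x" for p using assms by (simp add: t_def)
        have disj: "{s (Some p)<..<t (Some p)} \<inter> {s None<..<t None} = {}" for p
        proof (rule equals0I)
          fix z assume "z \<in> {s (Some p)<..<t (Some p)} \<inter> {s None<..<t None}"
          then have "z < t (Some p)" "s None < z" by auto
          with le[of p] s_none show False by linarith
        qed
        from True ij obtain p where "i = None \<and> j = Some p \<or> i = Some p \<and> j = None" by auto
        then show ?thesis by (metis disj inf_commute)
      next
        case False
        then obtain p q where pq: "i = Some p" "j = Some q" "p \<in> D" "q \<in> D" "p \<noteq> q" using ij by auto
        then show ?thesis using clamped_disjoint[OF D pq(3-5), of a x] by (simp only: s_def t_def option.case)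
      qed
      show "finite ?K" using fin by simp
    qed
    then obtain D' where D': "nonoverlapping a b D'" "\<forall>h :: real \<Rightarrow> real \<Rightarrow> real. (\<forall>x. h x x = 0) \<longrightarrow>
      (\<Sum>(x, y)\<in>D'. h x y) = (\<Sum>i\<in>?K. h (s i) (t i))"
      by (elim exE conjE) (rule that)
    have "(\<Sum>(s, t)\<in>D'. abs (f (clamp_to a y t) - f (clamp_to a y s)))
        = (\<Sum>i\<in>?K. abs (f (clamp_to a y (t i)) - f (clamp_to a y (s i))))"
      using D'(2)[THEN spec, THEN mp, of "\<lambda>s t. abs (f (clamp_to a y t) - f (clamp_to a y s))"] by simp
    also have "\<dots> = abs (f y - f x) + (\<Sum>p\<in>D. abs (f (clamp_to a x (snd p)) - f (clamp_to a x (fst p))))"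
    proof -
      have "clamp_to a y (clamp_to a x r) = clamp_to a x r" for r
        by (rule order_antisym) (use assms in \<open>auto simp: min_le_iff_disj le_max_iff_disj\<close>)
      then show ?thesis
        using fin assms by (simp add: s_def t_def sum.reindex max_absorb2)
    qed
    finally show ?thesis using variation_upper[OF D'(1), of y] assms by (simp add: split_beta')
  qed
  then have "variation a b f x \<le> variation a b f y - abs (f y - f x)"
    unfolding variation_def[of a b f x]
    by (intro cSUP_least) (auto intro: nonoverlapping_empty)
  then show ?thesis by simp
qed

text \<open>The increase of the variation over \<open>[x, y]\<close> is the variation of \<open>f\<close> on \<open>[x, y]\<close>: clamping to \<open>[a, y]\<close>
  splits into clamping to \<open>[a, x]\<close> and to \<open>[x, y]\<close>.\<close>

lemma variation_approx:
  assumes "a \<le> x" "x \<le> y" "y \<le> b" "0 < \<eta>"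
  obtains D where "nonoverlapping x y D"
    "variation a b f y - variation a b f x < (\<Sum>(s, t)\<in>D. abs (f t - f s)) + \<eta>"
proof -
  have "variation a b f y - \<eta> < variation a b f y" using assms by simp
  then obtain D where D: "nonoverlapping a b D"
    "variation a b f y - \<eta> < (\<Sum>(s, t)\<in>D. abs (f (clamp_to a y t) - f (clamp_to a y s)))"
    unfolding variation_def[of a b f y]
    by (subst (asm) less_cSUP_iff) (use assms variation_bdd[of y] nonoverlapping_empty in auto)
  obtain D' where D': "nonoverlapping x y D'" "\<forall>h :: real \<Rightarrow> real \<Rightarrow> real. (\<forall>x. h x x = 0) \<longrightarrow>
      (\<Sum>(s, t)\<in>D'. h s t) = (\<Sum>(s, t)\<in>D. h (clamp_to x y s) (clamp_to x y t))"
    using nonoverlapping_clamped[OF D(1) assms(2)] by (elim exE conjE) (rule that)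
  have split: "f (clamp_to a y r) = f (clamp_to a x r) + f (clamp_to x y r) - f x" for r
  proof (cases "r \<le> x")
    case True
    then have "clamp_to a y r = clamp_to a x r" "clamp_to x y r = x" using assms by auto
    then show ?thesis by simp
  next
    case False
    then have "clamp_to a y r = clamp_to x y r" "clamp_to a x r = x" using assms by auto
    then show ?thesis by simp
  qed
  have "(\<Sum>(s, t)\<in>D. abs (f (clamp_to a y t) - f (clamp_to a y s)))
      \<le> (\<Sum>(s, t)\<in>D. abs (f (clamp_to a x t) - f (clamp_to a x s)) + abs (f (clamp_to x y t) - f (clamp_to x y s)))"
  proof (rule sum_mono, clarsimp)
    fix s t
    have tri: "abs ((p + q - r) - (p' + q' - r)) \<le> abs (p - p') + abs (q - q')" for p q r p' q' :: real
      by linarith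
    show "abs (f (clamp_to a y t) - f (clamp_to a y s))
        \<le> abs (f (clamp_to a x t) - f (clamp_to a x s)) + abs (f (clamp_to x y t) - f (clamp_to x y s))"
      unfolding split by (rule tri)
  qed
  also have "\<dots> \<le> variation a b f x + (\<Sum>(s, t)\<in>D'. abs (f t - f s))"
    using variation_upper[OF D(1), of x] assms D'(2)[THEN spec, THEN mp, of "\<lambda>s t. abs (f t - f s)"]
    by (simp add: sum.distrib split_beta')
  finally show ?thesis using D(2) D'(1) by (intro that) auto
qed

text \<open>Almost optimal partial partitions of the given intervals combine to one partial partition of no greater
  length, to which the absolute continuity of \<open>f\<close> applies.\<close>

lemma abs_continuous_on_variation:
  assumes "abs_continuous_on a b f"
  shows "abs_continuous_on a b (variation a b f)"
  unfolding abs_continuous_on_nonoverlapping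
proof (intro allI impI)
  fix e :: real assume e: "0 < e"
  obtain d where d: "0 < d" "\<And>D. nonoverlapping a b D \<Longrightarrow> (\<Sum>(s, t)\<in>D. t - s) < d \<Longrightarrow>
      (\<Sum>(s, t)\<in>D. norm (f t - f s)) < e / 2"
    using assms e unfolding abs_continuous_on_nonoverlapping by (meson half_gt_zero)
  show "\<exists>d>0. \<forall>D. nonoverlapping a b D \<and> (\<Sum>(s, t)\<in>D. t - s) < d \<longrightarrow>
      (\<Sum>(s, t)\<in>D. norm (variation a b f t - variation a b f s)) < e"
  proof (intro exI[of _ d] conjI allI impI; (elim conjE)?)
    fix D assume D: "nonoverlapping a b D" "(\<Sum>(s, t)\<in>D. t - s) < d"
    have fin: "finite D" and mem: "\<And>p. p \<in> D \<Longrightarrow> a \<le> fst p \<and> fst p \<le> snd p \<and> snd p \<le> b"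
      using D by (auto simp: nonoverlapping_def)
    (* the error allowed on each of the finitely many intervals; the 1 covers an empty D *)
    define \<eta> where "\<eta> = e / (2 * (real (card D) + 1))"
    have \<eta>: "0 < \<eta>" "real (card D) * \<eta> \<le> e / 2" using e by (auto simp: \<eta>_def field_simps)
    have "\<exists>E. nonoverlapping (fst p) (snd p) E \<and>
        variation a b f (snd p) - variation a b f (fst p) < (\<Sum>(s, t)\<in>E. abs (f t - f s)) + \<eta>"
      if "p \<in> D" for p
      using variation_approx[of "fst p" "snd p" \<eta>] mem[OF that] \<eta> by metis
    then obtain E where E: "\<And>p. p \<in> D \<Longrightarrow> nonoverlapping (fst p) (snd p) (E p)"
      "\<And>p. p \<in> D \<Longrightarrow>
         variation a b f (snd p) - variation a b f (fst p) < (\<Sum>(s, t)\<in>E p. abs (f t - f s)) + \<eta>"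
      by metis
    have memE: "fst p \<le> fst q \<and> fst q \<le> snd q \<and> snd q \<le> snd p" if "p \<in> D" "q \<in> E p" for p q
      using E(1)[OF that(1)] that by (auto simp: nonoverlapping_def)
    have finE: "finite (E p)" if "p \<in> D" for p using E(1)[OF that] by (auto simp: nonoverlapping_def)
    have "\<exists>D'. nonoverlapping a b D' \<and> (\<forall>h :: real \<Rightarrow> real \<Rightarrow> real. (\<forall>x. h x x = 0) \<longrightarrow>
      (\<Sum>(x, y)\<in>D'. h x y) = (\<Sum>i\<in>Sigma D E. h (fst (snd i)) (snd (snd i))))"
    proof (rule nonoverlapping_of_family[of "Sigma D E" a "\<lambda>i. fst (snd i)" "\<lambda>i. snd (snd i)" b])
      show "finite (Sigma D E)" using fin finE by auto
      show "a \<le> fst (snd i) \<and> fst (snd i) \<le> snd (snd i) \<and> snd (snd i) \<le> b" if "i \<in> Sigma D E" for i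
        using that mem memE by fastforce
      show "{fst (snd i)<..<snd (snd i)} \<inter> {fst (snd j)<..<snd (snd j)} = {}"
        if ij: "i \<in> Sigma D E" "j \<in> Sigma D E" "i \<noteq> j" for i j
      proof (cases "fst i = fst j")
        case True
        then have "snd i \<in> E (fst i)" "snd j \<in> E (fst i)" "snd i \<noteq> snd j" "fst i \<in> D" using ij by (auto simp: prod_eq_iff)
        then show ?thesis using E(1)[of "fst i"] by (simp add: nonoverlapping_def pairwise_def)
      next
        case False
        then have "{fst (fst i)<..<snd (fst i)} \<inter> {fst (fst j)<..<snd (fst j)} = {}"
          using D(1) ij unfolding nonoverlapping_def pairwise_def by (metis mem_Sigma_iff prod.collapse)
        moreover have "{fst (snd i)<..<snd (snd i)} \<subseteq> {fst (fst i)<..<snd (fst i)}" if "i \<in> Sigma D E" for i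
          using that memE by fastforce
        ultimately show ?thesis using ij by blast
      qed
    qed
    then obtain D' where D': "nonoverlapping a b D'" "\<forall>h :: real \<Rightarrow> real \<Rightarrow> real. (\<forall>x. h x x = 0) \<longrightarrow>
      (\<Sum>(x, y)\<in>D'. h x y) = (\<Sum>i\<in>Sigma D E. h (fst (snd i)) (snd (snd i)))"
      by (elim exE conjE) (rule that)
    have "(\<Sum>(s, t)\<in>D'. t - s) = (\<Sum>p\<in>D. \<Sum>(s, t)\<in>E p. t - s)"
      using fin finE D'(2)[THEN spec, THEN mp, of "\<lambda>s t. t - s"] by (simp add: sum.Sigma split_beta')
    also have "\<dots> \<le> (\<Sum>p\<in>D. snd p - fst p)"
      by (rule sum_mono) (use E(1) mem in \<open>auto intro: nonoverlapping_length_le\<close>)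
    finally have "(\<Sum>(s, t)\<in>D'. norm (f t - f s)) < e / 2"
      using d(2)[OF D'(1)] D(2) by (simp add: split_beta')
    then have *: "(\<Sum>p\<in>D. \<Sum>(s, t)\<in>E p. abs (f t - f s)) < e / 2"
      using fin finE D'(2)[THEN spec, THEN mp, of "\<lambda>s t. abs (f t - f s)"] by (simp add: sum.Sigma split_beta')
    have "(\<Sum>(s, t)\<in>D. norm (variation a b f t - variation a b f s))
        \<le> (\<Sum>p\<in>D. (\<Sum>(s, t)\<in>E p. abs (f t - f s)) + \<eta>)"
    proof (unfold split_beta', rule sum_mono)
      fix p assume "p \<in> D"
      then show "norm (variation a b f (snd p) - variation a b f (fst p))
          \<le> (\<Sum>q\<in>E p. abs (f (snd q) - f (fst q))) + \<eta>"
        using E(2)[of p] variation_step[of "fst p" "snd p"] mem[of p] by (auto simp: split_beta')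
    qed
    also have "\<dots> < e" using * \<eta> by (simp add: sum.distrib)
    finally show "(\<Sum>(s, t)\<in>D. norm (variation a b f t - variation a b f s)) < e" .
  qed (use d in auto)
qed

end

lemma abs_continuous_onE:
  assumes "abs_continuous_on a b f" "0 < e"
  obtains d where "0 < d" "\<And>D. nonoverlapping a b D \<Longrightarrow> (\<Sum>(s, t)\<in>D. t - s) < d \<Longrightarrow>
      (\<Sum>(s, t)\<in>D. norm (f t - f s)) < e"
  using assms unfolding abs_continuous_on_nonoverlapping by meson

lemma abs_continuous_on_minus:
  fixes f g :: "real \<Rightarrow> 'a::real_normed_vector"
  assumes "abs_continuous_on a b f" "abs_continuous_on a b g"
  shows "abs_continuous_on a b (\<lambda>x. f x - g x)"
  unfolding abs_continuous_on_nonoverlapping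
proof (intro allI impI)
  fix e :: real assume e: "0 < e"
  obtain d where d: "0 < d" "\<And>D. nonoverlapping a b D \<Longrightarrow> (\<Sum>(s, t)\<in>D. t - s) < d \<Longrightarrow>
      (\<Sum>(s, t)\<in>D. norm (f t - f s)) < e / 2"
    using assms(1) e unfolding abs_continuous_on_nonoverlapping by (meson half_gt_zero)
  obtain d' where d': "0 < d'" "\<And>D. nonoverlapping a b D \<Longrightarrow> (\<Sum>(s, t)\<in>D. t - s) < d' \<Longrightarrow>
      (\<Sum>(s, t)\<in>D. norm (g t - g s)) < e / 2"
    using assms(2) e unfolding abs_continuous_on_nonoverlapping by (meson half_gt_zero)
  show "\<exists>\<delta>>0. \<forall>D. nonoverlapping a b D \<and> (\<Sum>(s, t)\<in>D. t - s) < \<delta> \<longrightarrow>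
      (\<Sum>(s, t)\<in>D. norm (f t - g t - (f s - g s))) < e"
  proof (intro exI[of _ "min d d'"] conjI allI impI; (elim conjE)?)
    fix D assume D: "nonoverlapping a b D" "(\<Sum>(s, t)\<in>D. t - s) < min d d'"
    have "(\<Sum>(s, t)\<in>D. norm (f t - g t - (f s - g s)))
        \<le> (\<Sum>(s, t)\<in>D. norm (f t - f s) + norm (g t - g s))"
    proof (rule sum_mono, clarsimp)
      fix s t
      have "f t - g t - (f s - g s) = (f t - f s) - (g t - g s)" by simp
      then show "norm (f t - g t - (f s - g s)) \<le> norm (f t - f s) + norm (g t - g s)"
        using norm_triangle_ineq4 by metis
    qed
    also have "\<dots> = (\<Sum>(s, t)\<in>D. norm (f t - f s)) + (\<Sum>(s, t)\<in>D. norm (g t - g s))"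
      by (simp add: split_beta' sum.distrib)
    also have "\<dots> < e" using d(2)[OF D(1)] d'(2)[OF D(1)] D(2) by linarith
    finally show "(\<Sum>(s, t)\<in>D. norm (f t - g t - (f s - g s))) < e" .
  qed (use d d' in auto)
qed

lemma abs_continuous_on_bounded_linear:
  assumes "abs_continuous_on a b f" "bounded_linear h"
  shows "abs_continuous_on a b (\<lambda>x. h (f x))"
  unfolding abs_continuous_on_nonoverlapping
proof (intro allI impI)
  fix e :: real assume e: "0 < e"
  interpret h: bounded_linear h by fact
  obtain K where K: "0 < K" "\<And>x. norm (h x) \<le> norm x * K" using h.pos_bounded by blast
  obtain d where d: "0 < d" "\<And>D. nonoverlapping a b D \<Longrightarrow> (\<Sum>(s, t)\<in>D. t - s) < d \<Longrightarrow>
      (\<Sum>(s, t)\<in>D. norm (f t - f s)) < e / K"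
    using abs_continuous_onE[OF assms(1) divide_pos_pos[OF e K(1)]] by metis
  show "\<exists>\<delta>>0. \<forall>D. nonoverlapping a b D \<and> (\<Sum>(s, t)\<in>D. t - s) < \<delta> \<longrightarrow>
      (\<Sum>(s, t)\<in>D. norm (h (f t) - h (f s))) < e"
  proof (intro exI[of _ d] conjI allI impI; (elim conjE)?)
    fix D assume D: "nonoverlapping a b D" "(\<Sum>(s, t)\<in>D. t - s) < d"
    have "(\<Sum>(s, t)\<in>D. norm (h (f t) - h (f s))) \<le> (\<Sum>(s, t)\<in>D. norm (f t - f s)) * K"
      unfolding sum_distrib_right
    proof (rule sum_mono, clarsimp)
      fix s t
      show "norm (h (f t) - h (f s)) \<le> norm (f t - f s) * K"
        using K(2)[of "f t - f s"] by (simp add: h.diff)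
    qed
    also have "\<dots> < e" using d(2)[OF D] K(1) by (simp add: pos_less_divide_eq)
    finally show "(\<Sum>(s, t)\<in>D. norm (h (f t) - h (f s))) < e" .
  qed (use d in auto)
qed

lemma abs_continuous_on_subinterval:
  assumes "abs_continuous_on a b f" "a \<le> c" "d \<le> b"
  shows "abs_continuous_on c d f"
  unfolding abs_continuous_on_nonoverlapping
proof (intro allI impI)
  fix e :: real assume "0 < e"
  then obtain \<delta> where "0 < \<delta>" "\<And>D. nonoverlapping a b D \<and> (\<Sum>(s, t)\<in>D. t - s) < \<delta> \<Longrightarrow>
      (\<Sum>(s, t)\<in>D. norm (f t - f s)) < e"
    using assms(1) unfolding abs_continuous_on_nonoverlapping by meson
  then show "\<exists>\<delta>>0. \<forall>D. nonoverlapping c d D \<and> (\<Sum>(s, t)\<in>D. t - s) < \<delta> \<longrightarrow>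
      (\<Sum>(s, t)\<in>D. norm (f t - f s)) < e"
    using nonoverlapping_mono[OF _ assms(2,3)] by (intro exI[of _ \<delta>]) simp
qed

lemma abs_continuous_on_imp_close:
  assumes "abs_continuous_on a b f" "0 < e"
  obtains d where "0 < d" "\<And>s t. \<lbrakk>a \<le> s; s \<le> t; t \<le> b; t - s < d\<rbrakk> \<Longrightarrow> norm (f t - f s) < e"
proof -
  obtain d where d: "0 < d" "\<And>D. nonoverlapping a b D \<Longrightarrow> (\<Sum>(s, t)\<in>D. t - s) < d \<Longrightarrow>
      (\<Sum>(s, t)\<in>D. norm (f t - f s)) < e"
    using assms unfolding abs_continuous_on_nonoverlapping by meson
  show ?thesis
  proof (rule that[OF d(1)])
    fix s t assume "a \<le> s" "s \<le> t" "t \<le> b" "t - s < d"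
    then show "norm (f t - f s) < e"
      using d(2)[of "{(s, t)}"] by (simp add: nonoverlapping_def)
  qed
qed

lemma abs_continuous_on_imp_continuous_on:
  assumes "abs_continuous_on a b f"
  shows "continuous_on {a..b} f"
  unfolding continuous_on_iff
proof (intro ballI allI impI)
  fix x e :: real assume x: "x \<in> {a..b}" and "0 < e"
  with abs_continuous_on_imp_close[OF assms, of e] obtain d where
    d: "0 < d" "\<And>s t. \<lbrakk>a \<le> s; s \<le> t; t \<le> b; t - s < d\<rbrakk> \<Longrightarrow> norm (f t - f s) < e" by metis
  show "\<exists>d>0. \<forall>x'\<in>{a..b}. dist x' x < d \<longrightarrow> dist (f x') (f x) < e"
  proof (intro exI[of _ d] conjI ballI impI)
    fix y assume y: "y \<in> {a..b}" "dist y x < d"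
    show "dist (f y) (f x) < e"
    proof (cases "x \<le> y")
      case True
      then show ?thesis using d(2)[of x y] x y by (simp add: dist_norm)
    next
      case False
      then show ?thesis using d(2)[of y x] x y by (simp add: dist_norm norm_minus_commute)
    qed
  qed (rule d(1))
qed

text \<open>The Stieltjes measure of a monotone absolutely continuous function has no part that is singular
  with respect to Lebesgue measure: a Lebesgue null set has open neighbourhoods of small length, and
  absolute continuity bounds the Stieltjes measure of finite unions of intervals by their length.\<close>

lemma interval_measure_absolutely_continuous:
  fixes F :: "real \<Rightarrow> real"
  assumes "a \<le> b" and ac: "abs_continuous_on a b F"
    and mono: "\<And>x y. x \<le> y \<Longrightarrow> F x \<le> F y" and cont: "continuous_on UNIV F"
    and below: "\<And>x. x \<le> a \<Longrightarrow> F x = F a" and above: "\<And>x. b \<le> x \<Longrightarrow> F x = F b"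
  shows "absolutely_continuous lborel (interval_measure F)"
proof -
  let ?\<mu> = "interval_measure F"
  have right: "\<And>x. continuous (at_right x) F"
    using cont by (simp add: continuous_on_eq_continuous_at continuous_at_imp_continuous_at_within)
  have Icc: "emeasure ?\<mu> {x..y} = F y - F x" if "x \<le> y" for x y
    by (rule emeasure_interval_measure_Icc) (use that mono cont in auto)
  have null_below: "{..a} \<in> null_sets ?\<mu>"
  proof -
    have "{a - real n..a} \<in> null_sets ?\<mu>" for n
      using below[of "a - real n"] by (auto simp: null_sets_def Icc)
    then have "(\<Union>n. {a - real n..a}) \<in> null_sets ?\<mu>" by (rule null_sets_UN)
    moreover have "{..a} \<subseteq> (\<Union>n. {a - real n..a})"
    proof
      fix x assume "x \<in> {..a}"
      moreover obtain n where "a - x \<le> real n" using real_arch_simple by blast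
      ultimately show "x \<in> (\<Union>n. {a - real n..a})" by (auto intro!: exI[of _ n])
    qed
    ultimately show ?thesis using null_sets_subset[of "\<Union>n. {a - real n..a}" ?\<mu> "{..a}"] by simp
  qed
  have null_above: "{b..} \<in> null_sets ?\<mu>"
  proof -
    have "{b..b + real n} \<in> null_sets ?\<mu>" for n
      using above[of "b + real n"] by (auto simp: null_sets_def Icc)
    then have "(\<Union>n. {b..b + real n}) \<in> null_sets ?\<mu>" by (rule null_sets_UN)
    moreover have "{b..} \<subseteq> (\<Union>n. {b..b + real n})"
    proof
      fix x assume "x \<in> {b..}"
      moreover obtain n where "x - b \<le> real n" using real_arch_simple by blast
      ultimately show "x \<in> (\<Union>n. {b..b + real n})" by (auto intro!: exI[of _ n])
    qed
    ultimately show ?thesis using null_sets_subset[of "\<Union>n. {b..b + real n}" ?\<mu> "{b..}"] by simp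
  qed
  (* open sets are exhausted by finite unions of closed intervals, to which F's modulus applies *)
  have small: "emeasure ?\<mu> U \<le> ennreal e"
    if e: "0 < e" and d: "\<And>D. nonoverlapping a b D \<Longrightarrow> (\<Sum>(s, t)\<in>D. t - s) < d \<Longrightarrow>
      (\<Sum>(s, t)\<in>D. norm (F t - F s)) < e"
      and U: "open U" "U \<subseteq> {a<..<b}" "measure lborel U < d" for U e d
  proof -
    obtain \<D> where \<D>: "countable \<D>" "\<D> \<subseteq> Pow U" "\<And>X. X \<in> \<D> \<Longrightarrow> \<exists>a b. X = cbox a b" "\<Union>\<D> = U"
      using open_countable_Union_open_cbox[OF U(1)] by metis
    have fin_le: "emeasure ?\<mu> (\<Union>\<F>) \<le> ennreal e" if \<F>: "finite \<F>" "\<F> \<subseteq> \<D>" for \<F>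
    proof -
      obtain p where p: "p division_of \<Union>\<F>"
        using elementary_unions_intervals[OF \<F>(1)] \<D>(3) \<F>(2) by (metis subsetD)
      have fp: "finite p" using p by auto
      have sets_F: "\<Union>\<F> \<in> sets lborel"
      proof (rule sets.finite_Union[OF \<F>(1)], rule subsetI)
        fix X assume "X \<in> \<F>"
        then obtain u v where "X = cbox u v" using \<D>(3) \<F>(2) by blast
        then show "X \<in> sets lborel" by simp
      qed
      have pU: "k \<subseteq> U" if "k \<in> p" for k using division_ofD(2)[OF p that] \<F>(2) \<D>(2) by blast
      have Inf_Sup: "k = {Inf k..Sup k} \<and> Inf k \<le> Sup k" if k: "k \<in> p" for k
      proof -
        obtain u v where "k = cbox u v" "k \<noteq> {}" using division_ofD(3)[OF p k] division_ofD(4)[OF p k] by metis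
        then show ?thesis by auto
      qed
      have ab: "a \<le> Inf k \<and> Inf k \<le> Sup k \<and> Sup k \<le> b" if "k \<in> p" for k
      proof -
        have "Inf k \<in> k" "Sup k \<in> k" using Inf_Sup[OF that] by (metis atLeastAtMost_iff order_refl)+
        then show ?thesis using pU[OF that] U(2) Inf_Sup[OF that] by fastforce
      qed
      have "\<exists>D. nonoverlapping a b D \<and> (\<forall>h :: real \<Rightarrow> real \<Rightarrow> real. (\<forall>x. h x x = 0) \<longrightarrow>
        (\<Sum>(x, y)\<in>D. h x y) = (\<Sum>k\<in>p. h (Inf k) (Sup k)))"
      proof (rule nonoverlapping_of_family[OF fp ab])
        fix i j assume ij: "i \<in> p" "j \<in> p" "i \<noteq> j"
        have "interior k = {Inf k<..<Sup k}" if "k \<in> p" for k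
          using Inf_Sup[OF that] interior_atLeastAtMost_real by metis
        then show "{Inf i<..<Sup i} \<inter> {Inf j<..<Sup j} = {}"
          using division_ofD(5)[OF p ij] ij by metis
      qed
      then obtain D where D: "nonoverlapping a b D" "\<forall>h :: real \<Rightarrow> real \<Rightarrow> real. (\<forall>x. h x x = 0) \<longrightarrow>
        (\<Sum>(x, y)\<in>D. h x y) = (\<Sum>k\<in>p. h (Inf k) (Sup k))"
        by (elim exE conjE) (rule that)
      have "(\<Sum>(s, t)\<in>D. t - s) = (\<Sum>k\<in>p. Sup k - Inf k)"
        using D(2)[THEN spec, THEN mp, of "\<lambda>s t. t - s"] by simp
      also have "\<dots> = (\<Sum>k\<in>p. measure lborel k)"
      proof (rule sum.cong[OF refl])
        fix k assume "k \<in> p"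
        from Inf_Sup[OF this] show "Sup k - Inf k = measure lborel k" by (metis content_real)
      qed
      also have "\<dots> = measure lborel (\<Union>\<F>)"
      proof -
        have "k \<in> sets lborel" if "k \<in> p" for k
          using division_ofD(4)[OF p that] by auto
        then have "(\<Sum>k\<in>p. measure lborel k) = (\<Sum>k\<in>p. measure lebesgue k)"
          by (intro sum.cong) (auto simp: measure_completion)
        also have "\<dots> = measure lebesgue (\<Union>\<F>)" using content_division[OF p] by simp
        also have "\<dots> = measure lborel (\<Union>\<F>)" using sets_F by (simp add: measure_completion)
        finally show ?thesis .
      qed
      also have "\<dots> \<le> measure lborel U"
      proof (rule measure_mono_fmeasurable)
        show "\<Union>\<F> \<subseteq> U" using \<F>(2) \<D>(2) by blast
        show "\<Union>\<F> \<in> sets lborel" by (rule sets_F)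
        have "bounded U" using U(2) bounded_subset[OF bounded_box[of a b]] by simp
        then show "U \<in> fmeasurable lborel"
          using U(1) by (intro fmeasurableI) (auto dest: emeasure_bounded_finite)
      qed
      finally have "(\<Sum>(s, t)\<in>D. norm (F t - F s)) < e" using d[OF D(1)] U(3) by linarith
      then have le: "(\<Sum>k\<in>p. norm (F (Sup k) - F (Inf k))) < e"
        using D(2)[THEN spec, THEN mp, of "\<lambda>s t. norm (F t - F s)"] by simp
      have "emeasure ?\<mu> (\<Union>\<F>) = emeasure ?\<mu> (\<Union>k\<in>p. k)"
        using division_ofD(6)[OF p] by simp
      also have "\<dots> \<le> (\<Sum>k\<in>p. emeasure ?\<mu> k)"
      proof (rule emeasure_subadditive_finite[OF fp])
        show "(\<lambda>k. k) ` p \<subseteq> sets ?\<mu>"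
          using division_ofD(4)[OF p] by fastforce
      qed
      also have "\<dots> = (\<Sum>k\<in>p. ennreal (norm (F (Sup k) - F (Inf k))))"
      proof (rule sum.cong[OF refl])
        fix k assume k: "k \<in> p"
        have "emeasure ?\<mu> k = emeasure ?\<mu> {Inf k..Sup k}" using Inf_Sup[OF k] by simp
        then show "emeasure ?\<mu> k = ennreal (norm (F (Sup k) - F (Inf k)))"
          using Icc[of "Inf k" "Sup k"] Inf_Sup[OF k] mono[of "Inf k" "Sup k"] by simp
      qed
      also have "\<dots> = ennreal (\<Sum>k\<in>p. norm (F (Sup k) - F (Inf k)))" by (rule sum_ennreal) simp
      also have "\<dots> \<le> ennreal e" using le by (intro ennreal_leI) simp
      finally show ?thesis .
    qed
    show ?thesis
    proof (cases "\<D> = {}")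
      case True
      then show ?thesis using \<D>(4) by simp
    next
      case False
      define A where "A n = \<Union>(from_nat_into \<D> ` {..n})" for n :: nat
      have range: "range (from_nat_into \<D>) = \<D>" using range_from_nat_into[OF False \<D>(1)] .
      have "(\<Union>n. A n) = \<Union>(range (from_nat_into \<D>))" unfolding A_def by blast
      then have "(\<Union>n. A n) = U" using range \<D>(4) by simp
      moreover have "incseq A"
        unfolding incseq_def A_def by (intro allI impI Union_mono image_mono) auto
      moreover have "range A \<subseteq> sets ?\<mu>"
      proof -
        have "from_nat_into \<D> i \<in> sets borel" for i
        proof -
          have "from_nat_into \<D> i \<in> \<D>" by (rule from_nat_into[OF False])
          then show ?thesis using \<D>(3) by (metis borel_closed closed_cbox)
        qed
        then show ?thesis unfolding A_def by auto
      qed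
      ultimately have "emeasure ?\<mu> U = (SUP n. emeasure ?\<mu> (A n))"
        using SUP_emeasure_incseq[of A ?\<mu>] by simp
      also have "\<dots> \<le> ennreal e"
        unfolding A_def by (intro SUP_least fin_le) (use range in auto)
      finally show ?thesis .
    qed
  qed
  show ?thesis
    unfolding absolutely_continuous_def
  proof
    fix N :: "real set" assume N: "N \<in> null_sets lborel"
    let ?N = "N \<inter> {a<..<b}"
    have N': "?N \<in> null_sets lborel" using N by (auto intro: null_set_Int2)
    have "emeasure ?\<mu> ?N \<le> ennreal e" if e: "0 < e" for e
    proof -
      obtain d where d: "0 < d" "\<And>D. nonoverlapping a b D \<Longrightarrow> (\<Sum>(s, t)\<in>D. t - s) < d \<Longrightarrow>
          (\<Sum>(s, t)\<in>D. norm (F t - F s)) < e"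
        by (rule abs_continuous_onE[OF ac e]) (rule that)
      have "?N \<in> sets borel" using N' by auto
      then obtain U where U: "open U" "?N \<subseteq> U" "emeasure lborel (U - ?N) < d"
        using outer_regular_lborel[of ?N d] d(1) by blast
      let ?U = "U \<inter> {a<..<b}"
      have "emeasure lborel ?U \<le> emeasure lborel ((U - ?N) \<union> ?N)"
        using U N' by (intro emeasure_mono) auto
      also have "\<dots> = emeasure lborel (U - ?N)"
        by (rule emeasure_Un_null_set) (use U N' in auto)
      also have "\<dots> < d" by fact
      finally have less: "emeasure lborel ?U < ennreal d" .
      then have "emeasure lborel ?U = ennreal (measure lborel ?U)"
        by (intro emeasure_eq_ennreal_measure) auto
      with less have "measure lborel ?U < d" by (simp add: ennreal_less_iff)
      have "open ?U" using U(1) by auto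
      from small[OF e d(2) this _ \<open>measure lborel ?U < d\<close>]
      have "emeasure ?\<mu> ?U \<le> ennreal e" by simp
      moreover have "emeasure ?\<mu> ?N \<le> emeasure ?\<mu> ?U"
        using U by (intro emeasure_mono) auto
      ultimately show ?thesis by (meson order_trans)
    qed
    note le_e = this
    have "emeasure ?\<mu> ?N \<le> 0"
      by (rule ennreal_le_epsilon, subst add_0, rule le_e)
    moreover have "?N \<in> sets ?\<mu>" using N' by (simp add: null_sets_def)
    ultimately have "?N \<in> null_sets ?\<mu>" by (simp add: null_sets_def)
    then have "?N \<union> {..a} \<union> {b..} \<in> null_sets ?\<mu>"
      by (rule null_sets.Un[OF null_sets.Un[OF _ null_below] null_above])
    moreover have "N \<subseteq> ?N \<union> {..a} \<union> {b..}" by force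
    moreover have "N \<in> sets ?\<mu>" using N by (simp add: null_sets_def)
    ultimately show "N \<in> null_sets ?\<mu>" by (metis null_sets_subset)
  qed
qed

text \<open>The density of the Stieltjes measure with respect to Lebesgue measure, given by the Radon--Nikodym theorem,
  is the integrand. It may be infinite on a null set and is made real-valued there.\<close>

lemma abs_continuous_mono_imp_integral:
  fixes F :: "real \<Rightarrow> real"
  assumes "a \<le> b" and ac: "abs_continuous_on a b F"
    and mono: "\<And>x y. \<lbrakk>a \<le> x; x \<le> y; y \<le> b\<rbrakk> \<Longrightarrow> F x \<le> F y"
  obtains g where "integrable lborel g"
    "\<And>x y. \<lbrakk>a \<le> x; x \<le> y; y \<le> b\<rbrakk> \<Longrightarrow> (g has_integral (F y - F x)) {x..y}"
proof -
  define H where "H x = F (clamp_to a b x)" for x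
  let ?\<mu> = "interval_measure H"
  have HF: "H x = F x" if "a \<le> x" "x \<le> b" for x using that by (simp add: H_def)
  have H_mono: "H x \<le> H y" if "x \<le> y" for x y
    unfolding H_def by (rule mono) (use that \<open>a \<le> b\<close> in auto)
  have "continuous_on UNIV (F \<circ> clamp_to a b)"
    by (rule continuous_on_compose)
      (use \<open>a \<le> b\<close> in \<open>auto intro!: continuous_intros
        intro: continuous_on_subset[OF abs_continuous_on_imp_continuous_on[OF ac]]\<close>)
  then have H_cont: "continuous_on UNIV H" by (simp add: H_def[abs_def] o_def)
  have H_ac: "abs_continuous_on a b H"
  proof -
    have "(\<Sum>(s, t)\<in>D. norm (H t - H s)) = (\<Sum>(s, t)\<in>D. norm (F t - F s))"
      if "nonoverlapping a b D" for D
      by (rule sum.cong) (use that in \<open>force simp: nonoverlapping_def HF\<close>)+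
    then show ?thesis using ac unfolding abs_continuous_on_nonoverlapping by metis
  qed
  have H_below: "H x = H a" if "x \<le> a" for x using that \<open>a \<le> b\<close> by (simp add: H_def)
  have H_above: "H x = H b" if "b \<le> x" for x using that \<open>a \<le> b\<close> by (simp add: H_def)
  have acm: "absolutely_continuous lborel ?\<mu>"
    by (rule interval_measure_absolutely_continuous[OF \<open>a \<le> b\<close> H_ac H_mono H_cont H_below H_above])
  obtain f where f: "f \<in> borel_measurable lborel" "density lborel f = ?\<mu>"
    using sigma_finite_measure.Radon_Nikodym[OF sigma_finite_lborel acm] by auto
  have Icc: "emeasure ?\<mu> {x..y} = H y - H x" if "x \<le> y" for x y
    by (rule emeasure_interval_measure_Icc) (use that H_mono H_cont in auto)
  have f_Icc: "(\<integral>\<^sup>+z. f z * indicator {x..y} z \<partial>lborel) = ennreal (H y - H x)" if "x \<le> y" for x y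
    using emeasure_density[OF f(1), of "{x..y}"] Icc[OF that] unfolding f(2) by simp
  have fin: "AE z in lborel. f z * indicator {a..b} z \<noteq> \<infinity>"
    by (rule nn_integral_noteq_infinite) (use f f_Icc[OF \<open>a \<le> b\<close>] in auto)
  define g where "g z = enn2real (f z * indicator {a..b} z)" for z
  have g_meas: "g \<in> borel_measurable lborel" using f(1) by (simp add: g_def[abs_def])
  have g_eq: "AE z in lborel. ennreal (g z) = f z * indicator {a..b} z"
    using fin by eventually_elim (simp add: g_def less_top)
  have g_nn: "0 \<le> g z" for z by (simp add: g_def)
  show ?thesis
  proof
    have "(\<integral>\<^sup>+z. ennreal (g z) \<partial>lborel) = ennreal (H b - H a)"
      using nn_integral_cong_AE[OF g_eq] f_Icc[OF \<open>a \<le> b\<close>] by simp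
    then show "integrable lborel g"
      using g_meas g_nn by (intro integrableI_nonneg) auto
    fix x y assume xy: "a \<le> x" "x \<le> y" "y \<le> b"
    have "AE z in lborel. ennreal (g z * indicator {x..y} z) = f z * indicator {x..y} z"
      using g_eq by eventually_elim (use xy in \<open>auto simp: indicator_def\<close>)
    then have "(\<integral>\<^sup>+z. ennreal (g z * indicator {x..y} z) \<partial>lborel) = ennreal (H y - H x)"
      using nn_integral_cong_AE f_Icc[OF xy(2)] by metis
    then have "((\<lambda>z. g z * indicator {x..y} z) has_integral (H y - H x)) UNIV"
      by (intro nn_integral_has_integral) (use g_nn g_meas H_mono[OF xy(2)] in auto)
    moreover have "(\<lambda>z. g z * indicator {x..y} z) = (\<lambda>z. if z \<in> {x..y} then g z else 0)"
      by (auto simp: indicator_def)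
    ultimately show "(g has_integral (F y - F x)) {x..y}"
      using xy HF by (simp only: has_integral_restrict_UNIV)
  qed
qed

text \<open>The Jordan decomposition of \<open>f\<close> into its variation and the difference of the variation and \<open>f\<close>.\<close>

lemma abs_continuous_imp_integral:
  fixes f :: "real \<Rightarrow> real"
  assumes "a \<le> b" and ac: "abs_continuous_on a b f"
    and C: "\<And>D. nonoverlapping a b D \<Longrightarrow> (\<Sum>(s, t)\<in>D. abs (f t - f s)) \<le> C"
  obtains g where "integrable lborel g"
    "\<And>x y. \<lbrakk>a \<le> x; x \<le> y; y \<le> b\<rbrakk> \<Longrightarrow> (g has_integral (f y - f x)) {x..y}"
proof -
  let ?V = "variation a b f"
  have V: "?V x + abs (f y - f x) \<le> ?V y" if "a \<le> x" "x \<le> y" "y \<le> b" for x y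
    using variation_step[OF C that] .
  have ac_V: "abs_continuous_on a b ?V"
    using abs_continuous_on_variation[OF C ac] .
  obtain g1 where g1: "integrable lborel g1"
    "\<And>x y. \<lbrakk>a \<le> x; x \<le> y; y \<le> b\<rbrakk> \<Longrightarrow> (g1 has_integral (?V y - ?V x)) {x..y}"
  proof (rule abs_continuous_mono_imp_integral[OF \<open>a \<le> b\<close> ac_V])
    show "?V x \<le> ?V y" if "a \<le> x" "x \<le> y" "y \<le> b" for x y using V[OF that] by linarith
  qed (rule that)
  obtain g2 where g2: "integrable lborel g2"
    "\<And>x y. \<lbrakk>a \<le> x; x \<le> y; y \<le> b\<rbrakk> \<Longrightarrow> (g2 has_integral ((?V y - f y) - (?V x - f x))) {x..y}"
  proof (rule abs_continuous_mono_imp_integral[OF \<open>a \<le> b\<close> abs_continuous_on_minus[OF ac_V ac]])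
    show "?V x - f x \<le> ?V y - f y" if "a \<le> x" "x \<le> y" "y \<le> b" for x y using V[OF that] by linarith
  qed (rule that)
  show ?thesis
  proof (rule that)
    show "integrable lborel (\<lambda>x. g1 x - g2 x)" using g1(1) g2(1) by simp
    show "((\<lambda>x. g1 x - g2 x) has_integral (f y - f x)) {x..y}" if "a \<le> x" "x \<le> y" "y \<le> b" for x y
      using has_integral_diff[OF g1(2)[OF that] g2(2)[OF that]] by (simp add: algebra_simps)
  qed
qed

text \<open>Lebesgue differentiation from both sides: the average over \<open>[x, x + h]\<close> is controlled directly, the
  one over \<open>[x - h, x]\<close> by applying the same result to the reflected function.\<close>

lemma integral_imp_AE_differentiable:
  fixes f g :: "real \<Rightarrow> real"
  assumes g: "integrable lborel g"
    and fg: "\<And>x y. \<lbrakk>a \<le> x; x \<le> y; y \<le> b\<rbrakk> \<Longrightarrow> (g has_integral (f y - f x)) {x..y}"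
  obtains N where "negligible N" "\<And>x. x \<in> {a<..<b} - N \<Longrightarrow> (f has_real_derivative g x) (at x)"
proof -
  have g_UNIV: "g integrable_on UNIV" by (rule integrable_on_lborel[OF g])
  have refl_UNIV: "(\<lambda>x. g (- x)) integrable_on UNIV"
    by (rule integrable_on_lborel) (use lborel_integrable_real_affine[OF g, of "-1" 0] in simp)
  have int1: "g integrable_on cbox u v" for u v
    using g_UNIV integrable_on_subcbox by blast
  have int2: "(\<lambda>x. g (- x)) integrable_on cbox u v" for u v
    using refl_UNIV integrable_on_subcbox by blast
  obtain N1 where N1: "negligible N1"
    "\<And>x e. \<lbrakk>x \<notin> N1; 0 < e\<rbrakk> \<Longrightarrow> \<exists>d>0. \<forall>h. 0 < h \<and> h < d \<longrightarrow>
        norm (integral (cbox x (x + h *\<^sub>R One)) g /\<^sub>R h ^ DIM(real) - g x) < e"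
    using integrable_ccontinuous_explicit[OF int1] by metis
  obtain N2 where N2: "negligible N2"
    "\<And>x e. \<lbrakk>x \<notin> N2; 0 < e\<rbrakk> \<Longrightarrow> \<exists>d>0. \<forall>h. 0 < h \<and> h < d \<longrightarrow>
        norm (integral (cbox x (x + h *\<^sub>R One)) (\<lambda>x. g (- x)) /\<^sub>R h ^ DIM(real) - g (- x)) < e"
    using integrable_ccontinuous_explicit[OF int2] by metis
  show ?thesis
  proof (rule that[of "N1 \<union> uminus ` N2"])
    show "negligible (N1 \<union> uminus ` N2)"
      using N1(1) N2(1)
      by (intro negligible_Un negligible_differentiable_image_negligible)
        (auto intro!: derivative_intros)
    fix x assume x: "x \<in> {a<..<b} - (N1 \<union> uminus ` N2)"
    then have "- x \<notin> N2" by force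
    show "(f has_real_derivative g x) (at x)"
      unfolding DERIV_def
    proof (rule LIM_I)
      fix e :: real assume e: "0 < e"
      obtain d1 where d1: "0 < d1" "\<And>h. \<lbrakk>0 < h; h < d1\<rbrakk> \<Longrightarrow> norm (integral {x..x + h} g / h - g x) < e"
        using N1(2)[of x e] x e by (auto simp: divide_inverse mult.commute)
      obtain d2 where d2: "0 < d2"
        "\<And>h. \<lbrakk>0 < h; h < d2\<rbrakk> \<Longrightarrow> norm (integral {- x..- x + h} (\<lambda>x. g (- x)) / h - g x) < e"
        using N2(2)[of "- x" e] \<open>- x \<notin> N2\<close> e by (auto simp: divide_inverse mult.commute)
      define d where "d = min (min d1 d2) (min (x - a) (b - x))"
      show "\<exists>d>0. \<forall>h. h \<noteq> 0 \<and> norm (h - 0) < d \<longrightarrow> norm ((f (x + h) - f x) / h - g x) < e"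
      proof (intro exI conjI allI impI; (elim conjE)?)
        show "0 < d" using d1 d2 x by (simp add: d_def)
        fix h :: real assume h: "h \<noteq> 0" "norm (h - 0) < d"
        show "norm ((f (x + h) - f x) / h - g x) < e"
        proof (cases "0 < h")
          case True
          have "integral {x..x + h} g = f (x + h) - f x"
            using True h x by (intro integral_unique fg) (auto simp: d_def)
          then show ?thesis using d1(2)[of h] True h by (simp add: d_def)
        next
          case False
          have "(g has_integral (f x - f (x + h))) {x + h..x}"
            using False h x by (intro fg) (auto simp: d_def)
          then have "((\<lambda>x. g (- x)) has_integral (f x - f (x + h))) {- x..- (x + h)}"
            by (simp only: has_integral_reflect_real)
          then have "integral {- x..- x + - h} (\<lambda>x. g (- x)) = f x - f (x + h)"
            by (intro integral_unique) simp
          moreover have "(f x - f (x + h)) / (- h) = (f (x + h) - f x) / h"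
            using h by (simp add: field_simps)
          ultimately show ?thesis using d2(2)[of "- h"] False h by (simp add: d_def)
        qed
      qed
    qed
  qed
qed

section \<open>Finite-dimensional normed spaces\<close>

text \<open>A basis with its coordinate functionals. The continuity of all norms and of all linear maps follows from
  that of the coordinates.\<close>

definition coordinates :: "'a::real_normed_vector set \<Rightarrow> ('a \<Rightarrow> 'a \<Rightarrow> real) \<Rightarrow> bool" where
  "coordinates B \<phi> \<longleftrightarrow> finite B \<and> (\<forall>b\<in>B. bounded_linear (\<phi> b)) \<and> (\<forall>v. (\<Sum>b\<in>B. \<phi> b v *\<^sub>R b) = v)"

text \<open>Equivalence of norms: on the compact set of coefficient vectors of \<open>\<ell>\<^sup>1\<close>-norm one, the norm of the
  linear combination stays away from zero.\<close>

lemma independent_norm_lower_bound: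
  fixes B :: "'a::real_normed_vector set"
  assumes "finite B" "independent B"
  obtains c where "0 < c" "\<And>a. c * (\<Sum>b\<in>B. abs (a b)) \<le> norm (\<Sum>b\<in>B. a b *\<^sub>R b)"
proof -
  have "\<exists>c>0. \<forall>a. (\<Sum>b\<in>B. abs (a b)) = 1 \<longrightarrow> c \<le> norm (\<Sum>b\<in>B. a b *\<^sub>R b)"
  proof (rule ccontr)
    assume neg: "\<not> ?thesis"
    have "\<exists>a. (\<Sum>b\<in>B. abs (a b)) = 1 \<and> \<not> inverse (real (Suc n)) \<le> norm (\<Sum>b\<in>B. a b *\<^sub>R b)" for n
    proof (rule ccontr)
      assume *: "\<not> ?thesis"
      have "0 < inverse (real (Suc n))" by simp
      with * have "\<exists>c>0. \<forall>a. (\<Sum>b\<in>B. abs (a b)) = 1 \<longrightarrow> c \<le> norm (\<Sum>b\<in>B. a b *\<^sub>R b)"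
        by (intro exI[of _ "inverse (real (Suc n))"]) simp
      with neg show False by (rule notE)
    qed
    then have "\<forall>n. \<exists>a. (\<Sum>b\<in>B. abs (a b)) = 1 \<and> \<not> inverse (real (Suc n)) \<le> norm (\<Sum>b\<in>B. a b *\<^sub>R b)" ..
    from choice[OF this] obtain A :: "nat \<Rightarrow> 'a \<Rightarrow> real" where A': "\<forall>n. (\<Sum>b\<in>B. abs (A n b)) = 1 \<and>
      \<not> inverse (real (Suc n)) \<le> norm (\<Sum>b\<in>B. A n b *\<^sub>R b)" ..
    then have A: "(\<Sum>b\<in>B. abs (A n b)) = 1" "norm (\<Sum>b\<in>B. A n b *\<^sub>R b) < inverse (real (Suc n))" for n
      by (simp_all only: not_le)
    have bnd: "bounded ((\<lambda>x. x k) ` range A)" if "k \<in> B" for k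
    proof (rule boundedI[of _ 1])
      fix y assume "y \<in> (\<lambda>x. x k) ` range A"
      then obtain n where "y = A n k" by auto
      moreover have "abs (A n k) \<le> (\<Sum>b\<in>B. abs (A n b))"
        by (rule member_le_sum[OF that _ assms(1)]) simp
      ultimately show "norm y \<le> 1" using A(1)[of n] by simp
    qed
    have "\<forall>\<delta>\<subseteq>B. \<exists>l r. strict_mono r \<and>
        (\<forall>\<epsilon>>0. eventually (\<lambda>n. \<forall>i\<in>\<delta>. dist (A (r n) i) (l i) < \<epsilon>) sequentially)"
      by (rule compact_lemma_general[where proj="\<lambda>x k. x k" and unproj="\<lambda>x. x" and f=A and basis=B]) (use assms(1) bnd in simp_all)
    note this[THEN spec, THEN mp, OF order_refl]
    then obtain l :: "'a \<Rightarrow> real" and r where r: "strict_mono r" and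
      l: "\<forall>\<epsilon>>0. eventually (\<lambda>n. \<forall>i\<in>B. dist (A (r n) i) (l i) < \<epsilon>) sequentially"
      by (elim exE conjE) (rule that)
    have lim: "(\<lambda>n. A (r n) b) \<longlonglongrightarrow> l b" if "b \<in> B" for b
    proof (rule tendstoI)
      fix e :: real assume "0 < e"
      then have "eventually (\<lambda>n. \<forall>i\<in>B. dist (A (r n) i) (l i) < e) sequentially"
        using l by simp
      then show "eventually (\<lambda>n. dist (A (r n) b) (l b) < e) sequentially"
        by (rule eventually_mono) (use that in simp)
    qed
    have "(\<lambda>n. \<Sum>b\<in>B. abs (A (r n) b)) \<longlonglongrightarrow> (\<Sum>b\<in>B. abs (l b))"
      by (intro tendsto_sum tendsto_rabs lim)
    then have one: "(\<Sum>b\<in>B. abs (l b)) = 1" using A(1) by (simp add: LIMSEQ_const_iff)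
    have "(\<lambda>n. \<Sum>b\<in>B. A (r n) b *\<^sub>R b) \<longlonglongrightarrow> (\<Sum>b\<in>B. l b *\<^sub>R b)"
      by (intro tendsto_sum tendsto_scaleR lim tendsto_const)
    moreover have "(\<lambda>n. \<Sum>b\<in>B. A (r n) b *\<^sub>R b) \<longlonglongrightarrow> 0"
    proof (rule Lim_null_comparison[OF _ LIMSEQ_inverse_real_of_nat])
      show "eventually (\<lambda>n. norm (\<Sum>b\<in>B. A (r n) b *\<^sub>R b) \<le> inverse (real (Suc n))) sequentially"
      proof (rule always_eventually, rule allI)
        fix n
        have "inverse (real (Suc (r n))) \<le> inverse (real (Suc n))"
          using seq_suble[OF r, of n] by (intro le_imp_inverse_le) auto
        then show "norm (\<Sum>b\<in>B. A (r n) b *\<^sub>R b) \<le> inverse (real (Suc n))"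
          using A(2)[of "r n"] by linarith
      qed
    qed
    ultimately have "(\<Sum>b\<in>B. l b *\<^sub>R b) = 0" by (rule LIMSEQ_unique)
    then have "\<forall>b\<in>B. l b = 0" using assms independentD by blast
    with one show False by simp
  qed
  then obtain c where c: "0 < c" "\<And>a. (\<Sum>b\<in>B. abs (a b)) = 1 \<Longrightarrow> c \<le> norm (\<Sum>b\<in>B. a b *\<^sub>R b)" by blast
  show ?thesis
  proof (rule that[OF c(1)])
    fix a :: "'a \<Rightarrow> real"
    define s where "s = (\<Sum>b\<in>B. abs (a b))"
    show "c * (\<Sum>b\<in>B. abs (a b)) \<le> norm (\<Sum>b\<in>B. a b *\<^sub>R b)"
    proof (cases "s = 0")
      case True then show ?thesis by (simp add: s_def)
    next
      case False
      moreover have "0 \<le> s" unfolding s_def by (rule sum_nonneg) simp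
      ultimately have s: "0 < s" by simp
      have "(\<Sum>b\<in>B. abs (a b / s)) = s / s"
        using s unfolding s_def by (simp add: sum_divide_distrib[symmetric] abs_divide)
      then have "c \<le> norm (\<Sum>b\<in>B. (a b / s) *\<^sub>R b)" using s by (intro c(2)) simp
      also have "(\<Sum>b\<in>B. (a b / s) *\<^sub>R b) = (1 / s) *\<^sub>R (\<Sum>b\<in>B. a b *\<^sub>R b)"
        by (simp add: scaleR_sum_right)
      finally show ?thesis using s by (simp add: s_def[symmetric] field_simps)
    qed
  qed
qed

lemma coordinates_exist:
  fixes B :: "'a::real_normed_vector set"
  assumes "finite B" "span B = UNIV"
  obtains C \<phi> where "coordinates (C :: 'a set) \<phi>"
proof -
  obtain C where C: "C \<subseteq> B" "independent C" "B \<subseteq> span C"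
    using maximal_independent_subset[of B] by metis
  have fin: "finite C" using C(1) assms(1) finite_subset by blast
  have span: "span C = UNIV"
    using C assms(2) span_minimal[OF C(3)] subspace_span by blast
  obtain c where c: "0 < c" "\<And>a. c * (\<Sum>b\<in>C. abs (a b)) \<le> norm (\<Sum>b\<in>C. a b *\<^sub>R b)"
    by (rule independent_norm_lower_bound[OF fin C(2)]) (rule that)
  define \<phi> where "\<phi> b v = representation C v b" for b v
  have rep: "(\<Sum>b\<in>C. \<phi> b v *\<^sub>R b) = v" for v
    unfolding \<phi>_def by (rule sum_representation_eq[OF C(2)]) (use span fin in auto)
  have "bounded_linear (\<phi> b)" if "b \<in> C" for b
  proof (rule bounded_linear_intro[where K="1/c"])
    show "\<phi> b (x + y) = \<phi> b x + \<phi> b y" for x y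
      unfolding \<phi>_def using representation_add[OF C(2), of y x] span by simp
    show "\<phi> b (r *\<^sub>R x) = r *\<^sub>R \<phi> b x" for r x
      unfolding \<phi>_def using representation_scale[OF C(2), of x r] span by simp
    show "norm (\<phi> b x) \<le> norm x * (1 / c)" for x
    proof -
      have "c * norm (\<phi> b x) \<le> c * (\<Sum>b\<in>C. abs (\<phi> b x))"
        using member_le_sum[OF that, of "\<lambda>b. abs (\<phi> b x)"] fin c(1) by simp
      also have "\<dots> \<le> norm x" using c(2)[of "\<lambda>b. \<phi> b x"] by (simp add: rep)
      finally show ?thesis using c(1) by (simp add: field_simps)
    qed
  qed
  then have "coordinates C \<phi>" using fin rep by (simp add: coordinates_def)
  then show ?thesis by (rule that)
qed

lemma coordinates_linear_bounded:
  fixes f :: "'a::real_normed_vector \<Rightarrow> 'b::real_normed_vector"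
  assumes coord: "coordinates (B :: 'a set) \<phi>" and f: "linear f"
  shows "bounded_linear f"
proof -
  have "bounded_linear (\<lambda>v. \<Sum>b\<in>B. \<phi> b v *\<^sub>R f b)"
    using coord
    by (intro bounded_linear_sum bounded_linear_scaleR_const) (auto simp: coordinates_def)
  moreover have "f v = (\<Sum>b\<in>B. \<phi> b v *\<^sub>R f b)" for v
  proof -
    have "f v = f (\<Sum>b\<in>B. \<phi> b v *\<^sub>R b)" using coord by (simp add: coordinates_def)
    also have "\<dots> = (\<Sum>b\<in>B. \<phi> b v *\<^sub>R f b)"
      by (simp add: linear_sum[OF f] linear_cmul[OF f])
    finally show ?thesis .
  qed
  then have eq: "f = (\<lambda>v. \<Sum>b\<in>B. \<phi> b v *\<^sub>R f b)" by (rule ext)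
  ultimately show ?thesis by (subst eq)
qed

text \<open>Multiplication in a chart is a function on the product of the model space with itself.\<close>

lemma coordinates_prod:
  fixes B :: "'a::real_normed_vector set"
  assumes "finite B" "span B = UNIV"
  obtains C \<phi> where "coordinates (C :: ('a \<times> 'a) set) \<phi>"
proof -
  let ?C = "(\<lambda>b. (b, 0)) ` B \<union> (\<lambda>b. (0, b)) ` B"
  have lin1: "linear (\<lambda>b::'a. (b, 0::'a))" and lin2: "linear (\<lambda>b::'a. (0::'a, b))"
    by (auto intro!: linearI)
  have "z \<in> span ?C" for z
  proof -
    have "(fst z, 0) \<in> span ((\<lambda>b. (b, 0::'a)) ` B)"
      unfolding linear_span_image[OF lin1] assms(2) by simp
    moreover have "(0, snd z) \<in> span ((\<lambda>b. (0::'a, b)) ` B)"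
      unfolding linear_span_image[OF lin2] assms(2) by simp
    ultimately have "(fst z, 0) + (0, snd z) \<in> span ?C"
      by (intro span_add) (meson Un_upper1 Un_upper2 span_mono subsetD)+
    then show ?thesis by simp
  qed
  then have "span ?C = UNIV" by blast
  then show ?thesis using coordinates_exist[of ?C] assms(1) that by blast
qed

text \<open>The minimum of \<open>n\<close> on the compact unit sphere serves as the constant, unless the space is trivial and
  the sphere is empty.\<close>

lemma homogeneous_lower_bound:
  fixes n :: "'a::{real_normed_vector, heine_borel} \<Rightarrow> real"
  assumes cont: "continuous_on UNIV n" and pos: "\<And>v. v \<noteq> 0 \<Longrightarrow> 0 < n v"
    and hom: "\<And>a v. n (a *\<^sub>R v) = \<bar>a\<bar> * n v"
  obtains c where "0 < c" "\<And>v. c * norm v \<le> n v"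
proof (cases "sphere (0::'a) 1 = {}")
  case True
  have zero: "v = 0" for v :: 'a
  proof (rule ccontr)
    assume "v \<noteq> 0"
    then have "(1 / norm v) *\<^sub>R v \<in> sphere 0 1" by simp
    with True show False by blast
  qed
  have "n (0 *\<^sub>R 0) = \<bar>0\<bar> * n 0" by (rule hom)
  then have "n 0 = 0" by simp
  then have "1 * norm v \<le> n v" for v using zero[of v] by simp
  then show ?thesis using that[of 1] by simp
next
  case False
  have "bounded (sphere (0::'a) 1)" by (rule bounded_subset[OF bounded_cball sphere_cball])
  moreover have "sphere (0::'a) 1 = {x. norm x = 1}" by auto
  then have "closed (sphere (0::'a) 1)" by (simp only:) (intro closed_Collect_eq continuous_intros)
  ultimately have "compact (sphere (0::'a) 1)" by (simp add: compact_eq_bounded_closed)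
  then obtain m where m: "m \<in> sphere 0 1" "\<And>v. v \<in> sphere 0 1 \<Longrightarrow> n m \<le> n v"
    using continuous_attains_inf[OF _ False continuous_on_subset[OF cont subset_UNIV]] by blast
  have "m \<noteq> 0" using m(1) by auto
  show ?thesis
  proof (rule that[OF pos[OF \<open>m \<noteq> 0\<close>]])
    fix v
    show "n m * norm v \<le> n v"
    proof (cases "v = 0")
      case True
      have "n (0 *\<^sub>R 0) = \<bar>0\<bar> * n 0" by (rule hom)
      then show ?thesis using True by simp
    next
      case False
      then have "n m \<le> n ((1 / norm v) *\<^sub>R v)" by (intro m(2)) simp
      also have "\<dots> = n v / norm v" by (simp add: hom)
      finally show ?thesis using False by (simp add: field_simps)
    qed
  qed
qed

text \<open>The norm \<open>nrm\<close> is unrelated to the one that defines the topology. The triangle inequality bounds it by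
  a combination of the coordinate functionals.\<close>

lemma is_norm_continuous:
  fixes nrm :: "'a::real_normed_vector \<Rightarrow> real"
  assumes coord: "coordinates (B :: 'a set) \<phi>" and n: "is_norm nrm"
  shows "continuous_on UNIV nrm"
proof -
  have fin: "finite B" and bl: "\<And>i. i \<in> B \<Longrightarrow> bounded_linear (\<phi> i)"
    and rep: "\<And>v. (\<Sum>i\<in>B. \<phi> i v *\<^sub>R i) = v"
    using coord by (auto simp: coordinates_def)
  have tri: "nrm (v + w) \<le> nrm v + nrm w" and hom: "nrm (a *\<^sub>R v) = \<bar>a\<bar> * nrm v"
    and nn: "0 \<le> nrm v" and zero: "nrm 0 = 0" for v w a
    using n by (auto simp: is_norm_def)
  have upper: "nrm v \<le> (\<Sum>i\<in>B. \<bar>\<phi> i v\<bar> * nrm i)" for v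
  proof -
    have "nrm (\<Sum>i\<in>F. \<phi> i v *\<^sub>R i) \<le> (\<Sum>i\<in>F. \<bar>\<phi> i v\<bar> * nrm i)" if "finite F" for F
      using that
    proof induction
      case empty
      then show ?case by (simp add: zero)
    next
      case (insert x F)
      then show ?case using tri[of "\<phi> x v *\<^sub>R x" "\<Sum>i\<in>F. \<phi> i v *\<^sub>R i"] by (simp add: hom)
    qed
    from this[OF fin] show ?thesis by (simp add: rep)
  qed
  have diff: "\<bar>nrm y - nrm x\<bar> \<le> nrm (y - x)" for x y
    using tri[of "y - x" x] tri[of "x - y" y] hom[of "-1" "y - x"] by simp
  have "isCont nrm x" for x
    unfolding isCont_def
  proof (rule LIM_zero_cancel, rule Lim_null_comparison)
    show "\<forall>\<^sub>F y in at x. norm (nrm y - nrm x) \<le> (\<Sum>i\<in>B. \<bar>\<phi> i (y - x)\<bar> * nrm i)"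
      by (intro always_eventually allI) (use diff upper in \<open>auto intro: order_trans\<close>)
    have "((\<lambda>y. \<Sum>i\<in>B. \<bar>\<phi> i (y - x)\<bar> * nrm i) \<longlongrightarrow> (\<Sum>i\<in>B. \<bar>\<phi> i (x - x)\<bar> * nrm i)) (at x)"
      by (intro tendsto_sum tendsto_mult tendsto_rabs bounded_linear.tendsto[OF bl] tendsto_diff tendsto_ident_at tendsto_const)
    moreover have "(\<Sum>i\<in>B. \<bar>\<phi> i (x - x)\<bar> * nrm i) = 0"
      by (intro sum.neutral) (auto simp: linear_0[OF bounded_linear.linear[OF bl]])
    ultimately show "((\<lambda>y. \<Sum>i\<in>B. \<bar>\<phi> i (y - x)\<bar> * nrm i) \<longlongrightarrow> 0) (at x)" by simp
  qed
  then show ?thesis by (simp add: continuous_on_eq_continuous_at)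
qed

lemma euclidean_norm_lower_bound:
  fixes N :: "'a::{real_normed_vector, heine_borel} \<Rightarrow> real"
  assumes coord: "coordinates (B :: 'a set) \<phi>" and N: "is_euclidean_norm N"
  obtains c where "0 < c" "\<And>v. c * norm v \<le> N v"
proof -
  obtain Q where Q: "bilinear Q" "\<And>v. v \<noteq> 0 \<Longrightarrow> 0 < Q v v" "\<And>v. N v = sqrt (Q v v)"
    using N by (auto simp: is_euclidean_norm_def)
  have rep: "\<And>v. (\<Sum>i\<in>B. \<phi> i v *\<^sub>R i) = v" and bl: "\<And>i. i \<in> B \<Longrightarrow> bounded_linear (\<phi> i)"
    using coord by (auto simp: coordinates_def)
  have lin1: "linear (\<lambda>v. Q v w)" and lin2: "linear (Q w)" for w
    using Q(1) by (auto simp: bilinear_def)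
  have Q_eq: "Q v w = (\<Sum>i\<in>B. \<phi> i v * Q i w)" for v w
  proof -
    have "Q v w = Q (\<Sum>i\<in>B. \<phi> i v *\<^sub>R i) w" by (simp add: rep)
    also have "\<dots> = (\<Sum>i\<in>B. \<phi> i v * Q i w)"
      using linear_sum[OF lin1[of w], of "\<lambda>i. \<phi> i v *\<^sub>R i" B] linear_cmul[OF lin1[of w]] by simp
    finally show ?thesis .
  qed
  have "continuous_on UNIV (\<lambda>v. \<Sum>i\<in>B. \<phi> i v * Q i v)"
    by (intro continuous_on_sum continuous_on_mult)
      (auto intro!: linear_continuous_on bl coordinates_linear_bounded[OF coord lin2])
  then have cont: "continuous_on UNIV N"
    unfolding Q(3)[abs_def] by (subst Q_eq) (rule continuous_on_real_sqrt)
  show ?thesis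
  proof (rule homogeneous_lower_bound[OF cont])
    show "0 < N v" if "v \<noteq> 0" for v using Q(2)[OF that] by (simp add: Q(3))
    show "N (a *\<^sub>R v) = \<bar>a\<bar> * N v" for a v
    proof -
      have "Q (a *\<^sub>R v) (a *\<^sub>R v) = a\<^sup>2 * Q v v"
        using linear_cmul[OF lin1, of a v "a *\<^sub>R v"] linear_cmul[OF lin2, of v a v]
        by (simp add: power2_eq_square)
      then show ?thesis by (simp add: Q(3) real_sqrt_mult)
    qed
  qed (rule that)
qed

section \<open>Absolutely continuous curves with a continuous derivative\<close>

text \<open>Every point of a nondegenerate interval \<open>I\<close>, endpoints included, has arbitrarily short compact
  nondegenerate intervals as neighbourhoods relative to \<open>I\<close>. One-sided derivatives at the endpoints of \<open>I\<close> can
  therefore be computed on compact intervals.\<close>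

lemma interval_neighbourhood:
  fixes I :: "real set"
  assumes "is_interval I" "t \<in> I" "u \<in> I" "u \<noteq> t" "0 < h"
  obtains a b e where "a < b" "t \<in> {a..b}" "{a..b} \<subseteq> I" "b - a < h" "0 < e" "I \<inter> ball t e \<subseteq> {a..b}"
proof -
  define a where "a = (if \<exists>v\<in>I. v < t then max (t - h / 3) (SOME v. v \<in> I \<and> v < t) else t)"
  define b where "b = (if \<exists>v\<in>I. t < v then min (t + h / 3) (SOME v. v \<in> I \<and> t < v) else t)"
  have a: "a \<in> I" "a \<le> t" "t - h / 3 \<le> a" "(\<exists>v\<in>I. v < t) \<Longrightarrow> a < t"
  proof -
    have "a \<in> I \<and> a \<le> t \<and> t - h / 3 \<le> a \<and> ((\<exists>v\<in>I. v < t) \<longrightarrow> a < t)"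
    proof (cases "\<exists>v\<in>I. v < t")
      case True
      define v where "v = (SOME v. v \<in> I \<and> v < t)"
      have v: "v \<in> I" "v < t" using True someI_ex[of "\<lambda>v. v \<in> I \<and> v < t"] by (auto simp: v_def)
      have "a = max (t - h / 3) v" using True by (simp add: a_def v_def)
      moreover have "max (t - h / 3) v \<in> I"
        using mem_is_interval_1_I[OF assms(1) v(1) assms(2)] v(2) \<open>0 < h\<close> by simp
      ultimately show ?thesis using v \<open>0 < h\<close> by auto
    qed (use assms in \<open>auto simp: a_def\<close>)
    then show "a \<in> I" "a \<le> t" "t - h / 3 \<le> a" "(\<exists>v\<in>I. v < t) \<Longrightarrow> a < t" by auto
  qed
  have b: "b \<in> I" "t \<le> b" "b \<le> t + h / 3" "(\<exists>v\<in>I. t < v) \<Longrightarrow> t < b"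
  proof -
    have "b \<in> I \<and> t \<le> b \<and> b \<le> t + h / 3 \<and> ((\<exists>v\<in>I. t < v) \<longrightarrow> t < b)"
    proof (cases "\<exists>v\<in>I. t < v")
      case True
      define v where "v = (SOME v. v \<in> I \<and> t < v)"
      have v: "v \<in> I" "t < v" using True someI_ex[of "\<lambda>v. v \<in> I \<and> t < v"] by (auto simp: v_def)
      have "b = min (t + h / 3) v" using True by (simp add: b_def v_def)
      moreover have "min (t + h / 3) v \<in> I"
        using mem_is_interval_1_I[OF assms(1) assms(2) v(1)] v(2) \<open>0 < h\<close> by simp
      ultimately show ?thesis using v \<open>0 < h\<close> by auto
    qed (use assms in \<open>auto simp: b_def\<close>)
    then show "b \<in> I" "t \<le> b" "b \<le> t + h / 3" "(\<exists>v\<in>I. t < v) \<Longrightarrow> t < b" by auto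
  qed
  define e where "e = min (if a < t then t - a else 1) (if t < b then b - t else 1)"
  show ?thesis
  proof (rule that[of a b e])
    show "a < b"
      using a b assms(3,4) by (metis linorder_neqE_linordered_idom order_le_less_trans order_less_le_trans)
    show "t \<in> {a..b}" using a b by simp
    show "{a..b} \<subseteq> I" using mem_is_interval_1_I[OF assms(1) a(1) b(1)] by auto
    show "b - a < h" using a b \<open>0 < h\<close> by simp
    show "0 < e" by (simp add: e_def)
    show "I \<inter> ball t e \<subseteq> {a..b}"
    proof
      fix z assume z: "z \<in> I \<inter> ball t e"
      then have "abs (z - t) < e" by (simp add: dist_real_def abs_minus_commute)
      moreover have "z < t \<Longrightarrow> a < t" "t < z \<Longrightarrow> t < b" using a(4) b(4) z by auto
      ultimately show "z \<in> {a..b}"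
        using a(2) b(2) by (cases "z < t"; cases "t < z") (auto simp: e_def)
    qed
  qed
qed

lemma interval_not_isolated:
  fixes I :: "real set"
  assumes "is_interval I" "t \<in> I" "u \<in> I" "u \<noteq> t"
  shows "at t within I \<noteq> bot"
proof -
  obtain a b e where ab: "a < b" "t \<in> {a..b}" "{a..b} \<subseteq> I"
    by (rule interval_neighbourhood[OF assms zero_less_one]) (rule that)
  have "t islimpt {a..b}" using ab(1,2) by (simp add: islimpt_Icc)
  then have "t islimpt I" using ab(3) by (rule islimpt_subset)
  then show ?thesis by (simp add: trivial_limit_within)
qed

lemma at_within_eq_nhd:
  assumes "0 < e" "I \<inter> ball t e \<subseteq> J" "J \<subseteq> I"
  shows "at t within J = at t within I"
  by (rule at_within_nhd[of t "ball t e"]) (use assms in auto)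

text \<open>Coordinatewise, \<open>f\<close> is the integral of functions \<open>h\<close> that are the derivatives of the coordinates almost
  everywhere. At almost every point all coordinates are differentiable, hence so is \<open>f\<close>, and
  \<open>h\<close> must be the corresponding coordinate of \<open>g\<close>.\<close>

lemma abs_continuous_has_vector_derivative_bounded_variation:
  fixes f :: "real \<Rightarrow> 'a::real_normed_vector"
  assumes coord: "coordinates (B :: 'a set) \<phi>" and "a < b" and ac: "abs_continuous_on a b f"
    and C: "\<And>D. nonoverlapping a b D \<Longrightarrow> (\<Sum>(s, t)\<in>D. norm (f t - f s)) \<le> C"
    and g: "continuous_on {a..b} g" and N: "negligible N"
    and fg: "\<And>t d. \<lbrakk>t \<in> {a<..<b} - N; (f has_vector_derivative d) (at t)\<rbrakk> \<Longrightarrow> d = g t"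
    and t: "t \<in> {a..b}"
  shows "(f has_vector_derivative g t) (at t within {a..b})"
proof -
  have fin: "finite B" and bl: "\<And>i. i \<in> B \<Longrightarrow> bounded_linear (\<phi> i)"
    and rep: "\<And>v. (\<Sum>i\<in>B. \<phi> i v *\<^sub>R i) = v"
    using coord by (auto simp: coordinates_def)
  have "\<exists>M h. negligible M \<and>
      (\<forall>x y. a \<le> x \<longrightarrow> x \<le> y \<longrightarrow> y \<le> b \<longrightarrow> (h has_integral (\<phi> i (f y) - \<phi> i (f x))) {x..y}) \<and>
      (\<forall>x\<in>{a<..<b} - M. ((\<lambda>x. \<phi> i (f x)) has_real_derivative h x) (at x))" if i: "i \<in> B" for i
  proof -
    interpret bounded_linear "\<phi> i" by (rule bl[OF i])
    obtain K where K: "0 \<le> K" "\<And>x. norm (\<phi> i x) \<le> norm x * K" using nonneg_bounded by blast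
    have ac_i: "abs_continuous_on a b (\<lambda>x. \<phi> i (f x))"
      by (rule abs_continuous_on_bounded_linear[OF ac bl[OF i]])
    have C_i: "(\<Sum>(s, t)\<in>D. abs (\<phi> i (f t) - \<phi> i (f s))) \<le> C * K" if "nonoverlapping a b D" for D
    proof -
      have "(\<Sum>(s, t)\<in>D. abs (\<phi> i (f t) - \<phi> i (f s))) \<le> (\<Sum>(s, t)\<in>D. norm (f t - f s)) * K"
        unfolding sum_distrib_right
      proof (rule sum_mono, clarsimp)
        fix s t
        show "abs (\<phi> i (f t) - \<phi> i (f s)) \<le> norm (f t - f s) * K"
          using K(2)[of "f t - f s"] by (simp add: diff)
      qed
      also have "\<dots> \<le> C * K" by (rule mult_right_mono[OF C[OF that] K(1)])
      finally show ?thesis .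
    qed
    obtain h where h: "integrable lborel h"
      "\<And>x y. \<lbrakk>a \<le> x; x \<le> y; y \<le> b\<rbrakk> \<Longrightarrow> (h has_integral (\<phi> i (f y) - \<phi> i (f x))) {x..y}"
      by (rule abs_continuous_imp_integral[OF less_imp_le[OF \<open>a < b\<close>] ac_i C_i]) (assumption, rule that)
    obtain M where "negligible M"
      "\<And>x. x \<in> {a<..<b} - M \<Longrightarrow> ((\<lambda>x. \<phi> i (f x)) has_real_derivative h x) (at x)"
      by (rule integral_imp_AE_differentiable[OF h]) (assumption+, rule that)
    then show ?thesis using h(2) by (intro exI[of _ M] exI[of _ h]) simp
  qed
  then obtain M h where M: "\<And>i. i \<in> B \<Longrightarrow> negligible (M i)"
    and h: "\<And>i x y. \<lbrakk>i \<in> B; a \<le> x; x \<le> y; y \<le> b\<rbrakk> \<Longrightarrow>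
      (h i has_integral (\<phi> i (f y) - \<phi> i (f x))) {x..y}"
    and Mh: "\<And>i x. \<lbrakk>i \<in> B; x \<in> {a<..<b} - M i\<rbrakk> \<Longrightarrow>
      ((\<lambda>x. \<phi> i (f x)) has_real_derivative h i x) (at x)"
    by metis
  define N' where "N' = N \<union> (\<Union>i\<in>B. M i) \<union> {a, b}"
  have N': "negligible N'"
    unfolding N'_def using fin M N by (intro negligible_Un negligible_Union) auto
  have h_eq: "h i x = \<phi> i (g x)" if i: "i \<in> B" and x: "x \<in> {a..b} - N'" for i x
  proof -
    have x': "x \<in> {a<..<b} - N" "\<And>j. j \<in> B \<Longrightarrow> x \<in> {a<..<b} - M j"
      using x by (auto simp: N'_def)
    have "((\<lambda>x. \<Sum>j\<in>B. \<phi> j (f x) *\<^sub>R j) has_vector_derivative (\<Sum>j\<in>B. h j x *\<^sub>R j)) (at x)"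
    proof (rule has_vector_derivative_sum)
      fix j assume j: "j \<in> B"
      show "((\<lambda>x. \<phi> j (f x) *\<^sub>R j) has_vector_derivative h j x *\<^sub>R j) (at x)"
        using has_vector_derivative_scaleR[OF Mh[OF j x'(2)[OF j]] has_vector_derivative_const[of j]]
        by simp
    qed
    then have "(f has_vector_derivative (\<Sum>j\<in>B. h j x *\<^sub>R j)) (at x)" by (simp add: rep)
    note df = this
    from fg[OF x'(1) df] have "(\<Sum>j\<in>B. h j x *\<^sub>R j) = g x" .
    with df have "(f has_vector_derivative g x) (at x)" by simp
    from bounded_linear.has_vector_derivative[OF bl[OF i] this]
    have "((\<lambda>x. \<phi> i (f x)) has_real_derivative \<phi> i (g x)) (at x)"
      by (simp add: has_real_derivative_iff_has_vector_derivative)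
    with Mh[OF i x'(2)[OF i]] show ?thesis by (rule DERIV_unique)
  qed
  have der: "((\<lambda>x. \<phi> i (f x)) has_vector_derivative \<phi> i (g t)) (at t within {a..b})" if i: "i \<in> B" for i
  proof -
    have cont: "continuous_on {a..b} (\<lambda>x. \<phi> i (g x))"
      by (rule continuous_on_compose2[OF linear_continuous_on[OF bl[OF i]] g]) auto
    have eq: "\<phi> i (f x) = \<phi> i (f a) + integral {a..x} (\<lambda>x. \<phi> i (g x))" if x: "x \<in> {a..b}" for x
    proof -
      have "((\<lambda>x. \<phi> i (g x)) has_integral (\<phi> i (f x) - \<phi> i (f a))) {a..x}"
        by (rule has_integral_spike[OF N' _ h[OF i]]) (use h_eq[OF i] x in auto)
      then show ?thesis by (simp add: integral_unique)
    qed
    have "((\<lambda>x. integral {a..x} (\<lambda>x. \<phi> i (g x))) has_vector_derivative \<phi> i (g t)) (at t within {a..b})"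
      by (rule integral_has_vector_derivative[OF cont t])
    then have "((\<lambda>x. \<phi> i (f a) + integral {a..x} (\<lambda>x. \<phi> i (g x))) has_vector_derivative \<phi> i (g t))
        (at t within {a..b})"
      by (auto intro!: derivative_eq_intros)
    then show ?thesis
      by (rule has_vector_derivative_transform[OF t eq, rotated])
  qed
  have "((\<lambda>x. \<Sum>j\<in>B. \<phi> j (f x) *\<^sub>R j) has_vector_derivative (\<Sum>j\<in>B. \<phi> j (g t) *\<^sub>R j)) (at t within {a..b})"
  proof (rule has_vector_derivative_sum)
    fix j assume j: "j \<in> B"
    show "((\<lambda>x. \<phi> j (f x) *\<^sub>R j) has_vector_derivative \<phi> j (g t) *\<^sub>R j) (at t within {a..b})"
      using has_vector_derivative_scaleR[OF der[OF j, folded has_real_derivative_iff_has_vector_derivative]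
          has_vector_derivative_const[of j]]
      by simp
  qed
  then show ?thesis by (simp add: rep)
qed

text \<open>An absolutely continuous curve is differentiable almost everywhere and is the integral of its
  derivative; if this derivative agrees almost everywhere with a continuous function, the curve is
  therefore of class \<open>C\<^sup>1\<close>. Only derivatives that exist are constrained by the hypothesis: that they
  exist almost everywhere is part of what is proved. The statement is local, which allows reducing to
  an interval so short that absolute continuity bounds the total variation.\<close>

theorem abs_continuous_has_vector_derivative:
  fixes f :: "real \<Rightarrow> 'a::real_normed_vector"
  assumes coord: "coordinates (B :: 'a set) \<phi>" and "a < b" and ac: "abs_continuous_on a b f"
    and g: "continuous_on {a..b} g" and N: "negligible N"
    and fg: "\<And>t d. \<lbrakk>t \<in> {a<..<b} - N; (f has_vector_derivative d) (at t)\<rbrakk> \<Longrightarrow> d = g t"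
    and t: "t \<in> {a..b}"
  shows "(f has_vector_derivative g t) (at t within {a..b})"
proof -
  obtain h where h: "0 < h" "\<And>D. nonoverlapping a b D \<Longrightarrow> (\<Sum>(s, t)\<in>D. t - s) < h \<Longrightarrow>
      (\<Sum>(s, t)\<in>D. norm (f t - f s)) < 1"
    by (rule abs_continuous_onE[OF ac zero_less_one]) (rule that)
  have "\<exists>u\<in>{a..b}. u \<noteq> t"
    using \<open>a < b\<close> by (metis atLeastAtMost_iff less_imp_le less_irrefl order_refl)
  then obtain u where u: "u \<in> {a..b}" "u \<noteq> t" by blast
  obtain c d e where cd: "c < d" "t \<in> {c..d}" "{c..d} \<subseteq> {a..b}" "d - c < h" "0 < e"
    "{a..b} \<inter> ball t e \<subseteq> {c..d}"
    by (rule interval_neighbourhood[OF is_interval_cc t u h(1)]) (rule that)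
  have ab: "a \<le> c" "d \<le> b" using cd(1,3) by auto
  have "(f has_vector_derivative g t) (at t within {c..d})"
  proof (rule abs_continuous_has_vector_derivative_bounded_variation[OF coord cd(1) _ _ _ N _ cd(2), where C=1])
    show "abs_continuous_on c d f" by (rule abs_continuous_on_subinterval[OF ac ab])
    show "(\<Sum>(s, t)\<in>D. norm (f t - f s)) \<le> 1" if "nonoverlapping c d D" for D
    proof -
      have "(\<Sum>(s, t)\<in>D. t - s) < h"
        using nonoverlapping_length_le[OF that] cd(1,4) by simp
      from h(2)[OF nonoverlapping_mono[OF that ab] this] show ?thesis by simp
    qed
    show "continuous_on {c..d} g" using g cd(3) by (rule continuous_on_subset)
    show "\<And>t d'. t \<in> {c<..<d} - N \<Longrightarrow> (f has_vector_derivative d') (at t) \<Longrightarrow> d' = g t"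
      using fg ab by auto
  qed
  then show ?thesis using at_within_eq_nhd[OF cd(5,6,3)] by simp
qed

section \<open>The Legendre transform of the energy\<close>

text \<open>The inverse of the subdifferential. For a strongly convex norm there is exactly one \<open>w\<close> to choose for
  each covector \<open>\<eta>\<close>.\<close>

definition legendre :: "('v::real_vector \<Rightarrow> real) \<Rightarrow> ('v \<Rightarrow> real) \<Rightarrow> 'v" where
  "legendre nrm \<eta> = (SOME w. \<eta> \<in> subdifferential (energy nrm) w)"

lemma subdifferentialD:
  "\<eta> \<in> subdifferential F w \<Longrightarrow> linear \<eta>"
  "\<eta> \<in> subdifferential F w \<Longrightarrow> \<eta> (v - w) \<le> F v - F w"
  by (auto simp: subdifferential_def)

text \<open>A minimiser \<open>w\<close> of \<open>E - \<eta>\<close> has \<open>\<eta>\<close> as subgradient. It exists because the energy grows quadratically and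
  \<open>\<eta>\<close> linearly.\<close>

lemma subgradient_exists:
  fixes nrm :: "'a::{real_normed_vector, heine_borel} \<Rightarrow> real"
  assumes coord: "coordinates (B :: 'a set) \<phi>" and n: "is_norm nrm" and \<eta>: "linear \<eta>"
  obtains w where "\<eta> \<in> subdifferential (energy nrm) w"
proof -
  have cont: "continuous_on UNIV nrm" by (rule is_norm_continuous[OF coord n])
  obtain c where c: "0 < c" "\<And>v. c * norm v \<le> nrm v"
    by (rule homogeneous_lower_bound[OF cont])
      (use n in \<open>auto simp: is_norm_def less_le\<close>)
  interpret \<eta>: bounded_linear \<eta> by (rule coordinates_linear_bounded[OF coord \<eta>])
  obtain K where K: "0 < K" "\<And>x. norm (\<eta> x) \<le> norm x * K" using \<eta>.pos_bounded by blast
  define F where "F v = energy nrm v - \<eta> v" for v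
  (* for |v| >= R the quadratic term c^2 |v|^2 / 2 exceeds K |v|, so E v - \<eta> v is positive *)
  define R where "R = 2 * K / c\<^sup>2"
  have "0 < R" using K c by (simp add: R_def)
  have "continuous_on (cball 0 R) F"
    unfolding F_def energy_def
    by (intro continuous_intros continuous_on_subset[OF cont] linear_continuous_on \<eta>.bounded_linear_axioms) auto
  moreover have "compact (cball (0::'a) R)" by (simp add: compact_eq_bounded_closed)
  moreover have "cball (0::'a) R \<noteq> {}" using \<open>0 < R\<close> by auto
  ultimately obtain w where w: "w \<in> cball 0 R" "\<And>v. v \<in> cball 0 R \<Longrightarrow> F w \<le> F v"
    using continuous_attains_inf by metis
  have zero: "F 0 = 0" using n by (simp add: F_def energy_def is_norm_def \<eta>.zero)
  have "F w \<le> F v" for v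
  proof (cases "v \<in> cball 0 R")
    case False
    then have v: "R < norm v" by simp
    then have "2 * K < c\<^sup>2 * norm v" using c(1) by (simp add: R_def field_simps)
    then have "norm v * (2 * K) \<le> norm v * (c\<^sup>2 * norm v)" by (intro mult_left_mono) auto
    moreover have "(c * norm v)\<^sup>2 \<le> (nrm v)\<^sup>2" using c by (intro power_mono) auto
    moreover have "\<eta> v \<le> norm v * K" using K(2)[of v] by simp
    ultimately have "0 \<le> F v"
      by (simp add: F_def energy_def power_mult_distrib power2_eq_square[of "norm v"] algebra_simps)
    moreover have "F w \<le> F 0" using \<open>0 < R\<close> by (intro w(2)) simp
    ultimately show ?thesis using zero by simp
  qed (rule w(2))
  then have "\<eta> (v - w) \<le> energy nrm v - energy nrm w" for v
    by (simp add: F_def \<eta>.diff algebra_simps)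
  then have "\<eta> \<in> subdifferential (energy nrm) w" using \<eta> by (simp add: subdifferential_def)
  then show ?thesis by (rule that)
qed

text \<open>Strong convexity makes the subdifferential strongly monotone; comparing the two subgradients at
  the midpoint of their base points already gives this.\<close>

lemma subdifferential_strongly_monotone:
  fixes nrm :: "'a::{real_normed_vector, heine_borel} \<Rightarrow> real"
  assumes coord: "coordinates (B :: 'a set) \<phi>" and sc: "strongly_convex_norm nrm"
  obtains c where "0 < c" "\<And>\<eta>1 \<eta>2 w1 w2. \<lbrakk>\<eta>1 \<in> subdifferential (energy nrm) w1;
      \<eta>2 \<in> subdifferential (energy nrm) w2\<rbrakk> \<Longrightarrow>
      c * (norm (w1 - w2))\<^sup>2 \<le> \<eta>1 (w1 - w2) - \<eta>2 (w1 - w2)"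
proof -
  obtain N where N: "is_euclidean_norm N" and
    conv: "\<And>v w t. t \<in> {0..1} \<Longrightarrow> energy nrm (t *\<^sub>R v + (1 - t) *\<^sub>R w)
        \<le> t * energy nrm v + (1 - t) * energy nrm w - t * (1 - t) * (N (w - v))\<^sup>2"
    using sc unfolding strongly_convex_norm_def by blast
  obtain c where c: "0 < c" "\<And>v. c * norm v \<le> N v"
    by (rule euclidean_norm_lower_bound[OF coord N]) (rule that)
  (* the subgradient inequality at the midpoint of v and w, combined with convexity between them *)
  have half: "\<eta> (v - w) \<le> energy nrm v - energy nrm w - (c * norm (w - v))\<^sup>2 / 2"
    if \<eta>: "\<eta> \<in> subdifferential (energy nrm) w" for \<eta> v w
  proof -
    let ?m = "(1/2) *\<^sub>R v + (1 - 1/2) *\<^sub>R w"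
    have "?m - w = (1/2) *\<^sub>R (v - w)" by (simp add: algebra_simps scaleR_left_diff_distrib[symmetric] flip: scaleR_add_left)
    then have "\<eta> (v - w) / 2 = \<eta> (?m - w)"
      using linear_cmul[OF subdifferentialD(1)[OF \<eta>], of "1/2" "v - w"] by simp
    also have "\<dots> \<le> energy nrm ?m - energy nrm w" by (rule subdifferentialD(2)[OF \<eta>])
    also have "\<dots> \<le> energy nrm v / 2 - energy nrm w / 2 - (N (w - v))\<^sup>2 / 4"
      using conv[of "1/2" v w] by (simp add: field_simps)
    finally have "\<eta> (v - w) \<le> energy nrm v - energy nrm w - (N (w - v))\<^sup>2 / 2" by simp
    moreover have "(c * norm (w - v))\<^sup>2 \<le> (N (w - v))\<^sup>2" using c by (intro power_mono) auto
    ultimately show ?thesis by simp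
  qed
  show ?thesis
  proof (rule that[of "c\<^sup>2"])
    show "0 < c\<^sup>2" using c by simp
    fix \<eta>1 \<eta>2 w1 w2
    assume *: "\<eta>1 \<in> subdifferential (energy nrm) w1" "\<eta>2 \<in> subdifferential (energy nrm) w2"
    have "\<eta>1 (w2 - w1) = - \<eta>1 (w1 - w2)"
      using linear_diff[OF subdifferentialD(1)[OF *(1)]] by simp
    then show "c\<^sup>2 * (norm (w1 - w2))\<^sup>2 \<le> \<eta>1 (w1 - w2) - \<eta>2 (w1 - w2)"
      using half[OF *(1), of w2] half[OF *(2), of w1]
      by (simp add: norm_minus_commute power_mult_distrib)
  qed
qed

lemma legendre_iff:
  fixes nrm :: "'a::{real_normed_vector, heine_borel} \<Rightarrow> real"
  assumes coord: "coordinates (B :: 'a set) \<phi>" and n: "is_norm nrm"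
    and sc: "strongly_convex_norm nrm" and \<eta>: "linear \<eta>"
  shows "\<eta> \<in> subdifferential (energy nrm) w \<longleftrightarrow> w = legendre nrm \<eta>"
proof -
  obtain c where c: "0 < c" "\<And>\<eta>1 \<eta>2 w1 w2. \<lbrakk>\<eta>1 \<in> subdifferential (energy nrm) w1;
      \<eta>2 \<in> subdifferential (energy nrm) w2\<rbrakk> \<Longrightarrow>
      c * (norm (w1 - w2))\<^sup>2 \<le> \<eta>1 (w1 - w2) - \<eta>2 (w1 - w2)"
    by (rule subdifferential_strongly_monotone[OF coord sc]) (rule that)
  obtain w0 where "\<eta> \<in> subdifferential (energy nrm) w0"
    by (rule subgradient_exists[OF coord n \<eta>])
  then have mem: "\<eta> \<in> subdifferential (energy nrm) (legendre nrm \<eta>)"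
    unfolding legendre_def by (rule someI)
  have "w = legendre nrm \<eta>" if "\<eta> \<in> subdifferential (energy nrm) w"
  proof -
    have "c * (norm (w - legendre nrm \<eta>))\<^sup>2 \<le> 0" using c(2)[OF that mem] by simp
    then show ?thesis using c(1) by (simp add: mult_le_0_iff)
  qed
  then show ?thesis using mem by blast
qed

lemma legendre_lipschitz:
  fixes nrm :: "'a::{real_normed_vector, heine_borel} \<Rightarrow> real"
  assumes coord: "coordinates (B :: 'a set) \<phi>" and n: "is_norm nrm" and sc: "strongly_convex_norm nrm"
  obtains L where "0 \<le> L" "\<And>\<eta>1 \<eta>2 \<delta>. \<lbrakk>linear \<eta>1; linear \<eta>2; 0 \<le> \<delta>; \<And>v. \<bar>\<eta>1 v - \<eta>2 v\<bar> \<le> \<delta> * norm v\<rbrakk> \<Longrightarrow>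
      norm (legendre nrm \<eta>1 - legendre nrm \<eta>2) \<le> L * \<delta>"
proof -
  obtain c where c: "0 < c" "\<And>\<eta>1 \<eta>2 w1 w2. \<lbrakk>\<eta>1 \<in> subdifferential (energy nrm) w1;
      \<eta>2 \<in> subdifferential (energy nrm) w2\<rbrakk> \<Longrightarrow>
      c * (norm (w1 - w2))\<^sup>2 \<le> \<eta>1 (w1 - w2) - \<eta>2 (w1 - w2)"
    by (rule subdifferential_strongly_monotone[OF coord sc]) (rule that)
  show ?thesis
  proof (rule that[of "1 / c"])
    show "0 \<le> 1 / c" using c by simp
    fix \<eta>1 \<eta>2 :: "'a \<Rightarrow> real" and \<delta>
    assume lin: "linear \<eta>1" "linear \<eta>2" and "0 \<le> \<delta>" and \<delta>: "\<And>v. \<bar>\<eta>1 v - \<eta>2 v\<bar> \<le> \<delta> * norm v"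
    let ?w = "legendre nrm \<eta>1 - legendre nrm \<eta>2"
    have "c * (norm ?w)\<^sup>2 \<le> \<eta>1 ?w - \<eta>2 ?w"
      by (rule c(2)) (simp_all add: legendre_iff[OF coord n sc] lin)
    also have "\<dots> \<le> \<delta> * norm ?w" using \<delta>[of ?w] by simp
    finally have *: "c * norm ?w * norm ?w \<le> \<delta> * norm ?w" by (simp add: power2_eq_square mult.assoc)
    show "norm ?w \<le> 1 / c * \<delta>"
    proof (cases "?w = 0")
      case False
      then have "c * norm ?w \<le> \<delta>" using * by (simp add: mult_le_cancel_right)
      then show ?thesis using c(1) by (simp add: field_simps)
    next
      case True
      then show ?thesis using \<open>0 \<le> \<delta>\<close> c(1) by simp
    qed
  qed
qed

text \<open>Along each line through \<open>w\<close>, a subgradient minorises the energy with equality at \<open>w\<close>, so it is the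
  directional derivative there. At the origin the energy is differentiable for every norm, by
  homogeneity.\<close>

lemma subgradient_unique:
  fixes nrm :: "'a::real_normed_vector \<Rightarrow> real"
  assumes n: "is_norm nrm" and w: "w = 0 \<or> nrm differentiable (at w)"
    and \<eta>1: "\<eta>1 \<in> subdifferential (energy nrm) w" and \<eta>2: "\<eta>2 \<in> subdifferential (energy nrm) w"
  shows "\<eta>1 = \<eta>2"
proof
  fix v
  have "\<exists>D. ((\<lambda>s. energy nrm (w + s *\<^sub>R v)) has_real_derivative D) (at 0)"
  proof (cases "w = 0")
    case True
    have "energy nrm (w + s *\<^sub>R v) = s\<^sup>2 * energy nrm v" for s
      using n True by (simp add: energy_def is_norm_def power_mult_distrib)
    moreover have "((\<lambda>s. s\<^sup>2 * energy nrm v) has_real_derivative 0) (at 0)"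
      by (auto intro!: derivative_eq_intros)
    ultimately show ?thesis by auto
  next
    case False
    then obtain n' where n': "(nrm has_derivative n') (at w)" using w by (auto simp: differentiable_def)
    have "((\<lambda>s. nrm (w + s *\<^sub>R v)) has_derivative (\<lambda>s. n' (s *\<^sub>R v))) (at 0)"
      by (rule has_derivative_compose[of "\<lambda>s. w + s *\<^sub>R v" "\<lambda>s. s *\<^sub>R v" 0 UNIV nrm n'])
        (use n' in \<open>auto intro!: derivative_eq_intros\<close>)
    then have "((\<lambda>s. nrm (w + s *\<^sub>R v)) has_real_derivative n' v) (at 0)"
      by (rule has_derivative_imp_has_field_derivative)
        (simp add: linear_cmul[OF has_derivative_linear[OF n']])
    then have "((\<lambda>s. (nrm (w + s *\<^sub>R v))\<^sup>2 / 2) has_real_derivative nrm w * n' v) (at 0)"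
      by (auto intro!: derivative_eq_intros)
    then show ?thesis by (auto simp: energy_def)
  qed
  then obtain D where D: "((\<lambda>s. energy nrm (w + s *\<^sub>R v)) has_real_derivative D) (at 0)" ..
  have eq: "\<eta> v = D" if \<eta>: "\<eta> \<in> subdifferential (energy nrm) w" for \<eta>
  proof -
    have le: "energy nrm w \<le> energy nrm (w + s *\<^sub>R v) - s * \<eta> v" for s
      using subdifferentialD(2)[OF \<eta>, of "w + s *\<^sub>R v"]
        linear_cmul[OF subdifferentialD(1)[OF \<eta>], of s v] by simp
    have "((\<lambda>s. energy nrm (w + s *\<^sub>R v) - s * \<eta> v) has_real_derivative D - \<eta> v) (at 0)"
      by (auto intro!: derivative_eq_intros D)
    then have "D - \<eta> v = 0"
      by (rule DERIV_local_min[of _ _ _ 1]) (use le in auto)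
    then show ?thesis by simp
  qed
  show "\<eta>1 v = \<eta>2 v" using eq[OF \<eta>1] eq[OF \<eta>2] by simp
qed

section \<open>Locally Lipschitz families of linear maps\<close>

text \<open>Lipschitz continuity near a point, for vector-valued maps and, in operator norm, for families of
  linear maps. Both are formulated with the neighbourhood filter of \<open>(x0, x0)\<close>, so that finitely many such
  conditions combine without a choice of radii.\<close>

definition lip_near :: "('a::real_normed_vector \<Rightarrow> 'b::real_normed_vector) \<Rightarrow> 'a \<Rightarrow> bool" where
  "lip_near f x0 \<longleftrightarrow> (\<exists>L\<ge>0. \<forall>\<^sub>F p in nhds (x0, x0). norm (f (fst p) - f (snd p)) \<le> L * norm (fst p - snd p))"

definition op_lip_near ::
  "('a::real_normed_vector \<Rightarrow> 'b::real_normed_vector \<Rightarrow> 'c::real_normed_vector) \<Rightarrow> 'a \<Rightarrow> bool" where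
  "op_lip_near T x0 \<longleftrightarrow> (\<exists>L\<ge>0. (\<forall>\<^sub>F x in nhds x0. linear (T x) \<and> (\<forall>v. norm (T x v) \<le> L * norm v)) \<and>
     (\<forall>\<^sub>F p in nhds (x0, x0). \<forall>v. norm (T (fst p) v - T (snd p) v) \<le> L * norm (fst p - snd p) * norm v))"

lemma eventually_nhds_fst_snd:
  assumes "\<forall>\<^sub>F x in nhds (x0 :: 'a::topological_space). P x"
  shows "\<forall>\<^sub>F p in nhds (x0, x0). P (fst p) \<and> P (snd p)"
proof (rule eventually_conj)
  have "filterlim fst (nhds x0) (nhds (x0, x0))"
    using tendsto_fst[OF tendsto_ident_at[of "(x0, x0)" UNIV]]
    by (metis filterlim_fst filterlim_ident nhds_prod)
  then show "\<forall>\<^sub>F p in nhds (x0, x0). P (fst p)" by (rule eventually_compose_filterlim[OF assms])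
  have "filterlim snd (nhds x0) (nhds (x0, x0))"
    by (metis filterlim_snd nhds_prod)
  then show "\<forall>\<^sub>F p in nhds (x0, x0). P (snd p)" by (rule eventually_compose_filterlim[OF assms])
qed

lemma eventually_nhds_prod_ball:
  fixes x0 :: "'a::metric_space"
  assumes "\<forall>\<^sub>F p in nhds (x0, x0). P p"
  obtains r where "0 < r" "\<And>x y. \<lbrakk>x \<in> ball x0 r; y \<in> ball x0 r\<rbrakk> \<Longrightarrow> P (x, y)"
proof -
  obtain Q R where Q: "\<forall>\<^sub>F x in nhds x0. Q x" and R: "\<forall>\<^sub>F x in nhds x0. R x"
    and P: "\<And>x y. Q x \<Longrightarrow> R y \<Longrightarrow> P (x, y)"
    using assms unfolding nhds_prod eventually_prod_filter by blast
  have "\<forall>\<^sub>F x in nhds x0. Q x \<and> R x" using Q R by (rule eventually_conj)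
  then obtain r where "0 < r" "\<And>x. dist x x0 < r \<Longrightarrow> Q x \<and> R x"
    unfolding eventually_nhds_metric by blast
  then show ?thesis using P by (intro that[of r]) (auto simp: dist_commute)
qed

lemma eventually_nhds_prod_ballI:
  fixes x0 :: "'a::metric_space"
  assumes "0 < r" "\<And>x y. \<lbrakk>x \<in> ball x0 r; y \<in> ball x0 r\<rbrakk> \<Longrightarrow> P (x, y)"
  shows "\<forall>\<^sub>F p in nhds (x0, x0). P p"
proof -
  have "\<forall>\<^sub>F x in nhds x0. x \<in> ball x0 r"
    using assms(1) by (intro eventually_nhds_in_open) auto
  from eventually_nhds_fst_snd[OF this] show ?thesis
    by (rule eventually_mono) (metis assms(2) prod.collapse)
qed

lemma lip_near_ball:
  assumes "lip_near f x0"
  obtains r L where "0 < r" "0 \<le> L" "\<And>x y. \<lbrakk>x \<in> ball x0 r; y \<in> ball x0 r\<rbrakk> \<Longrightarrow> norm (f x - f y) \<le> L * norm (x - y)"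
proof -
  obtain L where L: "0 \<le> L" "\<forall>\<^sub>F p in nhds (x0, x0). norm (f (fst p) - f (snd p)) \<le> L * norm (fst p - snd p)"
    using assms unfolding lip_near_def by blast
  obtain r where "0 < r" "\<And>x y. \<lbrakk>x \<in> ball x0 r; y \<in> ball x0 r\<rbrakk> \<Longrightarrow>
      norm (f (fst (x, y)) - f (snd (x, y))) \<le> L * norm (fst (x, y) - snd (x, y))"
    by (rule eventually_nhds_prod_ball[OF L(2)]) (rule that)
  then show ?thesis using that L(1) by simp
qed

lemma lip_near_ballI:
  assumes "0 < r" "\<And>x y. \<lbrakk>x \<in> ball x0 r; y \<in> ball x0 r\<rbrakk> \<Longrightarrow> norm (f x - f y) \<le> L * norm (x - y)"
  shows "lip_near f x0"
  unfolding lip_near_def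
proof (intro exI[of _ "max L 0"] conjI)
  have "norm (f x - f y) \<le> max L 0 * norm (x - y)" if "x \<in> ball x0 r" "y \<in> ball x0 r" for x y
    using assms(2)[OF that] mult_right_mono[of L "max L 0" "norm (x - y)"] by simp
  then show "\<forall>\<^sub>F p in nhds (x0, x0). norm (f (fst p) - f (snd p)) \<le> max L 0 * norm (fst p - snd p)"
    by (intro eventually_nhds_prod_ballI[OF assms(1)]) simp
qed simp

lemma lip_near_tendsto:
  assumes "lip_near f x0"
  shows "filterlim f (nhds (f x0)) (nhds x0)"
proof -
  obtain r L where *: "0 < r" "0 \<le> L" "\<And>x y. \<lbrakk>x \<in> ball x0 r; y \<in> ball x0 r\<rbrakk> \<Longrightarrow> norm (f x - f y) \<le> L * norm (x - y)"
    by (rule lip_near_ball[OF assms]) (rule that)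
  have "((\<lambda>x. f x - f x0) \<longlongrightarrow> 0) (at x0)"
  proof (rule Lim_null_comparison)
    have "\<forall>\<^sub>F x in at x0. x \<in> ball x0 r" using *(1) by (intro eventually_at_in_open') auto
    then show "\<forall>\<^sub>F x in at x0. norm (f x - f x0) \<le> L * norm (x - x0)"
      by eventually_elim (use * in auto)
    have "((\<lambda>x. L * norm (x - x0)) \<longlongrightarrow> L * norm (x0 - x0)) (at x0)" by (intro tendsto_intros)
    then show "((\<lambda>x. L * norm (x - x0)) \<longlongrightarrow> 0) (at x0)" by simp
  qed
  then have "isCont f x0" unfolding isCont_def by (rule LIM_zero_cancel)
  then show ?thesis by (simp add: isCont_def tendsto_at_iff_tendsto_nhds)
qed

lemma lip_near_bounded:
  assumes "lip_near f x0"
  shows "\<forall>\<^sub>F x in nhds x0. norm (f x) \<le> norm (f x0) + 1"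
proof -
  have "\<forall>\<^sub>F x in nhds x0. dist (f x) (f x0) < 1"
    using tendstoD[OF lip_near_tendsto[OF assms] zero_less_one] .
  then show ?thesis
  proof eventually_elim
    case (elim x)
    have "norm (f x) \<le> norm (f x0) + norm (f x - f x0)" by norm
    with elim show ?case by (simp add: dist_norm)
  qed
qed

lemma lip_near_pair_filterlim:
  assumes "lip_near f x0"
  shows "filterlim (\<lambda>p. (f (fst p), f (snd p))) (nhds (f x0, f x0)) (nhds (x0, x0))"
proof -
  have "filterlim (\<lambda>p. f (fst p)) (nhds (f x0)) (nhds (x0, x0))"
    "filterlim (\<lambda>p. f (snd p)) (nhds (f x0)) (nhds (x0, x0))"
    unfolding nhds_prod
    by (rule filterlim_compose[OF lip_near_tendsto[OF assms]], rule filterlim_fst,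
        rule filterlim_compose[OF lip_near_tendsto[OF assms]], rule filterlim_snd)
  then show ?thesis by (rule tendsto_Pair)
qed

lemma lip_near_const: "lip_near (\<lambda>x. c) x0"
  unfolding lip_near_def by (intro exI[of _ 0]) simp

lemma lip_near_ident_pair:
  assumes "lip_near f x0"
  shows "lip_near (\<lambda>x. (x, f x)) x0"
proof -
  obtain L where L: "0 \<le> L" "\<forall>\<^sub>F p in nhds (x0, x0). norm (f (fst p) - f (snd p)) \<le> L * norm (fst p - snd p)"
    using assms(1) unfolding lip_near_def by blast
  from L(2) have "\<forall>\<^sub>F p in nhds (x0, x0).
      norm ((fst p, f (fst p)) - (snd p, f (snd p))) \<le> (1 + L) * norm (fst p - snd p)"
  proof eventually_elim
    case (elim p)
    have "norm ((fst p, f (fst p)) - (snd p, f (snd p))) \<le> norm (fst p - snd p) + norm (f (fst p) - f (snd p))"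
      using norm_Pair_le[of "fst p - snd p" "f (fst p) - f (snd p)"] by simp
    with elim show ?case by (simp add: algebra_simps)
  qed
  then show ?thesis unfolding lip_near_def using L(1) by (intro exI[of _ "1 + L"]) simp
qed

lemma op_lip_near_const:
  assumes "bounded_linear T"
  shows "op_lip_near (\<lambda>x. T) x0"
proof -
  interpret bounded_linear T by fact
  obtain K where K: "0 \<le> K" "\<And>x. norm (T x) \<le> norm x * K" using nonneg_bounded by blast
  then show ?thesis unfolding op_lip_near_def
    by (intro exI[of _ K]) (auto simp: linear_axioms mult.commute)
qed

lemma op_lip_near_reparam:
  assumes "lip_near f x0" "op_lip_near T (f x0)"
  shows "op_lip_near (\<lambda>x. T (f x)) x0"
proof -
  obtain L where L: "0 \<le> L" "\<forall>\<^sub>F p in nhds (x0, x0). norm (f (fst p) - f (snd p)) \<le> L * norm (fst p - snd p)"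
    using assms(1) unfolding lip_near_def by blast
  obtain M where M: "0 \<le> M"
    "\<forall>\<^sub>F x in nhds (f x0). linear (T x) \<and> (\<forall>v. norm (T x v) \<le> M * norm v)"
    "\<forall>\<^sub>F p in nhds (f x0, f x0). \<forall>v. norm (T (fst p) v - T (snd p) v) \<le> M * norm (fst p - snd p) * norm v"
    using assms(2) unfolding op_lip_near_def by blast
  from eventually_compose_filterlim[OF M(3) lip_near_pair_filterlim[OF assms(1)]] L(2)
  have 1: "\<forall>\<^sub>F p in nhds (x0, x0). \<forall>v. norm (T (f (fst p)) v - T (f (snd p)) v)
      \<le> (M + M * L) * norm (fst p - snd p) * norm v"
  proof eventually_elim
    case (elim p)
    show ?case
    proof
      fix v
      have "norm (T (f (fst p)) v - T (f (snd p)) v) \<le> M * norm (f (fst p) - f (snd p)) * norm v"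
        using elim(1) by simp
      also have "\<dots> \<le> M * (L * norm (fst p - snd p)) * norm v"
        using elim(2) M(1) by (intro mult_right_mono mult_left_mono) auto
      also have "\<dots> \<le> (M + M * L) * norm (fst p - snd p) * norm v"
        using M(1) L(1) by (simp add: algebra_simps)
      finally show "norm (T (f (fst p)) v - T (f (snd p)) v) \<le> (M + M * L) * norm (fst p - snd p) * norm v" .
    qed
  qed
  from eventually_compose_filterlim[OF M(2) lip_near_tendsto[OF assms(1)]]
  have 2: "\<forall>\<^sub>F x in nhds x0. linear (T (f x)) \<and> (\<forall>v. norm (T (f x) v) \<le> (M + M * L) * norm v)"
  proof eventually_elim
    case (elim x)
    have "M * norm v \<le> (M + M * L) * norm v" for v :: 'c
      using M(1) L(1) by (intro mult_right_mono) auto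
    with elim show ?case by (meson order_trans)
  qed
  show ?thesis unfolding op_lip_near_def using 1 2 L(1) M(1) by (intro exI[of _ "M + M * L"]) simp
qed

lemma op_lip_near_compose:
  assumes "op_lip_near S x0" "op_lip_near T x0"
  shows "op_lip_near (\<lambda>x v. T x (S x v)) x0"
proof -
  obtain L where L: "0 \<le> L"
    "\<forall>\<^sub>F x in nhds x0. linear (S x) \<and> (\<forall>v. norm (S x v) \<le> L * norm v)"
    "\<forall>\<^sub>F p in nhds (x0, x0). \<forall>v. norm (S (fst p) v - S (snd p) v) \<le> L * norm (fst p - snd p) * norm v"
    using assms(1) unfolding op_lip_near_def by blast
  obtain M where M: "0 \<le> M"
    "\<forall>\<^sub>F x in nhds x0. linear (T x) \<and> (\<forall>v. norm (T x v) \<le> M * norm v)"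
    "\<forall>\<^sub>F p in nhds (x0, x0). \<forall>v. norm (T (fst p) v - T (snd p) v) \<le> M * norm (fst p - snd p) * norm v"
    using assms(2) unfolding op_lip_near_def by blast
  from L(2) M(2) have 1: "\<forall>\<^sub>F x in nhds x0. linear (\<lambda>v. T x (S x v)) \<and>
      (\<forall>v. norm (T x (S x v)) \<le> (2 * M * L) * norm v)"
  proof eventually_elim
    case (elim x)
    have "norm (T x (S x v)) \<le> (2 * M * L) * norm v" for v
    proof -
      have "norm (T x (S x v)) \<le> M * norm (S x v)" using elim(2) by simp
      also have "\<dots> \<le> M * (L * norm v)" using elim(1) M(1) by (intro mult_left_mono) auto
      also have "\<dots> \<le> (2 * M * L) * norm v" using M(1) L(1) by simp
      finally show ?thesis .
    qed
    moreover have "linear (T x \<circ> S x)" using elim by (intro linear_compose) auto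
    ultimately show ?case by (simp add: o_def)
  qed
  from L(3) M(3) eventually_nhds_fst_snd[OF L(2)] eventually_nhds_fst_snd[OF M(2)]
  have 2: "\<forall>\<^sub>F p in nhds (x0, x0). \<forall>v. norm (T (fst p) (S (fst p) v) - T (snd p) (S (snd p) v))
      \<le> (2 * M * L) * norm (fst p - snd p) * norm v"
  proof eventually_elim
    case (elim p)
    show ?case
    proof
      fix v
      have lin: "linear (T (fst p))" using elim(4) by blast
      have "T (fst p) (S (fst p) v) - T (snd p) (S (snd p) v) =
          T (fst p) (S (fst p) v - S (snd p) v) + (T (fst p) (S (snd p) v) - T (snd p) (S (snd p) v))"
        by (simp add: linear_diff[OF lin])
      then have "norm (T (fst p) (S (fst p) v) - T (snd p) (S (snd p) v))
          \<le> norm (T (fst p) (S (fst p) v - S (snd p) v)) + norm (T (fst p) (S (snd p) v) - T (snd p) (S (snd p) v))"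
        by (metis norm_triangle_ineq)
      also have "\<dots> \<le> M * norm (S (fst p) v - S (snd p) v) + M * norm (fst p - snd p) * norm (S (snd p) v)"
        using elim(2,4) by (intro add_mono) blast+
      also have "\<dots> \<le> M * (L * norm (fst p - snd p) * norm v) + M * norm (fst p - snd p) * (L * norm v)"
        using elim(1,3) M(1) by (intro add_mono mult_left_mono) auto
      also have "\<dots> = (2 * M * L) * norm (fst p - snd p) * norm v" by simp
      finally show "norm (T (fst p) (S (fst p) v) - T (snd p) (S (snd p) v))
          \<le> (2 * M * L) * norm (fst p - snd p) * norm v" .
    qed
  qed
  show ?thesis unfolding op_lip_near_def using 1 2 L(1) M(1) by (intro exI[of _ "2 * M * L"]) simp
qed

lemma op_lip_near_cong:
  assumes "\<forall>\<^sub>F x in nhds x0. S x = T x" "op_lip_near S x0"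
  shows "op_lip_near T x0"
proof -
  obtain L where L: "0 \<le> L"
    "\<forall>\<^sub>F x in nhds x0. linear (S x) \<and> (\<forall>v. norm (S x v) \<le> L * norm v)"
    "\<forall>\<^sub>F p in nhds (x0, x0). \<forall>v. norm (S (fst p) v - S (snd p) v) \<le> L * norm (fst p - snd p) * norm v"
    using assms(2) unfolding op_lip_near_def by blast
  from L(2) assms(1) have 1: "\<forall>\<^sub>F x in nhds x0. linear (T x) \<and> (\<forall>v. norm (T x v) \<le> L * norm v)"
    by eventually_elim simp
  from L(3) eventually_nhds_fst_snd[OF assms(1)]
  have 2: "\<forall>\<^sub>F p in nhds (x0, x0). \<forall>v. norm (T (fst p) v - T (snd p) v) \<le> L * norm (fst p - snd p) * norm v"
    by eventually_elim simp
  show ?thesis unfolding op_lip_near_def using 1 2 L(1) by blast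
qed

text \<open>A vector is the operator \<open>s \<mapsto> s v\<close> on \<open>\<real>\<close>; this reduces the application of a family of operators
  to their composition.\<close>

lemma op_lip_near_apply:
  assumes "op_lip_near T x0" "lip_near f x0"
  shows "lip_near (\<lambda>x. T x (f x)) x0"
proof -
  obtain L where L: "0 \<le> L" "\<forall>\<^sub>F p in nhds (x0, x0). norm (f (fst p) - f (snd p)) \<le> L * norm (fst p - snd p)"
    using assms(2) unfolding lip_near_def by blast
  have "op_lip_near (\<lambda>x (s::real). s *\<^sub>R f x) x0"
    unfolding op_lip_near_def
  proof (intro exI[of _ "L + (norm (f x0) + 1)"] conjI)
    show "\<forall>\<^sub>F x in nhds x0. linear (\<lambda>s::real. s *\<^sub>R f x) \<and> (\<forall>s::real. norm (s *\<^sub>R f x) \<le> (L + (norm (f x0) + 1)) * norm s)"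
      using lip_near_bounded[OF assms(2)]
    proof eventually_elim
      case (elim x)
      have "norm (s *\<^sub>R f x) \<le> (L + (norm (f x0) + 1)) * norm s" for s :: real
        using mult_right_mono[of "norm (f x)" "L + (norm (f x0) + 1)" "\<bar>s\<bar>"] elim L(1)
        by (simp add: mult.commute)
      then show ?case by (auto intro: linearI simp: scaleR_left_distrib)
    qed
    from L(2) show "\<forall>\<^sub>F p in nhds (x0, x0). \<forall>s::real. norm (s *\<^sub>R f (fst p) - s *\<^sub>R f (snd p))
        \<le> (L + (norm (f x0) + 1)) * norm (fst p - snd p) * norm s"
    proof eventually_elim
      case (elim p)
      show ?case
      proof
        fix s :: real
        have "norm (s *\<^sub>R f (fst p) - s *\<^sub>R f (snd p)) = \<bar>s\<bar> * norm (f (fst p) - f (snd p))"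
          by (simp flip: scaleR_diff_right)
        also have "\<dots> \<le> \<bar>s\<bar> * ((L + (norm (f x0) + 1)) * norm (fst p - snd p))"
          using elim mult_right_mono[of L "L + (norm (f x0) + 1)" "norm (fst p - snd p)"]
          by (intro mult_left_mono) auto
        finally show "norm (s *\<^sub>R f (fst p) - s *\<^sub>R f (snd p))
            \<le> (L + (norm (f x0) + 1)) * norm (fst p - snd p) * norm s" by (simp add: mult.commute)
      qed
    qed
  qed (use L in auto)
  from op_lip_near_compose[OF this assms(1)]
  obtain M where M: "0 \<le> M" "\<forall>\<^sub>F p in nhds (x0, x0). \<forall>s::real.
      norm (T (fst p) (s *\<^sub>R f (fst p)) - T (snd p) (s *\<^sub>R f (snd p))) \<le> M * norm (fst p - snd p) * norm s"
    unfolding op_lip_near_def by blast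
  have "\<forall>\<^sub>F p in nhds (x0, x0). norm (T (fst p) (f (fst p)) - T (snd p) (f (snd p))) \<le> M * norm (fst p - snd p)"
    using M(2)
  proof eventually_elim
    case (elim p)
    from spec[OF this, of 1] show ?case by simp
  qed
  then show ?thesis unfolding lip_near_def using M(1) by blast
qed

text \<open>In finite dimension it suffices to consider the values on a basis.\<close>

lemma op_lip_near_coordinates:
  fixes T :: "'a::real_normed_vector \<Rightarrow> 'b::real_normed_vector \<Rightarrow> 'c::real_normed_vector"
  assumes coord: "coordinates (B :: 'b set) \<phi>"
    and lin: "\<forall>\<^sub>F x in nhds x0. linear (T x)" and lip: "\<And>b. b \<in> B \<Longrightarrow> lip_near (\<lambda>x. T x b) x0"
  shows "op_lip_near T x0"
proof -
  have fin: "finite B" and bl: "\<And>i. i \<in> B \<Longrightarrow> bounded_linear (\<phi> i)"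
    and rep: "\<And>v. (\<Sum>i\<in>B. \<phi> i v *\<^sub>R i) = v"
    using coord by (auto simp: coordinates_def)
  have T_eq: "T x v = (\<Sum>b\<in>B. \<phi> b v *\<^sub>R T x b)" if "linear (T x)" for x v
  proof -
    have "T x v = T x (\<Sum>b\<in>B. \<phi> b v *\<^sub>R b)" by (simp add: rep)
    then show ?thesis by (simp add: linear_sum[OF that] linear_cmul[OF that])
  qed
  have "\<exists>K. \<forall>b\<in>B. 0 \<le> K b \<and> (\<forall>v. norm (\<phi> b v) \<le> norm v * K b)"
    by (intro bchoice ballI) (metis bounded_linear.nonneg_bounded[OF bl])
  then obtain K where K: "\<And>b. b \<in> B \<Longrightarrow> 0 \<le> K b" "\<And>b v. b \<in> B \<Longrightarrow> norm (\<phi> b v) \<le> norm v * K b"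
    by blast
  have "\<exists>L. \<forall>b\<in>B. 0 \<le> L b \<and> (\<forall>\<^sub>F p in nhds (x0, x0). norm (T (fst p) b - T (snd p) b) \<le> L b * norm (fst p - snd p))"
    using lip unfolding lip_near_def by (intro bchoice) blast
  then obtain L where L: "\<And>b. b \<in> B \<Longrightarrow> 0 \<le> L b"
    "\<And>b. b \<in> B \<Longrightarrow> \<forall>\<^sub>F p in nhds (x0, x0). norm (T (fst p) b - T (snd p) b) \<le> L b * norm (fst p - snd p)"
    by blast
  define M1 where "M1 = (\<Sum>b\<in>B. K b * (norm (T x0 b) + 1))"
  define M2 where "M2 = (\<Sum>b\<in>B. K b * L b)"
  have nn: "0 \<le> M1" "0 \<le> M2" unfolding M1_def M2_def using K(1) L(1) by (auto intro!: sum_nonneg)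
  have "\<forall>\<^sub>F x in nhds x0. \<forall>b\<in>B. norm (T x b) \<le> norm (T x0 b) + 1"
    using fin lip by (intro eventually_ball_finite ballI lip_near_bounded) auto
  with lin have 1: "\<forall>\<^sub>F x in nhds x0. linear (T x) \<and> (\<forall>v. norm (T x v) \<le> (M1 + M2) * norm v)"
  proof eventually_elim
    case (elim x)
    have "norm (T x v) \<le> (M1 + M2) * norm v" for v
    proof -
      have "norm (T x v) \<le> (\<Sum>b\<in>B. norm (\<phi> b v *\<^sub>R T x b))"
        unfolding T_eq[OF elim(1), of v] by (rule norm_sum)
      also have "\<dots> \<le> (\<Sum>b\<in>B. (norm v * K b) * (norm (T x0 b) + 1))"
        using elim(2) K by (intro sum_mono) (auto intro!: mult_mono)
      also have "\<dots> = M1 * norm v" by (simp add: M1_def sum_distrib_left mult_ac)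
      also have "\<dots> \<le> (M1 + M2) * norm v" using nn by (intro mult_right_mono) auto
      finally show ?thesis .
    qed
    with elim show ?case by blast
  qed
  have "\<forall>\<^sub>F p in nhds (x0, x0). \<forall>b\<in>B. norm (T (fst p) b - T (snd p) b) \<le> L b * norm (fst p - snd p)"
    using fin L(2) by (intro eventually_ball_finite ballI) auto
  with eventually_nhds_fst_snd[OF lin]
  have 2: "\<forall>\<^sub>F p in nhds (x0, x0). \<forall>v. norm (T (fst p) v - T (snd p) v) \<le> (M1 + M2) * norm (fst p - snd p) * norm v"
  proof eventually_elim
    case (elim p)
    show ?case
    proof
      fix v
      have lin: "linear (T (fst p))" "linear (T (snd p))" using elim by auto
      have "T (fst p) v - T (snd p) v = (\<Sum>b\<in>B. \<phi> b v *\<^sub>R (T (fst p) b - T (snd p) b))"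
        unfolding T_eq[OF lin(1), of v] T_eq[OF lin(2), of v] by (simp add: sum_subtractf scaleR_diff_right)
      then have "norm (T (fst p) v - T (snd p) v) \<le> (\<Sum>b\<in>B. norm (\<phi> b v *\<^sub>R (T (fst p) b - T (snd p) b)))"
        by (metis norm_sum)
      also have "\<dots> \<le> (\<Sum>b\<in>B. (norm v * K b) * (L b * norm (fst p - snd p)))"
        using elim(2) K by (intro sum_mono) (auto intro!: mult_mono)
      also have "\<dots> = M2 * norm (fst p - snd p) * norm v" by (simp add: M2_def sum_distrib_left mult_ac)
      also have "\<dots> \<le> (M1 + M2) * norm (fst p - snd p) * norm v" using nn by (intro mult_right_mono) auto
      finally show "norm (T (fst p) v - T (snd p) v) \<le> (M1 + M2) * norm (fst p - snd p) * norm v" .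
    qed
  qed
  show ?thesis unfolding op_lip_near_def using 1 2 nn by (intro exI[of _ "M1 + M2"]) simp
qed

lemma C1_lip_near:
  fixes f :: "'a::real_normed_vector \<Rightarrow> 'b::real_normed_vector"
  assumes coord: "coordinates (B :: 'a set) \<phi>" and f: "Ck_on 1 f S" and S: "open S" "x0 \<in> S"
  shows "lip_near f x0"
proof -
  have fin: "finite B" and bl: "\<And>i. i \<in> B \<Longrightarrow> bounded_linear (\<phi> i)"
    and rep: "\<And>v. (\<Sum>i\<in>B. \<phi> i v *\<^sub>R i) = v"
    using coord by (auto simp: coordinates_def)
  define D where "D x = frechet_derivative f (at x)" for x
  have D: "(f has_derivative D x) (at x)" if "x \<in> S" for x
    using f that by (simp add: D_def frechet_derivative_works)
  have cont: "continuous_on S (\<lambda>x. D x v)" for v using f by (simp add: D_def)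
  have "\<exists>K. \<forall>b\<in>B. 0 \<le> K b \<and> (\<forall>v. norm (\<phi> b v) \<le> norm v * K b)"
    by (intro bchoice ballI) (metis bounded_linear.nonneg_bounded[OF bl])
  then obtain K where K: "\<And>b. b \<in> B \<Longrightarrow> 0 \<le> K b" "\<And>b v. b \<in> B \<Longrightarrow> norm (\<phi> b v) \<le> norm v * K b"
    by blast
  define M where "M = (\<Sum>b\<in>B. K b * (norm (D x0 b) + 1))"
  have "\<forall>\<^sub>F x in nhds x0. \<forall>b\<in>B. norm (D x b) < norm (D x0 b) + 1"
  proof (intro eventually_ball_finite fin ballI)
    fix b
    have "isCont (\<lambda>x. norm (D x b)) x0"
      using cont[of b] S by (simp add: continuous_on_eq_continuous_at)
    then have "filterlim (\<lambda>x. norm (D x b)) (nhds (norm (D x0 b))) (nhds x0)"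
      using tendsto_at_iff_tendsto_nhds[of "\<lambda>x. norm (D x b)" x0] by (simp add: isCont_def)
    then show "\<forall>\<^sub>F x in nhds x0. norm (D x b) < norm (D x0 b) + 1"
      by (rule order_tendstoD) simp
  qed
  moreover have "\<forall>\<^sub>F x in nhds x0. x \<in> S" using S by (rule eventually_nhds_in_open)
  ultimately have "\<forall>\<^sub>F x in nhds x0. x \<in> S \<and> (\<forall>b\<in>B. norm (D x b) < norm (D x0 b) + 1)"
    by eventually_elim simp
  then obtain r where r: "0 < r" "\<And>x. dist x x0 < r \<Longrightarrow> x \<in> S \<and> (\<forall>b\<in>B. norm (D x b) < norm (D x0 b) + 1)"
    unfolding eventually_nhds_metric by blast
  have on: "onorm (D x) \<le> M" if "x \<in> ball x0 r" for x
  proof (rule onorm_bound)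
    show "0 \<le> M" unfolding M_def using K(1) by (auto intro!: sum_nonneg)
    fix v
    have x: "x \<in> S" "\<And>b. b \<in> B \<Longrightarrow> norm (D x b) \<le> norm (D x0 b) + 1"
      using r(2)[of x] that by (auto simp: dist_commute less_imp_le)
    have lin: "linear (D x)" by (rule has_derivative_linear[OF D[OF x(1)]])
    have "D x v = D x (\<Sum>b\<in>B. \<phi> b v *\<^sub>R b)" by (simp add: rep)
    also have "\<dots> = (\<Sum>b\<in>B. \<phi> b v *\<^sub>R D x b)" by (simp add: linear_sum[OF lin] linear_cmul[OF lin])
    finally have "norm (D x v) \<le> (\<Sum>b\<in>B. norm (\<phi> b v *\<^sub>R D x b))" by (metis norm_sum)
    also have "\<dots> \<le> (\<Sum>b\<in>B. (norm v * K b) * (norm (D x0 b) + 1))"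
      using x(2) K by (intro sum_mono) (auto intro!: mult_mono)
    also have "\<dots> = M * norm v" by (simp add: M_def sum_distrib_left mult_ac)
    finally show "norm (D x v) \<le> M * norm v" .
  qed
  show ?thesis
  proof (rule lip_near_ballI[OF r(1)])
    fix x y assume xy: "x \<in> ball x0 r" "y \<in> ball x0 r"
    show "norm (f x - f y) \<le> M * norm (x - y)"
    proof (rule differentiable_bound[OF convex_ball _ on xy])
      fix z assume "z \<in> ball x0 r"
      then have "z \<in> S" using r(2)[of z] by (simp add: dist_commute)
      then show "(f has_derivative D z) (at z within ball x0 r)"
        using D has_derivative_at_withinI by blast
    qed
  qed
qed

lemma C2_op_lip_near:
  fixes f :: "'a::real_normed_vector \<Rightarrow> 'b::real_normed_vector"
  assumes coord: "coordinates (B :: 'a set) \<phi>" and f: "Ck_on 2 f S" and S: "open S" "x0 \<in> S"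
  shows "op_lip_near (\<lambda>x. frechet_derivative f (at x)) x0"
proof (rule op_lip_near_coordinates[OF coord])
  have "Ck_on (Suc 1) f S" using f by (simp add: numeral_2_eq_2)
  then have f1: "\<forall>x\<in>S. f differentiable (at x)" "\<And>v. Ck_on 1 (\<lambda>x. frechet_derivative f (at x) v) S"
    unfolding Ck_on.simps(2)[of 1] by blast+
  have "\<forall>\<^sub>F x in nhds x0. x \<in> S" using S by (rule eventually_nhds_in_open)
  then show "\<forall>\<^sub>F x in nhds x0. linear (frechet_derivative f (at x))"
    by eventually_elim (use f1(1) linear_frechet_derivative in blast)
  show "lip_near (\<lambda>x. frechet_derivative f (at x) b) x0" for b
    by (rule C1_lip_near[OF coord f1(2) S])
qed

text \<open>The Legendre transform is Lipschitz for the operator norm on covectors, so it can be composed with a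
  Lipschitz family of covectors.\<close>

lemma legendre_lip_near:
  fixes T :: "'a::real_normed_vector \<Rightarrow> 'b::{real_normed_vector, heine_borel} \<Rightarrow> real"
  assumes coord: "coordinates (B :: 'b set) \<phi>" and n: "is_norm nrm" and sc: "strongly_convex_norm nrm"
    and T: "op_lip_near T x0"
  shows "lip_near (\<lambda>x. legendre nrm (T x)) x0"
proof -
  obtain M where M: "0 \<le> M" "\<And>\<eta>1 \<eta>2 \<delta>. \<lbrakk>linear \<eta>1; linear \<eta>2; 0 \<le> \<delta>; \<And>v. \<bar>\<eta>1 v - \<eta>2 v\<bar> \<le> \<delta> * norm v\<rbrakk> \<Longrightarrow>
      norm (legendre nrm \<eta>1 - legendre nrm \<eta>2) \<le> M * \<delta>"
    by (rule legendre_lipschitz[OF coord n sc]) (rule that, assumption, blast)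
  obtain L where L: "0 \<le> L" "\<forall>\<^sub>F x in nhds x0. linear (T x) \<and> (\<forall>v. norm (T x v) \<le> L * norm v)"
    "\<forall>\<^sub>F p in nhds (x0, x0). \<forall>v. norm (T (fst p) v - T (snd p) v) \<le> L * norm (fst p - snd p) * norm v"
    using T unfolding op_lip_near_def by blast
  from L(3) eventually_nhds_fst_snd[OF L(2)]
  have "\<forall>\<^sub>F p in nhds (x0, x0). norm (legendre nrm (T (fst p)) - legendre nrm (T (snd p))) \<le> (M * L) * norm (fst p - snd p)"
  proof eventually_elim
    case (elim p)
    have "norm (legendre nrm (T (fst p)) - legendre nrm (T (snd p))) \<le> M * (L * norm (fst p - snd p))"
      by (rule M(2)) (use elim L(1) in auto)
    then show ?case by (simp add: mult.assoc)
  qed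
  then show ?thesis unfolding lip_near_def using L(1) M(1) by (intro exI[of _ "M * L"]) simp
qed

section \<open>Local uniqueness for ordinary differential equations\<close>

text \<open>At distance at most \<open>h\<close> from the initial time, where \<open>h L \<le> 1 / 2\<close>, the mean value inequality
  bounds the maximal distance of the two solutions by half of itself.\<close>

lemma ode_unique_near:
  fixes x1 x2 :: "real \<Rightarrow> 'a::real_normed_vector"
  assumes Y: "lip_near Y z0" and t0: "t0 \<in> {a..b}" and init: "x1 t0 = z0" "x2 t0 = z0"
    and x1: "\<And>t. t \<in> {a..b} \<Longrightarrow> (x1 has_vector_derivative Y (x1 t)) (at t within {a..b})"
    and x2: "\<And>t. t \<in> {a..b} \<Longrightarrow> (x2 has_vector_derivative Y (x2 t)) (at t within {a..b})"
  obtains e where "0 < e" "\<And>t. t \<in> {a..b} \<inter> ball t0 e \<Longrightarrow> x1 t = x2 t"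
proof -
  obtain r L where L: "0 < r" "0 \<le> L" "\<And>x y. \<lbrakk>x \<in> ball z0 r; y \<in> ball z0 r\<rbrakk> \<Longrightarrow> norm (Y x - Y y) \<le> L * norm (x - y)"
    by (rule lip_near_ball[OF Y]) (rule that)
  have c1: "continuous_on {a..b} x1" and c2: "continuous_on {a..b} x2"
    unfolding continuous_on_eq_continuous_within
    by (intro ballI has_vector_derivative_continuous[OF x1], assumption)
      (intro ballI has_vector_derivative_continuous[OF x2], assumption)
  obtain d1 where d1: "0 < d1" "\<And>t. t \<in> {a..b} \<Longrightarrow> dist t t0 < d1 \<Longrightarrow> dist (x1 t) z0 < r"
    using c1 t0 L(1) init(1) unfolding continuous_on_iff by metis
  obtain d2 where d2: "0 < d2" "\<And>t. t \<in> {a..b} \<Longrightarrow> dist t t0 < d2 \<Longrightarrow> dist (x2 t) z0 < r"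
    using c2 t0 L(1) init(2) unfolding continuous_on_iff by metis
  define h where "h = min (min d1 d2) (1 / (L + 1)) / 2"
  have h: "0 < h" "h < d1" "h < d2" "h * L \<le> 1 / 2"
  proof -
    show "0 < h" using d1 d2 L(2) by (simp add: h_def)
    show "h < d1" "h < d2" using d1 d2 by (auto simp: h_def min_def)
    have "h \<le> 1 / (L + 1) / 2" unfolding h_def by (rule divide_right_mono) auto
    then have "h * L \<le> (1 / (L + 1) / 2) * L" using L(2) by (rule mult_right_mono)
    also have "\<dots> \<le> 1 / 2" using L(2) by (simp add: field_simps)
    finally show "h * L \<le> 1 / 2" .
  qed
  define S where "S = {max a (t0 - h)..min b (t0 + h)}"
  have S: "S \<subseteq> {a..b}" "t0 \<in> S" "compact S" "convex S" "\<And>t. t \<in> S \<Longrightarrow> \<bar>t - t0\<bar> \<le> h"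
    using t0 h(1) by (auto simp: S_def)
  have cont: "continuous_on S (\<lambda>t. norm (x1 t - x2 t))"
    by (intro continuous_on_norm continuous_on_diff continuous_on_subset[OF c1 S(1)] continuous_on_subset[OF c2 S(1)])
  obtain m where m: "m \<in> S" "\<And>t. t \<in> S \<Longrightarrow> norm (x1 t - x2 t) \<le> norm (x1 m - x2 m)"
    using continuous_attains_sup[OF S(3) _ cont] S(2) by blast
  define M where "M = norm (x1 m - x2 m)"
  have "norm ((x1 m - x2 m) - (x1 t0 - x2 t0)) \<le> (L * M) * norm (m - t0)"
  proof (rule differentiable_bound[OF S(4) _ _ m(1) S(2)])
    fix t assume t: "t \<in> S"
    have "((\<lambda>t. x1 t - x2 t) has_vector_derivative (Y (x1 t) - Y (x2 t))) (at t within S)"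
      using t S(1) by (intro has_vector_derivative_diff has_vector_derivative_within_subset[OF x1 S(1)]
        has_vector_derivative_within_subset[OF x2 S(1)]) auto
    then show "((\<lambda>t. x1 t - x2 t) has_derivative (\<lambda>s. s *\<^sub>R (Y (x1 t) - Y (x2 t)))) (at t within S)"
      by (simp add: has_vector_derivative_def)
    have "dist t t0 < d1" "dist t t0 < d2" using S(5)[OF t] h by (auto simp: dist_real_def)
    then have "x1 t \<in> ball z0 r" "x2 t \<in> ball z0 r"
      using d1(2)[of t] d2(2)[of t] t S(1) by (auto simp: dist_commute)
    then have "norm (Y (x1 t) - Y (x2 t)) \<le> L * norm (x1 t - x2 t)" by (rule L(3))
    also have "\<dots> \<le> L * M" using m(2)[OF t] L(2) by (simp add: M_def mult_left_mono)
    finally have "norm (Y (x1 t) - Y (x2 t)) \<le> L * M" .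
    then show "onorm (\<lambda>s. s *\<^sub>R (Y (x1 t) - Y (x2 t))) \<le> L * M"
      by (intro onorm_le) (simp add: mult.commute[of "L * M"] mult_left_mono)
  qed
  also have "\<dots> \<le> (L * M) * h"
    using S(5)[OF m(1)] L(2) by (intro mult_left_mono) (auto simp: M_def)
  also have "\<dots> = (h * L) * M" by simp
  also have "\<dots> \<le> 1 / 2 * M" using h(4) by (intro mult_right_mono) (auto simp: M_def)
  finally have "M \<le> 0" using init by (simp add: M_def)
  then have eq: "x1 t = x2 t" if "t \<in> S" for t using m(2)[OF that] by (simp add: M_def)
  show ?thesis
  proof (rule that[OF h(1)])
    fix t assume "t \<in> {a..b} \<inter> ball t0 h"
    then show "x1 t = x2 t" by (intro eq) (auto simp: S_def dist_real_def)
  qed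
qed

section \<open>Charts and differentials\<close>

lemma is_chartD:
  assumes "is_chart c"
  shows "open (fst c)" "open (snd c ` fst c)" "homeomorphism (fst c) (snd c ` fst c) (snd c) (chart_inv c)"
  using assms by (auto simp: is_chart_def)

lemma chart_inv_chart: "is_chart c \<Longrightarrow> p \<in> fst c \<Longrightarrow> chart_inv c (snd c p) = p"
  using is_chartD(3) homeomorphism_apply1 by fastforce

lemma chart_chart_inv: "is_chart c \<Longrightarrow> x \<in> snd c ` fst c \<Longrightarrow> snd c (chart_inv c x) = x"
  by (rule f_inv_into_f)

lemma chart_inv_mem: "x \<in> snd c ` fst c \<Longrightarrow> chart_inv c x \<in> fst c"
  by (rule inv_into_into)

lemma chart_filterlim:
  fixes c :: "('m::t2_space, 'e::real_normed_vector) chart"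
  assumes "is_chart c" "p \<in> fst c"
  shows "filterlim (snd c) (nhds (snd c p)) (nhds p)"
proof -
  have "continuous_on (fst c) (snd c)" using is_chartD(3)[OF assms(1)] by (simp add: homeomorphism_def)
  then have "isCont (snd c) p"
    using assms(2) is_chartD(1)[OF assms(1)] by (simp add: continuous_on_eq_continuous_at)
  then show ?thesis by (simp add: isCont_def tendsto_at_iff_tendsto_nhds)
qed

lemma chart_inv_filterlim:
  fixes c :: "('m::t2_space, 'e::real_normed_vector) chart"
  assumes "is_chart c" "p \<in> fst c"
  shows "filterlim (chart_inv c) (nhds p) (nhds (snd c p))"
proof -
  have "continuous_on (snd c ` fst c) (chart_inv c)" using is_chartD(3)[OF assms(1)] by (simp add: homeomorphism_def)
  then have "isCont (chart_inv c) (snd c p)"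
    using assms is_chartD(2)[OF assms(1)] by (simp add: continuous_on_eq_continuous_at)
  then show ?thesis
    using chart_inv_chart[OF assms] tendsto_at_iff_tendsto_nhds[of "chart_inv c" "snd c p"] by (simp add: isCont_def)
qed

lemma eventually_chart_image:
  assumes "is_chart c" "p \<in> fst c"
  shows "\<forall>\<^sub>F x in nhds (snd c p). x \<in> snd c ` fst c"
  using is_chartD(2)[OF assms(1)] assms(2) by (intro eventually_nhds_in_open) auto

lemma open_chart_image:
  assumes "is_chart c" "open U"
  shows "open (snd c ` (fst c \<inter> U))"
proof -
  have "continuous_on (snd c ` fst c) (chart_inv c)" using is_chartD(3)[OF assms(1)] by (simp add: homeomorphism_def)
  then have "open (snd c ` fst c \<inter> chart_inv c -` U)"
    using is_chartD(2)[OF assms(1)] assms(2) by (intro continuous_open_preimage)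
  moreover have "snd c ` (fst c \<inter> U) = snd c ` fst c \<inter> chart_inv c -` U"
    using chart_inv_chart[OF assms(1)] by auto
  ultimately show ?thesis by simp
qed

abbreviation prod_chart :: "('m, 'e) chart \<Rightarrow> ('n, 'f) chart \<Rightarrow> ('m \<times> 'n, 'e \<times> 'f) chart" where
  "prod_chart c d \<equiv> (fst c \<times> fst d, map_prod (snd c) (snd d))"

lemma prod_chart_image: "map_prod f g ` (A \<times> B) = (f ` A) \<times> (g ` B)"
  by auto

lemma prod_chart_inv:
  assumes "is_chart c" "is_chart d" "x \<in> snd c ` fst c" "y \<in> snd d ` fst d"
  shows "chart_inv (prod_chart c d) (x, y) = (chart_inv c x, chart_inv d y)"
proof -
  have inj: "inj_on (map_prod (snd c) (snd d)) (fst c \<times> fst d)"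
    by (intro map_prod_inj_on inj_on_inverseI[of _ "chart_inv c"] inj_on_inverseI[of _ "chart_inv d"]
        chart_inv_chart assms)
  have xy: "map_prod (snd c) (snd d) (chart_inv c x, chart_inv d y) = (x, y)"
    by (simp add: chart_chart_inv[OF assms(1,3)] chart_chart_inv[OF assms(2,4)])
  have "(chart_inv c x, chart_inv d y) \<in> fst c \<times> fst d"
    using chart_inv_mem[OF assms(3)] chart_inv_mem[OF assms(4)] by simp
  from inv_into_f_f[OF inj this] show ?thesis unfolding xy fst_conv snd_conv .
qed

lemma is_chart_prod:
  assumes c: "is_chart c" and d: "is_chart d"
  shows "is_chart (prod_chart c d)"
  unfolding is_chart_def
proof (intro conjI)
  show "open (fst (prod_chart c d))" using is_chartD(1)[OF c] is_chartD(1)[OF d] by (simp add: open_Times)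
  show "open (snd (prod_chart c d) ` fst (prod_chart c d))"
    using is_chartD(2)[OF c] is_chartD(2)[OF d] by (simp add: prod_chart_image open_Times)
  let ?i = "\<lambda>z. (chart_inv c (fst z), chart_inv d (snd z))"
  have hc: "continuous_on (fst c) (snd c)" "continuous_on (snd c ` fst c) (chart_inv c)"
    and hd: "continuous_on (fst d) (snd d)" "continuous_on (snd d ` fst d) (chart_inv d)"
    using is_chartD(3)[OF c] is_chartD(3)[OF d] by (auto simp: homeomorphism_def)
  have inv: "chart_inv (prod_chart c d) z = ?i z" if "z \<in> (snd c ` fst c) \<times> (snd d ` fst d)" for z
  proof -
    have "fst z \<in> snd c ` fst c" "snd z \<in> snd d ` fst d" using that by (auto simp: mem_Times_iff)
    from prod_chart_inv[OF c d this] show ?thesis by (simp only: prod.collapse)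
  qed
  have 1: "continuous_on (fst c \<times> fst d) (map_prod (snd c) (snd d))"
    unfolding map_prod_def split_beta'
    by (intro continuous_on_Pair continuous_on_compose2[OF hc(1)] continuous_on_compose2[OF hd(1)] continuous_intros) auto
  have "continuous_on ((snd c ` fst c) \<times> (snd d ` fst d)) ?i"
    by (intro continuous_on_Pair continuous_on_compose2[OF hc(2)] continuous_on_compose2[OF hd(2)] continuous_intros) auto
  then have 2: "continuous_on ((snd c ` fst c) \<times> (snd d ` fst d)) (chart_inv (prod_chart c d))"
    by (rule continuous_on_eq) (rule inv[symmetric])
  show "homeomorphism (fst (prod_chart c d)) (snd (prod_chart c d) ` fst (prod_chart c d))
      (snd (prod_chart c d)) (chart_inv (prod_chart c d))"
  proof (rule homeomorphismI)
    show "continuous_on (fst (prod_chart c d)) (snd (prod_chart c d))" using 1 by simp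
    show "continuous_on (snd (prod_chart c d) ` fst (prod_chart c d)) (chart_inv (prod_chart c d))"
      using 2 by (simp add: prod_chart_image)
    show "chart_inv (prod_chart c d) ` (snd (prod_chart c d) ` fst (prod_chart c d)) \<subseteq> fst (prod_chart c d)"
      by (meson image_subsetI inv_into_into)
    show "chart_inv (prod_chart c d) (snd (prod_chart c d) x) = x" if "x \<in> fst (prod_chart c d)" for x
    proof -
      have "fst x \<in> fst c" "snd x \<in> fst d" using that by auto
      then have "?i (map_prod (snd c) (snd d) x) = x"
        by (simp add: chart_inv_chart[OF c] chart_inv_chart[OF d])
      moreover have "map_prod (snd c) (snd d) x \<in> (snd c ` fst c) \<times> (snd d ` fst d)"
        using \<open>fst x \<in> fst c\<close> \<open>snd x \<in> fst d\<close> by (simp add: mem_Times_iff)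
      ultimately show ?thesis using inv[of "map_prod (snd c) (snd d) x"] by simp
    qed
    show "snd (prod_chart c d) (chart_inv (prod_chart c d) y) = y"
      if "y \<in> snd (prod_chart c d) ` fst (prod_chart c d)" for y
      using that by (rule f_inv_into_f)
  qed simp
qed

definition local_rep :: "('m, 'e) chart \<Rightarrow> ('n, 'f) chart \<Rightarrow> ('m \<Rightarrow> 'n) \<Rightarrow> 'e \<Rightarrow> 'f" where
  "local_rep c d F = snd d \<circ> F \<circ> chart_inv c"

definition chart_differential ::
  "('m, 'e::real_normed_vector) chart \<Rightarrow> ('n, 'f::real_normed_vector) chart \<Rightarrow> ('m \<Rightarrow> 'n) \<Rightarrow> 'm \<Rightarrow> 'e \<Rightarrow> 'f" where
  "chart_differential c d F p = frechet_derivative (local_rep c d F) (at (snd c p))"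

lemma chart_differential_eqI:
  "(local_rep c d F has_derivative D) (at (snd c p)) \<Longrightarrow> chart_differential c d F p = D"
  unfolding chart_differential_def by (rule frechet_derivative_at[symmetric])

lemma has_derivative_chart_differential:
  "local_rep c d F differentiable (at (snd c p)) \<Longrightarrow>
    (local_rep c d F has_derivative chart_differential c d F p) (at (snd c p))"
  unfolding chart_differential_def by (simp add: frechet_derivative_works)

text \<open>The chain rule on manifolds. The representation of the composition is the composition of the
  representations only near the point, where \<open>F\<close> stays in the domain of the chart \<open>d\<close>.\<close>

lemma has_derivative_local_rep_compose:
  fixes c :: "('m::t2_space, 'e::real_normed_vector) chart"
    and d :: "('n::topological_space, 'f::real_normed_vector) chart"
    and e :: "('o, 'h::real_normed_vector) chart"
  assumes c: "is_chart c" and d: "is_chart d"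
    and p: "p \<in> fst c" "F p \<in> fst d" and F_cont: "filterlim F (nhds (F p)) (nhds p)"
    and F: "local_rep c d F differentiable (at (snd c p))"
    and H: "local_rep d e H differentiable (at (snd d (F p)))"
  shows "(local_rep c e (\<lambda>q. H (F q)) has_derivative
      (\<lambda>v. chart_differential d e H (F p) (chart_differential c d F p v))) (at (snd c p))"
proof -
  have at_p: "local_rep c d F (snd c p) = snd d (F p)"
    using c p by (simp add: local_rep_def chart_inv_chart)
  have "((\<lambda>x. local_rep d e H (local_rep c d F x)) has_derivative
      (\<lambda>v. chart_differential d e H (F p) (chart_differential c d F p v))) (at (snd c p))"
    by (rule has_derivative_compose[OF has_derivative_chart_differential[OF F]])
      (simp add: at_p has_derivative_chart_differential[OF H])
  moreover have "\<forall>\<^sub>F x in nhds (snd c p). F (chart_inv c x) \<in> fst d"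
    by (rule topological_tendstoD[OF filterlim_compose[OF F_cont chart_inv_filterlim[OF c p(1)]]
          is_chartD(1)[OF d] p(2)])
  then have ev: "\<forall>\<^sub>F x in nhds (snd c p). local_rep d e H (local_rep c d F x) = local_rep c e (\<lambda>q. H (F q)) x"
    by eventually_elim (simp add: local_rep_def chart_inv_chart d)
  then have "\<forall>\<^sub>F x in at (snd c p). local_rep d e H (local_rep c d F x) = local_rep c e (\<lambda>q. H (F q)) x"
    by (simp add: eventually_at_filter eventually_mono)
  ultimately show ?thesis
    by (rule has_derivative_transform_eventually) (use eventually_nhds_x_imp_x[OF ev] in auto)
qed

lemma local_rep_ident_has_derivative:
  assumes c: "is_chart c" and p: "p \<in> fst c"
  shows "(local_rep c c (\<lambda>q. q) has_derivative (\<lambda>v. v)) (at (snd c p))"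
proof (rule has_derivative_transform_within_open[OF has_derivative_ident])
  show "open (snd c ` fst c)" by (rule is_chartD(2)[OF c])
  show "snd c p \<in> snd c ` fst c" using p by simp
  show "x = local_rep c c (\<lambda>q. q) x" if "x \<in> snd c ` fst c" for x
    using that by (simp add: local_rep_def chart_chart_inv[OF c])
qed

lemma smooth_on_differentiable: "smooth_on f S \<Longrightarrow> x \<in> S \<Longrightarrow> f differentiable (at x)"
  unfolding smooth_on_def by (metis Ck_on.simps(2))

section \<open>Translations and the adjoint representation in charts\<close>

context lie_group
begin

abbreviation "\<A> \<equiv> atlas G"
abbreviation "c\<^sub>1 \<equiv> chart_at \<A> \<one>"

lemma is_chart: "c \<in> \<A> \<Longrightarrow> is_chart c"
  using smooth_atlas by (simp add: smooth_atlas_def)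

lemma chart_at: "chart_at \<A> p \<in> \<A>" "p \<in> fst (chart_at \<A> p)"
proof -
  have "p \<in> (\<Union>c\<in>\<A>. fst c)" using smooth_atlas by (simp add: smooth_atlas_def)
  then have "\<exists>c. c \<in> \<A> \<and> p \<in> fst c" by blast
  then have "chart_at \<A> p \<in> \<A> \<and> p \<in> fst (chart_at \<A> p)" unfolding chart_at_def by (rule someI_ex)
  then show "chart_at \<A> p \<in> \<A>" "p \<in> fst (chart_at \<A> p)" by auto
qed

lemma carrier [simp]: "g \<in> carrier G"
  by (simp add: carrier_UNIV)

text \<open>The group law in charts. Left and right translations are its partial maps; their differentials are
  therefore partial derivatives of one smooth function, which gives the dependence on the group element.\<close>

definition mult_rep :: "('g, 'e) chart \<Rightarrow> ('g, 'e) chart \<Rightarrow> ('g, 'e) chart \<Rightarrow> 'e \<times> 'e \<Rightarrow> 'e" where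
  "mult_rep c d e = local_rep (prod_chart c d) e (\<lambda>(g, h). g \<otimes> h)"

lemma mult_filterlim: "filterlim (\<lambda>(g, h). g \<otimes> h) (nhds (g \<otimes> h)) (nhds (g, h))"
proof -
  have "continuous_on UNIV (\<lambda>(g, h). g \<otimes> h)" using smooth_mult by (simp add: smooth_map_def)
  then have "isCont (\<lambda>(g, h). g \<otimes> h) (g, h)" by (simp add: continuous_on_eq_continuous_at)
  then show ?thesis
    using tendsto_at_iff_tendsto_nhds[of "\<lambda>(g, h). g \<otimes> h" "(g, h)"] by (simp add: isCont_def)
qed

lemma inv_filterlim: "filterlim (\<lambda>g. inv g) (nhds (inv g)) (nhds g)"
proof -
  have "continuous_on UNIV (\<lambda>g. inv g)" using smooth_inv by (simp add: smooth_map_def)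
  then have "isCont (\<lambda>g. inv g) g" by (simp add: continuous_on_eq_continuous_at)
  then show ?thesis
    using tendsto_at_iff_tendsto_nhds[of "\<lambda>g. inv g" g] by (simp add: isCont_def)
qed

lemma left_filterlim: "filterlim (\<lambda>h. g \<otimes> h) (nhds (g \<otimes> h)) (nhds h)"
proof -
  have "filterlim (\<lambda>h. (g, h)) (nhds (g, h)) (nhds h)"
    by (intro tendsto_Pair tendsto_const filterlim_ident)
  from filterlim_compose[OF mult_filterlim this] show ?thesis by simp
qed

lemma right_filterlim: "filterlim (\<lambda>g. g \<otimes> h) (nhds (g \<otimes> h)) (nhds g)"
proof -
  have "filterlim (\<lambda>g. (g, h)) (nhds (g, h)) (nhds g)"
    by (intro tendsto_Pair tendsto_const filterlim_ident)
  from filterlim_compose[OF mult_filterlim this] show ?thesis by simp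
qed

lemma mult_rep_eq:
  assumes "c \<in> \<A>" "d \<in> \<A>" "x \<in> snd c ` fst c" "y \<in> snd d ` fst d"
  shows "mult_rep c d e (x, y) = snd e (chart_inv c x \<otimes> chart_inv d y)"
  using prod_chart_inv[OF is_chart[OF assms(1)] is_chart[OF assms(2)] assms(3,4)] by (simp add: mult_rep_def local_rep_def)

lemma mult_rep_smooth:
  assumes "c \<in> \<A>" "d \<in> \<A>" "e \<in> \<A>" "g \<in> fst c" "h \<in> fst d" "g \<otimes> h \<in> fst e"
  obtains S where "open S" "(snd c g, snd d h) \<in> S" "smooth_on (mult_rep c d e) S"
proof -
  let ?S = "snd (prod_chart c d) ` (fst (prod_chart c d) \<inter> (\<lambda>(g, h). g \<otimes> h) -` fst e)"
  have "prod_chart c d \<in> prod_atlas \<A> \<A>" using assms(1,2) unfolding prod_atlas_def by blast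
  then have sm: "smooth_on (mult_rep c d e) ?S"
    using smooth_mult assms(3) unfolding smooth_map_def mult_rep_def local_rep_def by blast
  have "continuous_on UNIV (\<lambda>(g, h). g \<otimes> h)" using smooth_mult by (simp add: smooth_map_def)
  then have "open ((\<lambda>(g, h). g \<otimes> h) -` fst e)"
    using is_chartD(1)[OF is_chart[OF assms(3)]] by (rule open_vimage[rotated])
  then have op: "open ?S" by (intro open_chart_image is_chart_prod is_chart assms)
  have "(snd c g, snd d h) \<in> ?S" using assms by (auto intro!: image_eqI[of _ _ "(g, h)"])
  then show ?thesis using that op sm by blast
qed

lemma left_has_derivative:
  assumes "c \<in> \<A>" "d \<in> \<A>" "e \<in> \<A>" "g \<in> fst c" "h \<in> fst d" "g \<otimes> h \<in> fst e"
  shows "(local_rep d e (\<lambda>h. g \<otimes> h) has_derivative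
      (\<lambda>v. frechet_derivative (mult_rep c d e) (at (snd c g, snd d h)) (0, v))) (at (snd d h))"
proof -
  obtain S where S: "open S" "(snd c g, snd d h) \<in> S" "smooth_on (mult_rep c d e) S"
    by (rule mult_rep_smooth[OF assms]) (rule that)
  have "(mult_rep c d e has_derivative frechet_derivative (mult_rep c d e) (at (snd c g, snd d h)))
      (at (snd c g, snd d h))"
    using smooth_on_differentiable[OF S(3,2)] by (simp add: frechet_derivative_works)
  then have "((\<lambda>y. mult_rep c d e (snd c g, y)) has_derivative
      (\<lambda>v. frechet_derivative (mult_rep c d e) (at (snd c g, snd d h)) (0, v))) (at (snd d h))"
    by (rule has_derivative_compose[rotated]) (auto intro!: derivative_eq_intros)
  then show ?thesis
  proof (rule has_derivative_transform_within_open)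
    show "open (snd d ` fst d)" by (rule is_chartD(2)[OF is_chart[OF assms(2)]])
    show "snd d h \<in> snd d ` fst d" using assms(5) by simp
    show "mult_rep c d e (snd c g, y) = local_rep d e (\<lambda>h. g \<otimes> h) y" if "y \<in> snd d ` fst d" for y
      using mult_rep_eq[OF assms(1,2) _ that, of "snd c g"] assms(4)
      by (simp add: local_rep_def chart_inv_chart is_chart assms(1))
  qed
qed

lemma right_has_derivative:
  assumes "c \<in> \<A>" "d \<in> \<A>" "e \<in> \<A>" "g \<in> fst c" "h \<in> fst d" "g \<otimes> h \<in> fst e"
  shows "(local_rep c e (\<lambda>g. g \<otimes> h) has_derivative
      (\<lambda>v. frechet_derivative (mult_rep c d e) (at (snd c g, snd d h)) (v, 0))) (at (snd c g))"
proof -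
  obtain S where S: "open S" "(snd c g, snd d h) \<in> S" "smooth_on (mult_rep c d e) S"
    by (rule mult_rep_smooth[OF assms]) (rule that)
  have "(mult_rep c d e has_derivative frechet_derivative (mult_rep c d e) (at (snd c g, snd d h)))
      (at (snd c g, snd d h))"
    using smooth_on_differentiable[OF S(3,2)] by (simp add: frechet_derivative_works)
  then have "((\<lambda>x. mult_rep c d e (x, snd d h)) has_derivative
      (\<lambda>v. frechet_derivative (mult_rep c d e) (at (snd c g, snd d h)) (v, 0))) (at (snd c g))"
    by (rule has_derivative_compose[rotated]) (auto intro!: derivative_eq_intros)
  then show ?thesis
  proof (rule has_derivative_transform_within_open)
    show "open (snd c ` fst c)" by (rule is_chartD(2)[OF is_chart[OF assms(1)]])
    show "snd c g \<in> snd c ` fst c" using assms(4) by simp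
    show "mult_rep c d e (x, snd d h) = local_rep c e (\<lambda>g. g \<otimes> h) x" if "x \<in> snd c ` fst c" for x
      using mult_rep_eq[OF assms(1,2) that, of "snd d h"] assms(5)
      by (simp add: local_rep_def chart_inv_chart is_chart assms(2))
  qed
qed

lemma left_differentiable:
  assumes "d \<in> \<A>" "e \<in> \<A>" "h \<in> fst d" "g \<otimes> h \<in> fst e"
  shows "local_rep d e (\<lambda>h. g \<otimes> h) differentiable (at (snd d h))"
  using left_has_derivative[OF chart_at(1) assms(1,2) chart_at(2) assms(3,4)]
  by (rule differentiableI)

lemma right_differentiable:
  assumes "c \<in> \<A>" "e \<in> \<A>" "g \<in> fst c" "g \<otimes> h \<in> fst e"
  shows "local_rep c e (\<lambda>g. g \<otimes> h) differentiable (at (snd c g))"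
  using right_has_derivative[OF assms(1) chart_at(1) assms(2,3) chart_at(2) assms(4)]
  by (rule differentiableI)

text \<open>The isomorphism \<open>dL\<^sub>g\<close> from the Lie algebra to the tangent space at \<open>g\<close>, read in the chart \<open>c\<close>.\<close>

abbreviation "dL c g \<equiv> chart_differential c\<^sub>1 c (\<lambda>h. g \<otimes> h) \<one>"

lemma one_mem: "\<one> \<in> fst c\<^sub>1" "c\<^sub>1 \<in> \<A>"
  by (rule chart_at)+

lemma dL_inverse:
  assumes c: "c \<in> \<A>" "g \<in> fst c"
  shows "chart_differential c c\<^sub>1 (\<lambda>h. inv g \<otimes> h) g (dL c g v) = v"
    and "dL c g (chart_differential c c\<^sub>1 (\<lambda>h. inv g \<otimes> h) g w) = w"
proof -
  have 1: "local_rep c\<^sub>1 c (\<lambda>h. g \<otimes> h) differentiable (at (snd c\<^sub>1 \<one>))"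
    by (rule left_differentiable) (use c one_mem in auto)
  have 2: "local_rep c c\<^sub>1 (\<lambda>h. inv g \<otimes> h) differentiable (at (snd c g))"
    by (rule left_differentiable) (use c one_mem in auto)
  have "(local_rep c\<^sub>1 c\<^sub>1 (\<lambda>q. inv g \<otimes> (g \<otimes> q)) has_derivative
      (\<lambda>v. chart_differential c c\<^sub>1 (\<lambda>h. inv g \<otimes> h) (g \<otimes> \<one>) (dL c g v))) (at (snd c\<^sub>1 \<one>))"
    by (rule has_derivative_local_rep_compose[OF is_chart is_chart one_mem(1) _ left_filterlim 1])
      (use c one_mem 2 in auto)
  moreover have "(\<lambda>q. inv g \<otimes> (g \<otimes> q)) = (\<lambda>q. q)" by (simp flip: m_assoc)
  ultimately have "(local_rep c\<^sub>1 c\<^sub>1 (\<lambda>q. q) has_derivative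
      (\<lambda>v. chart_differential c c\<^sub>1 (\<lambda>h. inv g \<otimes> h) g (dL c g v))) (at (snd c\<^sub>1 \<one>))" by simp
  from has_derivative_unique[OF this local_rep_ident_has_derivative[OF is_chart[OF one_mem(2)] one_mem(1)]]
  show "chart_differential c c\<^sub>1 (\<lambda>h. inv g \<otimes> h) g (dL c g v) = v" by (rule fun_cong)
  have "(local_rep c c (\<lambda>q. g \<otimes> (inv g \<otimes> q)) has_derivative
      (\<lambda>w. chart_differential c\<^sub>1 c (\<lambda>h. g \<otimes> h) (inv g \<otimes> g) (chart_differential c c\<^sub>1 (\<lambda>h. inv g \<otimes> h) g w)))
      (at (snd c g))"
    by (rule has_derivative_local_rep_compose[OF is_chart is_chart c(2) _ left_filterlim 2])
      (use c one_mem 1 in auto)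
  moreover have "(\<lambda>q. g \<otimes> (inv g \<otimes> q)) = (\<lambda>q. q)" by (simp flip: m_assoc)
  ultimately have "(local_rep c c (\<lambda>q. q) has_derivative
      (\<lambda>w. dL c g (chart_differential c c\<^sub>1 (\<lambda>h. inv g \<otimes> h) g w))) (at (snd c g))" by simp
  from has_derivative_unique[OF this local_rep_ident_has_derivative[OF is_chart[OF c(1)] c(2)]]
  show "dL c g (chart_differential c c\<^sub>1 (\<lambda>h. inv g \<otimes> h) g w) = w" by (rule fun_cong)
qed

text \<open>Conjugation by \<open>g\<close> is left translation, from the identity to \<open>g\<close>, followed by right translation back to the
  identity. Hence \<open>Ad g\<close> factors through the tangent space at \<open>g\<close>.\<close>

lemma Ad_has_derivative:
  "(local_rep c\<^sub>1 c\<^sub>1 (\<lambda>h. g \<otimes> h \<otimes> inv g) has_derivative Ad G g) (at (snd c\<^sub>1 \<one>))"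
  and Ad_eq: "c \<in> \<A> \<Longrightarrow> g \<in> fst c \<Longrightarrow> Ad G g v = chart_differential c c\<^sub>1 (\<lambda>h. h \<otimes> inv g) g (dL c g v)"
proof -
  have Ad_def': "Ad G g = chart_differential c\<^sub>1 c\<^sub>1 (\<lambda>h. g \<otimes> h \<otimes> inv g) \<one>"
    by (simp add: Ad_def differential_def chart_differential_def local_rep_def)
  have *: "(local_rep c\<^sub>1 c\<^sub>1 (\<lambda>h. g \<otimes> h \<otimes> inv g) has_derivative
      (\<lambda>v. chart_differential c c\<^sub>1 (\<lambda>h. h \<otimes> inv g) g (dL c g v))) (at (snd c\<^sub>1 \<one>))"
    if c: "c \<in> \<A>" "g \<in> fst c" for c
  proof -
    have 1: "local_rep c\<^sub>1 c (\<lambda>h. g \<otimes> h) differentiable (at (snd c\<^sub>1 \<one>))"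
      by (rule left_differentiable) (use c one_mem in auto)
    have 2: "local_rep c c\<^sub>1 (\<lambda>h. h \<otimes> inv g) differentiable (at (snd c g))"
      by (rule right_differentiable) (use c one_mem in auto)
    have "(local_rep c\<^sub>1 c\<^sub>1 (\<lambda>q. (g \<otimes> q) \<otimes> inv g) has_derivative
        (\<lambda>v. chart_differential c c\<^sub>1 (\<lambda>h. h \<otimes> inv g) (g \<otimes> \<one>) (dL c g v))) (at (snd c\<^sub>1 \<one>))"
      by (rule has_derivative_local_rep_compose[OF is_chart is_chart one_mem(1) _ left_filterlim 1])
        (use c one_mem 2 in auto)
    then show ?thesis by simp
  qed
  from *[OF chart_at] have "local_rep c\<^sub>1 c\<^sub>1 (\<lambda>h. g \<otimes> h \<otimes> inv g) differentiable (at (snd c\<^sub>1 \<one>))"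
    by (rule differentiableI)
  then show "(local_rep c\<^sub>1 c\<^sub>1 (\<lambda>h. g \<otimes> h \<otimes> inv g) has_derivative Ad G g) (at (snd c\<^sub>1 \<one>))"
    unfolding Ad_def' by (rule has_derivative_chart_differential)
  show "Ad G g v = chart_differential c c\<^sub>1 (\<lambda>h. h \<otimes> inv g) g (dL c g v)" if "c \<in> \<A>" "g \<in> fst c"
    unfolding Ad_def' by (subst chart_differential_eqI[OF *[OF that]]) simp
qed

lemma linear_Ad: "linear (Ad G g)"
  by (rule has_derivative_linear[OF Ad_has_derivative])

lemma Ad_Ad_inv: "Ad G g (Ad G (inv g) v) = v"
proof -
  have eq: "chart_differential c\<^sub>1 c\<^sub>1 (\<lambda>h. g \<otimes> h \<otimes> inv g) \<one> = Ad G g" for g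
    by (rule chart_differential_eqI[OF Ad_has_derivative])
  have cont: "filterlim (\<lambda>h. inv g \<otimes> h \<otimes> inv (inv g)) (nhds (inv g \<otimes> \<one> \<otimes> inv (inv g))) (nhds \<one>)"
    by (rule filterlim_compose[OF right_filterlim left_filterlim])
  have diff: "local_rep c\<^sub>1 c\<^sub>1 (\<lambda>h. g \<otimes> h \<otimes> inv g) differentiable (at (snd c\<^sub>1 \<one>))" for g
    by (rule differentiableI[OF Ad_has_derivative])
  have "(local_rep c\<^sub>1 c\<^sub>1 (\<lambda>q. g \<otimes> (inv g \<otimes> q \<otimes> inv (inv g)) \<otimes> inv g) has_derivative
      (\<lambda>v. chart_differential c\<^sub>1 c\<^sub>1 (\<lambda>h. g \<otimes> h \<otimes> inv g) (inv g \<otimes> \<one> \<otimes> inv (inv g))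
        (chart_differential c\<^sub>1 c\<^sub>1 (\<lambda>h. inv g \<otimes> h \<otimes> inv (inv g)) \<one> v))) (at (snd c\<^sub>1 \<one>))"
    by (rule has_derivative_local_rep_compose[OF is_chart is_chart one_mem(1) _ cont diff])
      (use one_mem diff[of g] in auto)
  moreover have "(\<lambda>q. g \<otimes> (inv g \<otimes> q \<otimes> inv (inv g)) \<otimes> inv g) = (\<lambda>q. q)"
  proof
    fix q
    have "g \<otimes> (inv g \<otimes> q \<otimes> inv (inv g)) \<otimes> inv g = (g \<otimes> inv g) \<otimes> q \<otimes> (g \<otimes> inv g)"
      by (simp only: m_assoc carrier m_closed inv_closed inv_inv)
    then show "g \<otimes> (inv g \<otimes> q \<otimes> inv (inv g)) \<otimes> inv g = q" by simp
  qed
  ultimately have "(local_rep c\<^sub>1 c\<^sub>1 (\<lambda>q. q) has_derivative (\<lambda>v. Ad G g (Ad G (inv g) v))) (at (snd c\<^sub>1 \<one>))"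
    using eq[of "inv g"] by (simp add: eq)
  from has_derivative_unique[OF this local_rep_ident_has_derivative[OF is_chart[OF one_mem(2)] one_mem(1)]]
  show ?thesis by (rule fun_cong)
qed

lemma coordinates_Lie_algebra: obtains B \<phi> where "coordinates (B :: 'e set) \<phi>"
  using finite_dim coordinates_exist by metis

lemma mult_rep_op_lip_near:
  assumes "c \<in> \<A>" "d \<in> \<A>" "e \<in> \<A>" "g \<in> fst c" "h \<in> fst d" "g \<otimes> h \<in> fst e"
  shows "op_lip_near (\<lambda>z. frechet_derivative (mult_rep c d e) (at z)) (snd c g, snd d h)"
proof -
  obtain S where S: "open S" "(snd c g, snd d h) \<in> S" "smooth_on (mult_rep c d e) S"
    by (rule mult_rep_smooth[OF assms]) (rule that)
  obtain B :: "'e set" where B: "finite B" "span B = UNIV" using finite_dim by blast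
  obtain C \<phi> where coord: "coordinates (C :: ('e \<times> 'e) set) \<phi>"
    by (rule coordinates_prod[OF B]) (rule that)
  have "Ck_on 2 (mult_rep c d e) S" using S(3) by (simp add: smooth_on_def)
  from C2_op_lip_near[OF coord this S(1,2)] show ?thesis .
qed

text \<open>A partial derivative of the smooth function \<open>mult_rep c c\<^sub>1 c\<close> along the points \<open>(x, c\<^sub>1 \<one>)\<close>.\<close>

lemma dL_op_lip_near:
  assumes c: "c \<in> \<A>" "g \<in> fst c"
  shows "op_lip_near (\<lambda>x. dL c (chart_inv c x)) (snd c g)"
proof (rule op_lip_near_cong)
  let ?D = "\<lambda>z. frechet_derivative (mult_rep c c\<^sub>1 c) (at z)"
  have "op_lip_near (\<lambda>x. ?D (x, snd c\<^sub>1 \<one>)) (snd c g)"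
    by (rule op_lip_near_reparam[OF lip_near_ident_pair[OF lip_near_const] mult_rep_op_lip_near])
      (use c one_mem in auto)
  moreover have "bounded_linear (\<lambda>v::'e. (0::'e, v))"
    by (intro bounded_linear_Pair bounded_linear_zero bounded_linear_ident)
  ultimately show "op_lip_near (\<lambda>x v. ?D (x, snd c\<^sub>1 \<one>) (0, v)) (snd c g)"
    using op_lip_near_compose[OF op_lip_near_const] by blast
  show "\<forall>\<^sub>F x in nhds (snd c g). (\<lambda>v. ?D (x, snd c\<^sub>1 \<one>) (0, v)) = dL c (chart_inv c x)"
    using eventually_chart_image[OF is_chart[OF c(1)] c(2)]
  proof eventually_elim
    case (elim x)
    have "(local_rep c\<^sub>1 c (\<lambda>h. chart_inv c x \<otimes> h) has_derivative
        (\<lambda>v. ?D (snd c (chart_inv c x), snd c\<^sub>1 \<one>) (0, v))) (at (snd c\<^sub>1 \<one>))"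
      by (rule left_has_derivative) (use c one_mem chart_inv_mem[OF elim] in auto)
    from chart_differential_eqI[OF this] show ?case
      by (simp add: chart_chart_inv[OF is_chart[OF c(1)] elim])
  qed
qed

lemma inv_lip_near:
  assumes c: "c \<in> \<A>" "g \<in> fst c" and d: "d \<in> \<A>" "inv g \<in> fst d"
  shows "lip_near (local_rep c d (\<lambda>g. inv g)) (snd c g)"
proof -
  obtain B \<phi> where coord: "coordinates (B :: 'e set) \<phi>" by (rule coordinates_Lie_algebra)
  let ?S = "snd c ` (fst c \<inter> (\<lambda>g. inv g) -` fst d)"
  have "smooth_on (local_rep c d (\<lambda>g. inv g)) ?S"
    using smooth_inv c(1) d(1) unfolding smooth_map_def local_rep_def by blast
  then have C1: "Ck_on 1 (local_rep c d (\<lambda>g. inv g)) ?S" unfolding smooth_on_def by blast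
  have "continuous_on UNIV (\<lambda>g. inv g)" using smooth_inv by (simp add: smooth_map_def)
  then have "open ((\<lambda>g. inv g) -` fst d)"
    using is_chartD(1)[OF is_chart[OF d(1)]] by (rule open_vimage[rotated])
  then have "open ?S" by (rule open_chart_image[OF is_chart[OF c(1)]])
  moreover have "snd c g \<in> ?S" using c d by auto
  ultimately show ?thesis by (rule C1_lip_near[OF coord C1])
qed

text \<open>Here the second argument of the group law is \<open>inv g\<close>, which moves with \<open>g\<close>; smoothness of the inversion
  enters at this point.\<close>

lemma dR_inv_op_lip_near:
  assumes c: "c \<in> \<A>" "g \<in> fst c"
  shows "op_lip_near (\<lambda>x. chart_differential c c\<^sub>1 (\<lambda>h. h \<otimes> inv (chart_inv c x)) (chart_inv c x)) (snd c g)"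
proof (rule op_lip_near_cong)
  define d where "d = chart_at \<A> (inv g)"
  have d: "d \<in> \<A>" "inv g \<in> fst d" unfolding d_def by (rule chart_at)+
  let ?D = "\<lambda>z. frechet_derivative (mult_rep c d c\<^sub>1) (at z)"
  let ?i = "local_rep c d (\<lambda>g. inv g)"
  have i_eq: "?i (snd c g) = snd d (inv g)"
    by (simp add: local_rep_def chart_inv_chart[OF is_chart[OF c(1)] c(2)])
  have "op_lip_near ?D (snd c g, snd d (inv g))"
    by (rule mult_rep_op_lip_near) (use c d one_mem in auto)
  then have "op_lip_near ?D (snd c g, ?i (snd c g))" by (simp only: i_eq)
  then have "op_lip_near (\<lambda>x. ?D (x, ?i x)) (snd c g)"
    by (rule op_lip_near_reparam[OF lip_near_ident_pair[OF inv_lip_near[OF c d]]])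
  moreover have "bounded_linear (\<lambda>v::'e. (v, 0::'e))"
    by (intro bounded_linear_Pair bounded_linear_zero bounded_linear_ident)
  ultimately show "op_lip_near (\<lambda>x v. ?D (x, ?i x) (v, 0)) (snd c g)"
    using op_lip_near_compose[OF op_lip_near_const] by blast
  have "\<forall>\<^sub>F x in nhds (snd c g). inv (chart_inv c x) \<in> fst d"
    by (rule topological_tendstoD[OF filterlim_compose[OF inv_filterlim chart_inv_filterlim[OF is_chart[OF c(1)] c(2)]]
          is_chartD(1)[OF is_chart[OF d(1)]] d(2)])
  with eventually_chart_image[OF is_chart[OF c(1)] c(2)]
  show "\<forall>\<^sub>F x in nhds (snd c g). (\<lambda>v. ?D (x, ?i x) (v, 0)) =
      chart_differential c c\<^sub>1 (\<lambda>h. h \<otimes> inv (chart_inv c x)) (chart_inv c x)"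
  proof eventually_elim
    case (elim x)
    have "(local_rep c c\<^sub>1 (\<lambda>h. h \<otimes> inv (chart_inv c x)) has_derivative
        (\<lambda>v. ?D (snd c (chart_inv c x), snd d (inv (chart_inv c x))) (v, 0))) (at (snd c (chart_inv c x)))"
      by (rule right_has_derivative) (use c d one_mem chart_inv_mem[OF elim(1)] elim(2) in auto)
    from chart_differential_eqI[OF this] show ?case
      by (simp add: chart_chart_inv[OF is_chart[OF c(1)] elim(1)] local_rep_def)
  qed
qed

lemma Ad_op_lip_near:
  assumes c: "c \<in> \<A>" "g \<in> fst c"
  shows "op_lip_near (\<lambda>x. Ad G (chart_inv c x)) (snd c g)"
proof (rule op_lip_near_cong[OF _ op_lip_near_compose[OF dL_op_lip_near[OF c] dR_inv_op_lip_near[OF c]]])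
  show "\<forall>\<^sub>F x in nhds (snd c g). (\<lambda>v. chart_differential c c\<^sub>1 (\<lambda>h. h \<otimes> inv (chart_inv c x)) (chart_inv c x)
      (dL c (chart_inv c x) v)) = Ad G (chart_inv c x)"
    using eventually_chart_image[OF is_chart[OF c(1)] c(2)]
  proof eventually_elim
    case (elim x)
    show ?case using Ad_eq[OF c(1) chart_inv_mem[OF elim]] by (intro ext) simp
  qed
qed

text \<open>The velocity is defined in the chart chosen at \<open>\<gamma> t\<close>, which changes with \<open>t\<close>. The chain rule for the
  transition map removes this choice and expresses the control in one chart along a whole piece of the curve.\<close>

lemma control_in_chart:
  assumes t: "t \<in> I" "at t within I \<noteq> bot" and cont: "continuous_on I \<gamma>"
    and c: "c \<in> \<A>" "\<gamma> t \<in> fst c" and x': "(snd c \<circ> \<gamma> has_vector_derivative x') (at t within I)"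
  shows "control G I \<gamma> t = chart_differential c c\<^sub>1 (\<lambda>h. inv (\<gamma> t) \<otimes> h) (\<gamma> t) x'"
proof -
  define d where "d = chart_at \<A> (\<gamma> t)"
  have d: "d \<in> \<A>" "\<gamma> t \<in> fst d" unfolding d_def by (rule chart_at)+
  have "smooth_on (snd d \<circ> chart_inv c) (snd c ` (fst c \<inter> fst d))"
    using smooth_atlas c(1) d(1) by (simp add: smooth_atlas_def)
  moreover have "snd c (\<gamma> t) \<in> snd c ` (fst c \<inter> fst d)" using c d by blast
  ultimately have "snd d \<circ> chart_inv c differentiable (at (snd c (\<gamma> t)))"
    by (rule smooth_on_differentiable)
  then have trans: "local_rep c d (\<lambda>q. q) differentiable (at (snd c (\<gamma> t)))"
    by (simp add: local_rep_def o_def)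
  define D where "D = chart_differential c d (\<lambda>q. q) (\<gamma> t)"
  have D: "(local_rep c d (\<lambda>q. q) has_derivative D) (at (snd c (\<gamma> t)))"
    unfolding D_def by (rule has_derivative_chart_differential[OF trans])
  have "((local_rep c d (\<lambda>q. q) \<circ> (snd c \<circ> \<gamma>)) has_vector_derivative D x') (at t within I)"
    by (rule vector_derivative_diff_chain_within[OF x']) (use D has_derivative_at_withinI in auto)
  moreover have "\<forall>\<^sub>F s in nhds t. s \<in> I \<longrightarrow> (local_rep c d (\<lambda>q. q) \<circ> (snd c \<circ> \<gamma>)) s = (snd d \<circ> \<gamma>) s"
  proof -
    have "(\<gamma> \<longlongrightarrow> \<gamma> t) (at t within I)" using cont t(1) by (simp add: continuous_on_def)
    then have "\<forall>\<^sub>F s in at t within I. \<gamma> s \<in> fst c"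
      using is_chartD(1)[OF is_chart[OF c(1)]] c(2) by (rule topological_tendstoD)
    then have "\<forall>\<^sub>F s in nhds t. s \<noteq> t \<longrightarrow> s \<in> I \<longrightarrow> \<gamma> s \<in> fst c" by (simp add: eventually_at_filter)
    then show ?thesis
    proof eventually_elim
      case (elim s)
      then show ?case
        using c(2) chart_inv_chart[OF is_chart[OF c(1)]] by (cases "s = t") (auto simp: local_rep_def)
    qed
  qed
  ultimately have "(snd d \<circ> \<gamma> has_vector_derivative D x') (at t within I)"
    using has_vector_derivative_cong_ev[of I "local_rep c d (\<lambda>q. q) \<circ> (snd c \<circ> \<gamma>)" "snd d \<circ> \<gamma>" t] eventually_nhds_x_imp_x t(1)
    by (metis (mono_tags, lifting))
  then have vel: "velocity \<A> I \<gamma> t = D x'"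
    unfolding velocity_def d_def[symmetric] by (rule vector_derivative_within[OF t(2)])
  have left: "local_rep d c\<^sub>1 (\<lambda>h. inv (\<gamma> t) \<otimes> h) differentiable (at (snd d (\<gamma> t)))"
    by (rule left_differentiable) (use d one_mem in auto)
  have "(local_rep c c\<^sub>1 (\<lambda>q. inv (\<gamma> t) \<otimes> q) has_derivative
      (\<lambda>v. chart_differential d c\<^sub>1 (\<lambda>h. inv (\<gamma> t) \<otimes> h) (\<gamma> t) (chart_differential c d (\<lambda>q. q) (\<gamma> t) v)))
      (at (snd c (\<gamma> t)))"
    by (rule has_derivative_local_rep_compose[OF is_chart[OF c(1)] is_chart[OF d(1)] c(2) _ filterlim_ident trans left])
      (rule d(2))
  note eq = chart_differential_eqI[OF this]
  have "control G I \<gamma> t = chart_differential d c\<^sub>1 (\<lambda>h. inv (\<gamma> t) \<otimes> h) (\<gamma> t) (velocity \<A> I \<gamma> t)"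
    by (simp add: control_def differential_def chart_differential_def local_rep_def d_def)
  then show ?thesis by (simp add: vel D_def eq)
qed

end

section \<open>Normal curves as integral curves\<close>

lemma AE_lebesgue_on_interval:
  fixes I :: "real set"
  assumes "is_interval I" "AE t in lebesgue_on I. P t"
  obtains N where "negligible N" "\<And>t. t \<in> I - N \<Longrightarrow> P t"
proof -
  have "negligible (I \<inter> frontier I)"
    by (rule negligible_subset[OF negligible_convex_frontier[OF is_interval_convex[OF assms(1)]]]) simp
  then have "I \<inter> frontier I \<in> sets lebesgue" by (rule negligible_imp_sets)
  moreover have "interior I \<in> sets lebesgue" by simp
  ultimately have "interior I \<union> (I \<inter> frontier I) \<in> sets lebesgue" by (rule sets.Un[rotated])
  moreover have "interior I \<union> (I \<inter> frontier I) = I"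
    using interior_subset[of I] closure_subset[of I] by (auto simp: frontier_def)
  ultimately have "I \<in> sets lebesgue" by simp
  then have "AE t in lebesgue. t \<in> I \<longrightarrow> P t"
    using assms(2) by (subst (asm) AE_restrict_space_iff) auto
  then obtain N where N: "{t \<in> space lebesgue. \<not> (t \<in> I \<longrightarrow> P t)} \<subseteq> N" "N \<in> null_sets lebesgue"
    by (auto elim!: AE_E simp: null_sets_def)
  then show ?thesis by (intro that[of N]) (auto simp: negligible_iff_null_sets)
qed

context finsler_lie_group
begin

text \<open>The vector field, read in the chart \<open>c\<close>, whose integral curves are the normal curves with covector \<open>\<xi>\<close>.\<close>

definition normal_field :: "('g, 'e) chart \<Rightarrow> ('e \<Rightarrow> real) \<Rightarrow> 'e \<Rightarrow> 'e" where
  "normal_field c \<xi> x = dL c (chart_inv c x) (legendre nrm (\<xi> \<circ> Ad G (chart_inv c x)))"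

lemma normal_field_lip_near:
  assumes sc: "strongly_convex_norm nrm" and \<xi>: "linear \<xi>" and c: "c \<in> \<A>" "g \<in> fst c"
  shows "lip_near (normal_field c \<xi>) (snd c g)"
proof -
  obtain B \<phi> where coord: "coordinates (B :: 'e set) \<phi>" by (rule coordinates_Lie_algebra)
  have "op_lip_near (\<lambda>x v. \<xi> (Ad G (chart_inv c x) v)) (snd c g)"
    by (rule op_lip_near_compose[OF Ad_op_lip_near[OF c]
          op_lip_near_const[OF coordinates_linear_bounded[OF coord \<xi>]]])
  from legendre_lip_near[OF coord is_norm sc this]
  have "lip_near (\<lambda>x. legendre nrm (\<xi> \<circ> Ad G (chart_inv c x))) (snd c g)" by (simp add: o_def)
  from op_lip_near_apply[OF dL_op_lip_near[OF c] this]
  show ?thesis by (simp add: normal_field_def[abs_def])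
qed

lemma legendre_Ad_iff:
  assumes sc: "strongly_convex_norm nrm" and \<xi>: "linear \<xi>"
  shows "\<xi> \<circ> Ad G g \<in> subdifferential (energy nrm) w \<longleftrightarrow> w = legendre nrm (\<xi> \<circ> Ad G g)"
proof -
  obtain B \<phi> where coord: "coordinates (B :: 'e set) \<phi>" by (rule coordinates_Lie_algebra)
  show ?thesis
    by (rule legendre_iff[OF coord is_norm sc linear_compose[OF linear_Ad \<xi>]])
qed

lemma chart_neighbourhood:
  assumes cont: "continuous_on I \<gamma>" and t: "t \<in> I" and c: "c \<in> \<A>" "\<gamma> t \<in> fst c"
    and U: "open U" "snd c (\<gamma> t) \<in> U"
  obtains h where "0 < h" "\<And>s. \<lbrakk>s \<in> I; dist s t < h\<rbrakk> \<Longrightarrow> \<gamma> s \<in> fst c \<and> snd c (\<gamma> s) \<in> U"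
proof -
  have "\<forall>\<^sub>F q in nhds (\<gamma> t). q \<in> fst c \<and> snd c q \<in> U"
    by (intro eventually_conj eventually_nhds_in_open[OF is_chartD(1)[OF is_chart[OF c(1)]] c(2)]
        topological_tendstoD[OF chart_filterlim[OF is_chart[OF c(1)] c(2)] U])
  moreover have "(\<gamma> \<longlongrightarrow> \<gamma> t) (at t within I)" using cont t by (simp add: continuous_on_def)
  ultimately have "\<forall>\<^sub>F s in at t within I. \<gamma> s \<in> fst c \<and> snd c (\<gamma> s) \<in> U"
    by (rule eventually_compose_filterlim)
  then obtain h where "0 < h" "\<And>s. \<lbrakk>s \<in> I; s \<noteq> t; dist s t < h\<rbrakk> \<Longrightarrow> \<gamma> s \<in> fst c \<and> snd c (\<gamma> s) \<in> U"
    unfolding eventually_at by blast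
  then show ?thesis using that c(2) U(2) by metis
qed

text \<open>Almost everywhere the derivative is either missing or prescribed by the field. As the field is continuous
  along the curve, the curve is of class \<open>C\<^sup>1\<close> and satisfies the equation at every time.\<close>

lemma normal_curve_integral_curve:
  assumes sc: "strongly_convex_norm nrm" and I: "is_interval I" "t \<in> I" "u \<in> I" "u \<noteq> t"
    and ac: "abs_continuous_curve \<A> I \<gamma>" and \<xi>: "linear \<xi>"
    and AE: "AE s in lebesgue_on I. \<xi> \<circ> Ad G (\<gamma> s) \<in> subdifferential (energy nrm) (control G I \<gamma> s)"
    and c: "c \<in> \<A>" "\<gamma> t \<in> fst c"
  shows "(snd c \<circ> \<gamma> has_vector_derivative normal_field c \<xi> (snd c (\<gamma> t))) (at t within I)"
proof -
  have cont: "continuous_on I \<gamma>" using ac by (simp add: abs_continuous_curve_def)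
  obtain N where N: "negligible N"
    "\<And>s. s \<in> I - N \<Longrightarrow> \<xi> \<circ> Ad G (\<gamma> s) \<in> subdifferential (energy nrm) (control G I \<gamma> s)"
    by (rule AE_lebesgue_on_interval[OF I(1) AE]) (rule that)
  obtain r L where L: "0 < r" "0 \<le> L" "\<And>x y. \<lbrakk>x \<in> ball (snd c (\<gamma> t)) r; y \<in> ball (snd c (\<gamma> t)) r\<rbrakk> \<Longrightarrow>
      norm (normal_field c \<xi> x - normal_field c \<xi> y) \<le> L * norm (x - y)"
    by (rule lip_near_ball[OF normal_field_lip_near[OF sc \<xi> c]]) (rule that)
  have field_cont: "continuous_on (ball (snd c (\<gamma> t)) r) (normal_field c \<xi>)"
    by (rule lipschitz_on_continuous_on[of L]) (use L in \<open>auto intro!: lipschitz_onI simp: dist_norm\<close>)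
  obtain h where h: "0 < h"
    "\<And>s. \<lbrakk>s \<in> I; dist s t < h\<rbrakk> \<Longrightarrow> \<gamma> s \<in> fst c \<and> snd c (\<gamma> s) \<in> ball (snd c (\<gamma> t)) r"
    using chart_neighbourhood[OF cont I(2) c open_ball, of "snd c (\<gamma> t)" r] L(1) by (metis centre_in_ball)
  obtain a b e where ab: "a < b" "t \<in> {a..b}" "{a..b} \<subseteq> I" "b - a < h" "0 < e" "I \<inter> ball t e \<subseteq> {a..b}"
    by (rule interval_neighbourhood[OF I h(1)]) (rule that)
  have in_chart: "\<gamma> s \<in> fst c" "snd c (\<gamma> s) \<in> ball (snd c (\<gamma> t)) r" if "s \<in> {a..b}" for s
  proof -
    have "dist s t < h" using that ab(2,4) by (auto simp: dist_real_def)
    with h(2)[of s] that ab(3) show "\<gamma> s \<in> fst c" "snd c (\<gamma> s) \<in> ball (snd c (\<gamma> t)) r" by blast+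
  qed
  have ac_ab: "abs_continuous_on a b (snd c \<circ> \<gamma>)"
  proof -
    have "\<gamma> ` {a..b} \<subseteq> fst c" using in_chart(1) by blast
    with ac c(1) ab(1,3) show ?thesis unfolding abs_continuous_curve_def by simp
  qed
  have "continuous_on {a..b} (snd c \<circ> \<gamma>)" by (rule abs_continuous_on_imp_continuous_on[OF ac_ab])
  then have "continuous_on {a..b} (\<lambda>s. normal_field c \<xi> ((snd c \<circ> \<gamma>) s))"
    by (rule continuous_on_compose2[OF field_cont]) (rule image_subsetI, simp only: comp_apply in_chart(2))
  then have g: "continuous_on {a..b} (\<lambda>s. normal_field c \<xi> (snd c (\<gamma> s)))" by (simp only: comp_apply)
  obtain B \<phi> where coord: "coordinates (B :: 'e set) \<phi>" by (rule coordinates_Lie_algebra)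
  have "(snd c \<circ> \<gamma> has_vector_derivative normal_field c \<xi> (snd c (\<gamma> t))) (at t within {a..b})"
  proof (rule abs_continuous_has_vector_derivative[OF coord ab(1) ac_ab g N(1) _ ab(2)])
    fix s x' assume s: "s \<in> {a<..<b} - N" and x': "(snd c \<circ> \<gamma> has_vector_derivative x') (at s)"
    have sI: "s \<in> I - N" "s \<in> {a..b}" using s ab(3) by auto
    have "s \<in> interior I"
    proof -
      have "{a<..<b} \<subseteq> I" using ab(3) by auto
      then have "{a<..<b} \<subseteq> interior I" by (rule interior_maximal) (rule open_greaterThanLessThan)
      then show ?thesis using s by blast
    qed
    from at_within_interior[OF this] have not_bot: "at s within I \<noteq> bot" by simp
    have "s \<in> I" using sI(1) by simp
    from control_in_chart[OF this not_bot cont c(1) in_chart(1)[OF sI(2)] has_vector_derivative_at_within[OF x']]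
    have "control G I \<gamma> s = chart_differential c c\<^sub>1 (\<lambda>h. inv (\<gamma> s) \<otimes> h) (\<gamma> s) x'" .
    then have "x' = dL c (\<gamma> s) (control G I \<gamma> s)"
      by (simp only: dL_inverse(2)[OF c(1) in_chart(1)[OF sI(2)]])
    also have "control G I \<gamma> s = legendre nrm (\<xi> \<circ> Ad G (\<gamma> s))"
      by (rule legendre_Ad_iff[OF sc \<xi>, THEN iffD1, OF N(2)[OF sI(1)]])
    finally show "x' = normal_field c \<xi> (snd c (\<gamma> s))"
      by (simp add: normal_field_def chart_inv_chart[OF is_chart[OF c(1)] in_chart(1)[OF sI(2)]])
  qed
  then show ?thesis using at_within_eq_nhd[OF ab(5,6,3)] by simp
qed

text \<open>The condition that defines normal curves holds at every time and not only almost everywhere, so it can be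
  used at the time at which two curves are compared.\<close>

lemma normal_curve_subgradient:
  assumes sc: "strongly_convex_norm nrm" and I: "is_interval I" "t \<in> I" "u \<in> I" "u \<noteq> t"
    and ac: "abs_continuous_curve \<A> I \<gamma>" and \<xi>: "linear \<xi>"
    and AE: "AE s in lebesgue_on I. \<xi> \<circ> Ad G (\<gamma> s) \<in> subdifferential (energy nrm) (control G I \<gamma> s)"
  shows "\<xi> \<circ> Ad G (\<gamma> t) \<in> subdifferential (energy nrm) (control G I \<gamma> t)"
proof -
  define c where "c = chart_at \<A> (\<gamma> t)"
  have c: "c \<in> \<A>" "\<gamma> t \<in> fst c" unfolding c_def by (rule chart_at)+
  have cont: "continuous_on I \<gamma>" using ac by (simp add: abs_continuous_curve_def)
  have "control G I \<gamma> t = legendre nrm (\<xi> \<circ> Ad G (\<gamma> t))"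
    using control_in_chart[OF I(2) interval_not_isolated[OF I] cont c
        normal_curve_integral_curve[OF sc I ac \<xi> AE c]]
    by (simp add: normal_field_def chart_inv_chart[OF is_chart[OF c(1)] c(2)] dL_inverse(1)[OF c])
  then show ?thesis by (rule legendre_Ad_iff[OF sc \<xi>, THEN iffD2])
qed

text \<open>The set of times at which the curves agree is closed by continuity and open by local uniqueness for the
  differential equation.\<close>

lemma normal_curves_agree:
  assumes sc: "strongly_convex_norm nrm" and I: "is_interval I" "t \<in> I" "u \<in> I" "u \<noteq> t" and \<xi>: "linear \<xi>"
    and ac1: "abs_continuous_curve \<A> I \<gamma>1" and ac2: "abs_continuous_curve \<A> I \<gamma>2"
    and AE1: "AE s in lebesgue_on I. \<xi> \<circ> Ad G (\<gamma>1 s) \<in> subdifferential (energy nrm) (control G I \<gamma>1 s)"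
    and AE2: "AE s in lebesgue_on I. \<xi> \<circ> Ad G (\<gamma>2 s) \<in> subdifferential (energy nrm) (control G I \<gamma>2 s)"
    and init: "\<gamma>1 t = \<gamma>2 t" and s: "s \<in> I"
  shows "\<gamma>1 s = \<gamma>2 s"
proof -
  have cont1: "continuous_on I \<gamma>1" and cont2: "continuous_on I \<gamma>2"
    using ac1 ac2 by (simp_all add: abs_continuous_curve_def)
  define S where "S = {s \<in> I. \<gamma>1 s = \<gamma>2 s}"
  have "closedin (top_of_set I) (I \<inter> (\<lambda>s. (\<gamma>1 s, \<gamma>2 s)) -` {y. \<exists>x. y = (x, x)})"
    by (intro continuous_closedin_preimage closed_diagonal continuous_on_Pair cont1 cont2)
  moreover have "I \<inter> (\<lambda>s. (\<gamma>1 s, \<gamma>2 s)) -` {y. \<exists>x. y = (x, x)} = S" by (auto simp: S_def)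
  ultimately have closed: "closedin (top_of_set I) S" by simp
  have "openin (top_of_set I) S"
    unfolding openin_euclidean_subtopology_iff
  proof (intro conjI ballI)
    show "S \<subseteq> I" by (auto simp: S_def)
    fix t0 assume "t0 \<in> S"
    then have t0: "t0 \<in> I" "\<gamma>1 t0 = \<gamma>2 t0" by (auto simp: S_def)
    have other: "\<exists>u\<in>I. u \<noteq> t'" for t' using I(2-4) by (cases "t = t'") auto
    obtain u where u: "u \<in> I" "u \<noteq> t0" using other by blast
    define c where "c = chart_at \<A> (\<gamma>1 t0)"
    have c: "c \<in> \<A>" "\<gamma>1 t0 \<in> fst c" unfolding c_def by (rule chart_at)+
    have c2: "\<gamma>2 t0 \<in> fst c" using c(2) t0(2) by simp
    obtain h1 where h1: "0 < h1" "\<And>s. \<lbrakk>s \<in> I; dist s t0 < h1\<rbrakk> \<Longrightarrow> \<gamma>1 s \<in> fst c \<and> snd c (\<gamma>1 s) \<in> UNIV"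
      by (rule chart_neighbourhood[OF cont1 t0(1) c open_UNIV]) (auto intro: that)
    obtain h2 where h2: "0 < h2" "\<And>s. \<lbrakk>s \<in> I; dist s t0 < h2\<rbrakk> \<Longrightarrow> \<gamma>2 s \<in> fst c \<and> snd c (\<gamma>2 s) \<in> UNIV"
      by (rule chart_neighbourhood[OF cont2 t0(1) c(1) c2 open_UNIV]) (auto intro: that)
    have "0 < min h1 h2" using h1 h2 by simp
    obtain a b e where ab: "a < b" "t0 \<in> {a..b}" "{a..b} \<subseteq> I" "b - a < min h1 h2" "0 < e" "I \<inter> ball t0 e \<subseteq> {a..b}"
      by (rule interval_neighbourhood[OF I(1) t0(1) u \<open>0 < min h1 h2\<close>]) (rule that)
    have in_chart: "\<gamma>1 s \<in> fst c" "\<gamma>2 s \<in> fst c" if "s \<in> {a..b}" for s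
    proof -
      have "dist s t0 < h1" "dist s t0 < h2" using that ab(2,4) by (auto simp: dist_real_def)
      with h1(2)[of s] h2(2)[of s] that ab(3) show "\<gamma>1 s \<in> fst c" "\<gamma>2 s \<in> fst c" by blast+
    qed
    have der: "((snd c \<circ> \<gamma>) has_vector_derivative normal_field c \<xi> ((snd c \<circ> \<gamma>) s)) (at s within {a..b})"
      if s: "s \<in> {a..b}" and ac: "abs_continuous_curve \<A> I \<gamma>" and mem: "\<gamma> s \<in> fst c"
        and AE: "AE s in lebesgue_on I. \<xi> \<circ> Ad G (\<gamma> s) \<in> subdifferential (energy nrm) (control G I \<gamma> s)" for s \<gamma>
    proof -
      obtain u where u: "u \<in> I" "u \<noteq> s" using other by blast
      have "s \<in> I" using s ab(3) by blast
      from has_vector_derivative_within_subset[OF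
          normal_curve_integral_curve[OF sc I(1) this u ac \<xi> AE c(1) mem] ab(3)]
      show ?thesis by simp
    qed
    have d1: "((snd c \<circ> \<gamma>1) has_vector_derivative normal_field c \<xi> ((snd c \<circ> \<gamma>1) s)) (at s within {a..b})"
      if "s \<in> {a..b}" for s by (rule der[OF that ac1 in_chart(1)[OF that] AE1])
    have d2: "((snd c \<circ> \<gamma>2) has_vector_derivative normal_field c \<xi> ((snd c \<circ> \<gamma>2) s)) (at s within {a..b})"
      if "s \<in> {a..b}" for s by (rule der[OF that ac2 in_chart(2)[OF that] AE2])
    have init1: "(snd c \<circ> \<gamma>1) t0 = snd c (\<gamma>1 t0)" and init2: "(snd c \<circ> \<gamma>2) t0 = snd c (\<gamma>1 t0)"
      using t0(2) by simp_all
    obtain e' where e': "0 < e'" "\<And>s. s \<in> {a..b} \<inter> ball t0 e' \<Longrightarrow> (snd c \<circ> \<gamma>1) s = (snd c \<circ> \<gamma>2) s"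
      by (rule ode_unique_near[OF normal_field_lip_near[OF sc \<xi> c] ab(2) init1 init2 d1 d2]) (assumption+, rule that)
    show "\<exists>e>0. \<forall>s\<in>I. dist s t0 < e \<longrightarrow> s \<in> S"
    proof (intro exI[of _ "min e e'"] conjI ballI impI)
      show "0 < min e e'" using ab(5) e'(1) by simp
      fix s assume s: "s \<in> I" "dist s t0 < min e e'"
      then have "s \<in> {a..b}" using ab(6) by (auto simp: dist_commute)
      moreover from this e'(2)[of s] s have "snd c (\<gamma>1 s) = snd c (\<gamma>2 s)" by (simp add: dist_commute)
      ultimately have "\<gamma>1 s = \<gamma>2 s"
        using in_chart chart_inv_chart[OF is_chart[OF c(1)]] by metis
      then show "s \<in> S" using s(1) by (simp add: S_def)
    qed
  qed
  moreover have "connected I" using I(1) by (simp add: is_interval_connected)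
  ultimately have "S = {} \<or> S = I" using closed by (auto simp: connected_clopen)
  moreover have "t \<in> S" using I(2) init by (simp add: S_def)
  ultimately show ?thesis using s by (auto simp: S_def)
qed

text \<open>The common control determines the subgradient \<open>\<xi> \<circ> Ad (\<gamma> t)\<close>, and, as \<open>Ad (\<gamma> t)\<close> is surjective, the
  covector.\<close>

theorem normal_curve_unique:
  assumes sc: "strongly_convex_norm nrm" and I: "is_interval I" "t \<in> I" "u \<in> I" "u \<noteq> t"
    and normal: "normal_curve G nrm I \<gamma>1" "normal_curve G nrm I \<gamma>2"
    and init: "\<gamma>1 t = \<gamma>2 t" "control G I \<gamma>1 t = control G I \<gamma>2 t"
    and diff: "control G I \<gamma>1 t = 0 \<or> nrm differentiable (at (control G I \<gamma>1 t))"
    and s: "s \<in> I"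
  shows "\<gamma>1 s = \<gamma>2 s"
proof -
  obtain \<xi>1 where 1: "abs_continuous_curve \<A> I \<gamma>1" "linear \<xi>1"
    "AE s in lebesgue_on I. \<xi>1 \<circ> Ad G (\<gamma>1 s) \<in> subdifferential (energy nrm) (control G I \<gamma>1 s)"
    using normal(1) unfolding normal_curve_def by blast
  obtain \<xi>2 where 2: "abs_continuous_curve \<A> I \<gamma>2" "linear \<xi>2"
    "AE s in lebesgue_on I. \<xi>2 \<circ> Ad G (\<gamma>2 s) \<in> subdifferential (energy nrm) (control G I \<gamma>2 s)"
    using normal(2) unfolding normal_curve_def by blast
  have eq: "\<xi>1 \<circ> Ad G (\<gamma>1 t) = \<xi>2 \<circ> Ad G (\<gamma>1 t)"
    by (rule subgradient_unique[OF is_norm diff])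
      (use normal_curve_subgradient[OF sc I 1] normal_curve_subgradient[OF sc I 2] init in simp_all)
  have "\<xi>1 v = \<xi>2 v" for v
    using fun_cong[OF eq, of "Ad G (inv (\<gamma>1 t)) v"] by (simp add: Ad_Ad_inv)
  then have "\<xi>1 = \<xi>2" by (rule ext)
  with 2(3) have "AE s in lebesgue_on I. \<xi>1 \<circ> Ad G (\<gamma>2 s) \<in> subdifferential (energy nrm) (control G I \<gamma>2 s)"
    by simp
  from normal_curves_agree[OF sc I 1(2,1) 2(1) 1(3) this init(1) s] show ?thesis .
qed

end

section \<open>Uniqueness and non-branching\<close>

theorem proposition4p2:
  fixes G :: "('g::{t2_space, second_countable_topology},
    'e::{real_normed_vector, heine_borel, second_countable_topology}) lie_group_structure"
    and nrm :: "'e \<Rightarrow> real"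
  assumes "finsler_lie_group G nrm"
    and "strongly_convex_norm nrm"
  shows "(\<forall>\<gamma>1 \<gamma>2. normal_curve G nrm {0..1} \<gamma>1 \<and> normal_curve G nrm {0..1} \<gamma>2 \<and>
            (\<exists>t\<in>{0..1}. \<gamma>1 t = \<gamma>2 t \<and>
               velocity (atlas G) {0..1} \<gamma>1 t = velocity (atlas G) {0..1} \<gamma>2 t \<and>
               nrm differentiable (at (control G {0..1} \<gamma>1 t)))
            \<longrightarrow> (\<forall>t\<in>{0..1}. \<gamma>1 t = \<gamma>2 t))
       \<and> ((\<forall>v. v \<noteq> 0 \<longrightarrow> nrm differentiable (at v)) \<longrightarrow> \<not> branching_of_normal_curves G nrm)"
proof (intro conjI allI impI ballI notI)
  interpret finsler_lie_group G nrm by fact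
  fix \<gamma>1 \<gamma>2 and s :: real
  assume *: "normal_curve G nrm {0..1} \<gamma>1 \<and> normal_curve G nrm {0..1} \<gamma>2 \<and>
            (\<exists>t\<in>{0..1}. \<gamma>1 t = \<gamma>2 t \<and>
               velocity (atlas G) {0..1} \<gamma>1 t = velocity (atlas G) {0..1} \<gamma>2 t \<and>
               nrm differentiable (at (control G {0..1} \<gamma>1 t)))" and s: "s \<in> {0..1}"
  then obtain t where t: "t \<in> {0..1}" "\<gamma>1 t = \<gamma>2 t"
    "velocity (atlas G) {0..1} \<gamma>1 t = velocity (atlas G) {0..1} \<gamma>2 t"
    "nrm differentiable (at (control G {0..1} \<gamma>1 t))" by blast
  have "\<exists>u\<in>{0..1::real}. u \<noteq> t" by (rule bexI[of _ "if t = 0 then 1 else 0"]) auto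
  then obtain u where u: "u \<in> {0..1}" "u \<noteq> t" by blast
  have normal: "normal_curve G nrm {0..1} \<gamma>1" "normal_curve G nrm {0..1} \<gamma>2" using * by auto
  have "control G {0..1} \<gamma>1 t = control G {0..1} \<gamma>2 t" by (simp add: control_def t(2,3))
  from normal_curve_unique[OF assms(2) is_interval_cc t(1) u normal t(2) this disjI2[OF t(4)] s]
  show "\<gamma>1 s = \<gamma>2 s" .
next
  interpret finsler_lie_group G nrm by fact
  (* at an interior time of J both curves have the same germ, hence the same control *)
  assume diff: "\<forall>v. v \<noteq> 0 \<longrightarrow> nrm differentiable (at v)" and "branching_of_normal_curves G nrm"
  then obtain I J \<gamma>1 \<gamma>2 s where I: "is_interval I" "J \<subseteq> I" "interior J \<noteq> {}"
    and normal: "normal_curve G nrm I \<gamma>1" "normal_curve G nrm I \<gamma>2"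
    and s: "s \<in> I" "\<gamma>1 s \<noteq> \<gamma>2 s" and eq: "\<forall>t\<in>J. \<gamma>1 t = \<gamma>2 t"
    unfolding branching_of_normal_curves_def by blast
  obtain t where t: "t \<in> interior J" using I(3) by blast
  then have tJ: "t \<in> J" using interior_subset by blast
  have tI: "t \<in> I" using tJ I(2) by blast
  have st: "s \<noteq> t" using s(2) eq tJ by blast
  have "\<forall>\<^sub>F x in nhds t. x \<in> interior J" using t by (intro eventually_nhds_in_open) auto
  then have "\<forall>\<^sub>F x in nhds t. x \<in> I \<longrightarrow> (snd (chart_at (atlas G) (\<gamma>1 t)) \<circ> \<gamma>1) x = (snd (chart_at (atlas G) (\<gamma>1 t)) \<circ> \<gamma>2) x"
  proof eventually_elim
    case (elim x)
    then have "x \<in> J" using interior_subset by blast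
    with eq show ?case by simp
  qed
  then have "velocity (atlas G) I \<gamma>1 t = velocity (atlas G) I \<gamma>2 t"
    using eq tJ unfolding velocity_def by (simp add: vector_derivative_cong_eq[OF _ refl refl tI])
  then have control: "control G I \<gamma>1 t = control G I \<gamma>2 t" using eq tJ by (simp add: control_def)
  have "\<gamma>1 t = \<gamma>2 t" using eq tJ by blast
  moreover have "control G I \<gamma>1 t = 0 \<or> nrm differentiable (at (control G I \<gamma>1 t))" using diff by blast
  ultimately have "\<gamma>1 s = \<gamma>2 s"
    using normal_curve_unique[OF assms(2) I(1) tI s(1) st normal _ control _ s(1)] by blast
  with s(2) show False ..
qed

end
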